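(* Let $d=2$ and consider the Gaussian white noise model with $A$ the two-dimensional Radon transform. Let $$\mathcal{F}=\Big\{\sum_{j_1,j_2\ge0,\,(j_1,j_2)\ne(0,0)}\theta_{j_1j_2}\phi_{j_1j_2}:(\theta_{j_1j_2})\in\Theta\Big\},\qquad \Theta=\Big\{\theta:\sum_{j_1,j_2\ge0,\,(j_1,j_2)\ne(0,0)}a_{j_1j_2}^2\theta_{j_1j_2}^2\le L^2\Big\},$$ where $L>0$ and $\phi_{j_1j_2}$ is the real orthonormal singular basis of the Radon transform (given in the context). Assume that $$C_0(j_1+j_2)^s\le a_{j_1j_2}\le C_1(j_1+j_2)^s$$ for some $s>0$ and $C_0,C_1>0$. Then, for $d=2$, $$\limsup_{n\to\infty}n^{2s/(2s+2d-1)}\sup_{f\in\mathcal{F}}E_f\|\hat f-f\|_2^2<\infty,$$ where $\hat f$ is the $\delta$-net estimator (with $\delta=n^{-s/(2s+2d-1)}$, over the net described in the context). Also, $$\liminf_{n\to\infty}n^{2s/(2s+2d-1)}\inf_{\hat g}\sup_{f\in\mathcal{F}}E_f\|\hat g-f\|_2^2>0,$$ where the infimum is taken over all estimators $\hat g$.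
   Context: Radon transform. $D=\{x\in\mathbf{R}^2:\|x\|\le1\}$ and, for functions $f$ on $D$ in $L_1(D)\cap L_2(D)$, $$Af(u,\phi)=\frac{\pi}{2\sqrt{1-u^2}}\int_{-\sqrt{1-u^2}}^{\sqrt{1-u^2}}f(u\cos\phi-t\sin\phi,\ u\sin\phi+t\cos\phi)\,dt,\qquad (u,\phi)\in\mathbf{Y}=[0,1]\times[0,2\pi),$$ regarded as an element of $L_2(\mathbf{Y},\nu)$ with $d\nu(u,\phi)=2\pi^{-1}\sqrt{1-u^2}\,du\,d\phi$. $\|\cdot\|_2$ denotes the $L_2$-norm (Lebesgue measure on $D$, $\nu$ on $\mathbf{Y}$). Basis. In polar coordinates, $\tilde\phi_{jk}(r,\theta)=\pi^{-1/2}(j+k+1)^{1/2}Z_{j+k}^{|j-k|}(r)e^{i(j-k)\theta}$, where $Z_a^b$ is the Zernike polynomial of degree $a$ and order $b$, and $\phi_{jk}=\sqrt2\,\mathrm{Re}(\tilde\phi_{jk})$ if $j>k$, $\phi_{jk}=\tilde\phi_{jk}$ if $j=k$, $\phi_{jk}=\sqrt2\,\mathrm{Im}(\tilde\phi_{jk})$ if $j<k$. These are singular functions of $A$. Gaussian white noise model: one observes $dY_n(y)=(Af)(y)\,dy+n^{-1/2}dW(y)$, $y\in\mathbf{Y}$, i.e. $\int h\,dY_n=\int_{\mathbf{Y}}h\,(Af)\,d\nu+n^{-1/2}\int h\,dW$ for $h\in L_2(\mathbf{Y},\nu)$, where $(\int h_1dW,\int h_2dW)$ is mean-zero Gaussian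 with variances $\|h_1\|_2^2,\|h_2\|_2^2$ and covariance $\int_{\mathbf{Y}}h_1h_2\,d\nu$. $E_f$ is expectation under $f$; estimators are measurable functions of the observed process. $\delta$-net estimator: $\hat f=\arg\min_{\phi\in\mathcal{F}_\delta}\gamma_n(\phi)$, where $\gamma_n(g)=-2\int_{\mathbf{Y}}(Qg)\,dY_n+\|g\|_2^2$ and $Q=(A^{-1})^*$ is the adjoint of the inverse of $A$ (so $\int_D fg=\int_{\mathbf{Y}}(Af)(Qg)\,d\nu$). The net $\mathcal{F}_\delta=\{\sum\theta_{j_1j_2}\phi_{j_1j_2}:\theta\in\Theta_\delta\}$ is a finite $\delta$-net of $\mathcal{F}$ in $L_2$ (each $f\in\mathcal{F}$ is within $L_2$-distance $\delta$ of an element of $\mathcal{F}_\delta$) such that every $\theta\in\Theta_\delta$ has $\theta_{j_1j_2}=0$ for $(j_1,j_2)\notin\{0,\ldots,M\}^2$, with $M\asymp\delta^{-1/s}$, and $\log(\#\mathcal{F}_\delta)\le C\delta^{-d/s}$ with $C$ not depending on $\delta$. *)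

theory Defs
  imports "HOL-Probability.Probability" "HOL-Library.Landau_Symbols"
begin

section \<open>Real square-integrable functions\<close>

text \<open>Elements of \<open>L2 M\<close> are functions, not equivalence classes; the objects built on it below
  respect equality almost everywhere.\<close>

definition L2 :: "'a measure \<Rightarrow> ('a \<Rightarrow> real) set" where
  "L2 M = {f \<in> borel_measurable M. integrable M (\<lambda>x. (f x)\<^sup>2)}"

definition l2_inner :: "'a measure \<Rightarrow> ('a \<Rightarrow> real) \<Rightarrow> ('a \<Rightarrow> real) \<Rightarrow> real" where
  "l2_inner M f g = (\<integral>x. f x * g x \<partial>M)"

definition l2_norm :: "'a measure \<Rightarrow> ('a \<Rightarrow> real) \<Rightarrow> real" where
  "l2_norm M f = sqrt (\<integral>x. (f x)\<^sup>2 \<partial>M)"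

definition l2_dist :: "'a measure \<Rightarrow> ('a \<Rightarrow> real) \<Rightarrow> ('a \<Rightarrow> real) \<Rightarrow> real" where
  "l2_dist M f g = l2_norm M (\<lambda>x. f x - g x)"

text \<open>The Borel sigma-algebra of the topology given by the \<open>L\<^sub>2\<close>-distance.\<close>

definition l2_borel :: "'a measure \<Rightarrow> ('a \<Rightarrow> real) measure" where
  "l2_borel M = sigma (L2 M)
     {U. U \<subseteq> L2 M \<and> (\<forall>f\<in>U. \<exists>e>0. \<forall>g\<in>L2 M. l2_dist M g f < e \<longrightarrow> g \<in> U)}"

definition l2_closure :: "'a measure \<Rightarrow> ('a \<Rightarrow> real) set \<Rightarrow> ('a \<Rightarrow> real) set" where
  "l2_closure M S = {h \<in> L2 M. \<forall>e>0. \<exists>g\<in>S. l2_dist M h g < e}"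


section \<open>The Radon transform\<close>

definition disk :: "(real \<times> real) measure" where
  "disk = restrict_space lborel (cball 0 1)"

definition cyl :: "(real \<times> real) measure" where
  "cyl = density (restrict_space lborel ({0..1} \<times> {0..<2 * pi}))
           (\<lambda>(u, \<phi>). ennreal (2 / pi * sqrt (1 - u\<^sup>2)))"

text \<open>The domain of the transform is \<open>L2 disk\<close>, which is contained in \<open>L\<^sub>1\<close> since the disk has
  finite measure.\<close>

definition radon :: "(real \<times> real \<Rightarrow> real) \<Rightarrow> real \<times> real \<Rightarrow> real" where
  "radon f = (\<lambda>(u, \<phi>). pi / (2 * sqrt (1 - u\<^sup>2)) *
     set_lebesgue_integral lborel {- sqrt (1 - u\<^sup>2) .. sqrt (1 - u\<^sup>2)}
       (\<lambda>t. f (u * cos \<phi> - t * sin \<phi>, u * sin \<phi> + t * cos \<phi>)))"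

text \<open>The adjoint of the inverse. The inverse of the transform is an operator from the range of
  \<open>radon\<close>, a dense subspace of the Hilbert space obtained as the closure of that range, to
  \<open>L2 disk\<close>. The range is not dense in \<open>L2 cyl\<close>, so the defining identity alone would
  determine \<open>Q g\<close> only up to its orthogonal complement; membership in the closure makes
  \<open>Q g\<close> unique up to a null set.\<close>

definition radon_Q :: "(real \<times> real \<Rightarrow> real) \<Rightarrow> real \<times> real \<Rightarrow> real" where
  "radon_Q g = (SOME h. h \<in> l2_closure cyl (radon ` L2 disk) \<and>
     (\<forall>f\<in>L2 disk. l2_inner disk f g = l2_inner cyl (radon f) h))"


section \<open>The singular basis\<close>

text \<open>The radial Zernike polynomial of degree \<open>a\<close> and order \<open>b\<close>, for \<open>b \<le> a\<close> and \<open>a - b\<close> even,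
  normalised by the value 1 at \<open>r = 1\<close>.\<close>

definition zernike :: "nat \<Rightarrow> nat \<Rightarrow> real \<Rightarrow> real" where
  "zernike a b r = (\<Sum>l = 0..(a - b) div 2.
     (-1) ^ l * fact (a - l) /
       (fact l * fact ((a + b) div 2 - l) * fact ((a - b) div 2 - l)) * r ^ (a - 2 * l))"

definition basis_polar :: "nat \<Rightarrow> nat \<Rightarrow> real \<Rightarrow> real \<Rightarrow> complex" where
  "basis_polar j k r \<theta> =
     of_real (pi powr (-1/2) * real (j + k + 1) powr (1/2)
       * zernike (j + k) (nat \<bar>int j - int k\<bar>) r) * cis ((real j - real k) * \<theta>)"

definition basis_complex :: "nat \<Rightarrow> nat \<Rightarrow> real \<times> real \<Rightarrow> complex" where
  "basis_complex j k x = basis_polar j k (norm x) (Arg (Complex (fst x) (snd x)))"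

definition basis :: "nat \<Rightarrow> nat \<Rightarrow> real \<times> real \<Rightarrow> real" where
  "basis j k x =
     (if j > k then sqrt 2 * Re (basis_complex j k x)
      else if j = k then Re (basis_complex j k x)
      else sqrt 2 * Im (basis_complex j k x))"


section \<open>The function class\<close>

definition ellipsoid :: "(nat \<Rightarrow> nat \<Rightarrow> real) \<Rightarrow> real \<Rightarrow> (nat \<Rightarrow> nat \<Rightarrow> real) set" where
  "ellipsoid a L = {\<theta>.
     (\<lambda>(j, k). (a j k)\<^sup>2 * (\<theta> j k)\<^sup>2) summable_on (- {(0, 0)}) \<and>
     infsum (\<lambda>(j, k). (a j k)\<^sup>2 * (\<theta> j k)\<^sup>2) (- {(0, 0)}) \<le> L\<^sup>2}"

definition has_expansion :: "(real \<times> real \<Rightarrow> real) \<Rightarrow> (nat \<Rightarrow> nat \<Rightarrow> real) \<Rightarrow> bool" where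
  "has_expansion f \<theta> \<longleftrightarrow>
     ((\<lambda>S. l2_dist disk f (\<lambda>x. \<Sum>(j, k)\<in>S. \<theta> j k * basis j k x)) \<longlongrightarrow> 0)
       (finite_subsets_at_top (- {(0, 0)}))"

definition fun_class :: "(nat \<Rightarrow> nat \<Rightarrow> real) \<Rightarrow> real \<Rightarrow> (real \<times> real \<Rightarrow> real) set" where
  "fun_class a L = {f \<in> L2 disk. \<exists>\<theta>\<in>ellipsoid a L. has_expansion f \<theta>}"


section \<open>The Gaussian white noise model\<close>

text \<open>Centred normal law of variance \<open>v\<close>; for \<open>v = 0\<close> this is the point mass at 0.\<close>

definition centered_normal :: "'w measure \<Rightarrow> ('w \<Rightarrow> real) \<Rightarrow> real \<Rightarrow> bool" where
  "centered_normal P X v \<longleftrightarrow> X \<in> borel_measurable P \<and>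
     (if v = 0 then (AE \<omega> in P. X \<omega> = 0)
      else v > 0 \<and> distributed P lborel X (\<lambda>x. ennreal (normal_density 0 (sqrt v) x)))"

text \<open>A pair is jointly normal iff all its linear combinations are normal; degenerate covariance
  matrices are allowed.\<close>

definition centered_normal_pair ::
    "'w measure \<Rightarrow> ('w \<Rightarrow> real) \<Rightarrow> ('w \<Rightarrow> real) \<Rightarrow> real \<Rightarrow> real \<Rightarrow> real \<Rightarrow> bool" where
  "centered_normal_pair P X Y vX vY c \<longleftrightarrow>
     (\<forall>a b. centered_normal P (\<lambda>\<omega>. a * X \<omega> + b * Y \<omega>) (a\<^sup>2 * vX + 2 * a * b * c + b\<^sup>2 * vY))"

text \<open>\<open>W h\<close> is the stochastic integral of \<open>h\<close>. Joint normality of pairs with these covariances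
  makes \<open>W\<close> linear almost surely and hence a Gaussian process.\<close>

definition white_noise :: "'a measure \<Rightarrow> 'w measure \<Rightarrow> (('a \<Rightarrow> real) \<Rightarrow> 'w \<Rightarrow> real) \<Rightarrow> bool" where
  "white_noise N P W \<longleftrightarrow> prob_space P \<and>
     (\<forall>h1\<in>L2 N. \<forall>h2\<in>L2 N. centered_normal_pair P (W h1) (W h2)
        ((l2_norm N h1)\<^sup>2) ((l2_norm N h2)\<^sup>2) (l2_inner N h1 h2))"

text \<open>The sample space of the observed process, a family of reals indexed by the test functions.\<close>

definition obs_space :: "((real \<times> real \<Rightarrow> real) \<Rightarrow> real) measure" where
  "obs_space = (\<Pi>\<^sub>M h\<in>L2 cyl. borel)"

definition observe ::
    "((real \<times> real \<Rightarrow> real) \<Rightarrow> 'w \<Rightarrow> real) \<Rightarrow> nat \<Rightarrow> (real \<times> real \<Rightarrow> real) \<Rightarrow> 'w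
       \<Rightarrow> (real \<times> real \<Rightarrow> real) \<Rightarrow> real" where
  "observe W n f \<omega> =
     (\<lambda>h\<in>L2 cyl. l2_inner cyl h (radon f) + real n powr (-1/2) * W h \<omega>)"

definition estimators ::
    "(((real \<times> real \<Rightarrow> real) \<Rightarrow> real) \<Rightarrow> real \<times> real \<Rightarrow> real) set" where
  "estimators = measurable obs_space (l2_borel disk)"

definition risk ::
    "'w measure \<Rightarrow> ((real \<times> real \<Rightarrow> real) \<Rightarrow> 'w \<Rightarrow> real) \<Rightarrow> nat
       \<Rightarrow> (((real \<times> real \<Rightarrow> real) \<Rightarrow> real) \<Rightarrow> real \<times> real \<Rightarrow> real)
       \<Rightarrow> (real \<times> real \<Rightarrow> real) \<Rightarrow> ennreal" where
  "risk P W n fhat f = (\<integral>\<^sup>+\<omega>. ennreal ((l2_dist disk (fhat (observe W n f \<omega>)) f)\<^sup>2) \<partial>P)"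


section \<open>The net estimator\<close>

text \<open>Used for finitely supported \<open>\<theta>\<close> only.\<close>

definition fin_expansion :: "(nat \<Rightarrow> nat \<Rightarrow> real) \<Rightarrow> real \<times> real \<Rightarrow> real" where
  "fin_expansion \<theta> x = (\<Sum>(j, k) | \<theta> j k \<noteq> 0. \<theta> j k * basis j k x)"

definition net_funs :: "(nat \<Rightarrow> nat \<Rightarrow> real) set \<Rightarrow> (real \<times> real \<Rightarrow> real) set" where
  "net_funs T = fin_expansion ` T"

definition is_delta_net ::
    "(real \<times> real \<Rightarrow> real) set \<Rightarrow> real \<Rightarrow> (real \<times> real \<Rightarrow> real) set \<Rightarrow> bool" where
  "is_delta_net F \<delta> G \<longleftrightarrow> finite G \<and> (\<forall>f\<in>F. \<exists>g\<in>G. l2_dist disk f g \<le> \<delta>)"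

definition admissible_nets ::
    "(real \<times> real \<Rightarrow> real) set \<Rightarrow> real \<Rightarrow> nat \<Rightarrow> (real \<Rightarrow> (nat \<Rightarrow> nat \<Rightarrow> real) set) \<Rightarrow> bool" where
  "admissible_nets F s d T \<longleftrightarrow>
     (\<forall>\<delta>>0. is_delta_net F \<delta> (net_funs (T \<delta>))) \<and>
     (\<exists>M :: real \<Rightarrow> nat.
        (\<forall>\<delta>>0. \<forall>\<theta>\<in>T \<delta>. \<forall>j k. (j, k) \<notin> {0..M \<delta>} \<times> {0..M \<delta>} \<longrightarrow> \<theta> j k = 0) \<and>
        (\<lambda>\<delta>. real (M \<delta>)) \<in> \<Theta>[at_right 0](\<lambda>\<delta>. \<delta> powr (- 1 / s))) \<and>
     (\<exists>C. \<forall>\<^sub>F \<delta> in at_right 0. ln (real (card (net_funs (T \<delta>)))) \<le> C * \<delta> powr (- real d / s))"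

definition emp_risk ::
    "((real \<times> real \<Rightarrow> real) \<Rightarrow> real) \<Rightarrow> (real \<times> real \<Rightarrow> real) \<Rightarrow> real" where
  "emp_risk y g = - 2 * y (radon_Q g) + (l2_norm disk g)\<^sup>2"

text \<open>Minimisers over the net need not be unique; every measurable selection is admitted.\<close>

definition is_net_estimator ::
    "(real \<times> real \<Rightarrow> real) set
       \<Rightarrow> (((real \<times> real \<Rightarrow> real) \<Rightarrow> real) \<Rightarrow> real \<times> real \<Rightarrow> real) \<Rightarrow> bool" where
  "is_net_estimator G fhat \<longleftrightarrow> fhat \<in> estimators \<and>
     (\<forall>y\<in>space obs_space. is_arg_min (emp_risk y) (\<lambda>g. g \<in> G) (fhat y))"

end

theory Submission
  imports Defs
begin

text \<open>The ridge functions \<open>U\<^sub>n(x \<bullet> e\<^sub>\<alpha>)\<close>, with \<open>U\<^sub>n\<close> the Chebyshev polynomials of the second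
  kind, carry the whole singular value decomposition: averaging them over \<open>\<alpha>\<close> against a
  trigonometric function gives the basis, and their Radon transforms are explicit. Hence the
  transform has singular values \<open>\<pi> / sqrt (j + k + 1)\<close>.

  Upper bound: on functions of degree at most \<open>m\<close> the operator \<open>Q\<close> increases the squared norm by at
  most a factor of order \<open>m\<close>, so the noise in the empirical risk over the net is a maximum of
  Gaussian variables of variance of order \<open>M / n\<close>. This gives a risk of order
  \<open>\<delta>\<^sup>2 + M ln (card G) / n\<close>, which \<open>\<delta>\<close> balances.

  Lower bound: Assouad's lemma for a cube spanned by the basis functions with \<open>j, k\<close> in
  \<open>{M+1..2M}\<close>. For neighbouring vertices the component of the noise in the direction of the
  difference of the two drifts is split off as an independent normal variable; the process is
  indexed by all of \<open>L\<^sub>2\<close>, so this rests on the uniqueness of joint laws given the laws of linear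
  combinations.\<close>

section \<open>Fourier integrals over the circle\<close>

text \<open>The rate: put x = delta^(-1/s). The noise term of the net estimator is of order x * x^2
  / n, and equating it with delta^2 = x^(-2s) gives n of order x^(2s+3). The lower bound meets the
  same equation: M^2 coordinates of size tau^2 ~ M^(-2s-2) fit into the ellipsoid, and one flip
  moves the data by at most one noise unit as long as n * tau^2 is of order M. The cylinder contains
  only the half u \<ge> 0, so Chebyshev orthogonality is needed on half of its interval. It survives
  because degree and angular frequency have the same parity, which is the invariance under (u, a) ->
  (-u, a + pi). Orthonormality of the basis is read off from its image, so no radial integral of
  Zernike polynomials is computed. Three features of the model shape the probabilistic part.
  \<open>radon_Q\<close> is a choice, fixed only almost everywhere. White noise is specified through
  pairs, so linearity in the test function has to be derived, and each instance holds off its own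
  null set. The index set is uncountable, so laws are compared on finitely many coordinates instead
  of through likelihood ratios.\<close>

definition circ :: "real measure" where
  "circ = restrict_space lborel {0..<2 * pi}"

lemma space_circ [simp]: "space circ = {0..<2 * pi}"
  by (simp add: circ_def space_restrict_space)

lemma measurable_circ: "f \<in> borel_measurable borel \<Longrightarrow> f \<in> borel_measurable circ"
  unfolding circ_def by (simp add: measurable_restrict_space1)

lemma finite_measure_circ: "finite_measure circ"
  by (rule finite_measureI) (simp add: circ_def emeasure_restrict_space space_restrict_space)

lemma circ_integral_eq:
  fixes f :: "real \<Rightarrow> real"
  assumes "f \<in> borel_measurable borel"
  shows "(\<integral>x. f x \<partial>circ) = set_lebesgue_integral lborel {0..2 * pi} f"
    and "set_integrable lborel {0..2 * pi} f \<Longrightarrow> integrable circ f"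
proof -
  have ae: "AE x in lborel. indicator {0..<2 * pi} x *\<^sub>R f x = indicator {0..2 * pi} x *\<^sub>R f x"
    using AE_lborel_singleton[of "2 * pi"] by eventually_elim (auto simp: indicator_def)
  note [measurable] = assms
  have m1: "(\<lambda>x. indicator {0..<2 * pi} x *\<^sub>R f x) \<in> borel_measurable lborel"
    using assms by simp
  have m2: "(\<lambda>x. indicator {0..2 * pi} x *\<^sub>R f x) \<in> borel_measurable lborel"
    using assms by simp
  have "(\<integral>x. f x \<partial>circ) = (\<integral>x. indicator {0..<2 * pi} x *\<^sub>R f x \<partial>lborel)"
    unfolding circ_def by (subst integral_restrict_space) auto
  also have "\<dots> = (\<integral>x. indicator {0..2 * pi} x *\<^sub>R f x \<partial>lborel)"
    by (rule integral_cong_AE[OF m1 m2 ae])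
  finally show "(\<integral>x. f x \<partial>circ) = set_lebesgue_integral lborel {0..2 * pi} f"
    by (simp add: set_lebesgue_integral_def)
  show "integrable circ f" if "set_integrable lborel {0..2 * pi} f"
    using that unfolding set_integrable_def integrable_cong_AE[OF m1 m2 ae, symmetric] circ_def
    by (subst integrable_restrict_space) auto
qed

lemma circ_FTC:
  fixes f :: "real \<Rightarrow> real"
  assumes "\<And>x. (F has_real_derivative f x) (at x)" and c: "continuous_on UNIV f"
  shows "has_bochner_integral circ f (F (2 * pi) - F 0)"
proof -
  have b: "f \<in> borel_measurable borel"
    using c by (rule borel_measurable_continuous_onI)
  have i: "set_integrable lborel {0..2 * pi} f"
    by (rule borel_integrable_atLeastAtMost')
      (use c continuous_on_subset in blast)
  have "(LBINT x. f x * indicator {0..2 * pi} x) = F (2 * pi) - F 0"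
    by (rule integral_FTC_Icc_real)
      (use assms c in \<open>auto simp: continuous_on_eq_continuous_at\<close>)
  then have "set_lebesgue_integral lborel {0..2 * pi} f = F (2 * pi) - F 0"
    by (simp add: set_lebesgue_integral_def mult.commute)
  with circ_integral_eq[OF b] i show ?thesis
    by (auto simp: has_bochner_integral_iff)
qed

lemma circ_cos: "has_bochner_integral circ (\<lambda>x. cos (of_int p * x)) (if p = 0 then 2 * pi else 0)"
proof (cases "p = 0")
  case True
  then show ?thesis
    using circ_FTC[of "\<lambda>x. x" "\<lambda>x. 1"] by simp
next
  case False
  have s: "sin (of_int p * (2 * pi)) = 0"
    using sin_integer_2pi[of "of_int p"] by (simp add: mult.commute mult.left_commute)
  show ?thesis
    by (rule circ_FTC[of "\<lambda>x. sin (of_int p * x) / of_int p" "\<lambda>x. cos (of_int p * x)", THEN has_bochner_integral_cong[THEN iffD1, rotated -1]])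
      (use False s in \<open>auto intro!: derivative_eq_intros continuous_intros\<close>)
qed

lemma circ_sin: "has_bochner_integral circ (\<lambda>x. sin (of_int p * x)) 0"
proof (cases "p = 0")
  case True
  then show ?thesis using has_bochner_integral_zero[of circ] by simp
next
  case False
  have s: "cos (of_int p * (2 * pi)) = 1"
    using cos_int_2pin[of p] by (simp add: mult_ac)
  show ?thesis
    by (rule circ_FTC[of "\<lambda>x. - cos (of_int p * x) / of_int p" "\<lambda>x. sin (of_int p * x)", THEN has_bochner_integral_cong[THEN iffD1, rotated -1]])
      (use False s in \<open>auto intro!: derivative_eq_intros continuous_intros\<close>)
qed

text \<open>Real Fourier system with mean square 1 over the circle. With m = j - k the sign of m
  selects the real or imaginary part exactly as in \<open>basis\<close>; for m < 0 the sine keeps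
  its negative frequency, which is the sign that \<open>Im\<close> produces there.\<close>

definition ang :: "int \<Rightarrow> real \<Rightarrow> real" where
  "ang m x = (if m > 0 then sqrt 2 * cos (of_int m * x) else if m = 0 then 1
    else sqrt 2 * sin (of_int m * x))"

lemma ang_measurable [measurable]: "ang m \<in> borel_measurable borel"
  unfolding ang_def by (cases "m > 0"; cases "m = 0"; simp)

lemma abs_ang_le: "\<bar>ang m x\<bar> \<le> 2"
proof -
  have "sqrt 2 * \<bar>cos y\<bar> \<le> 2 * 1" "sqrt 2 * \<bar>sin y\<bar> \<le> 2 * 1" for y
    by (rule mult_mono; simp add: real_sqrt_le_iff real_le_lsqrt)+
  then show ?thesis
    by (auto simp: ang_def abs_mult)
qed

lemma circ_cos_cos: "has_bochner_integral circ (\<lambda>x. cos (of_int p * x) * cos (of_int q * x))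
   (pi * (of_bool (p = q) + of_bool (p = - q)))"
proof -
  have e: "cos (of_int p * x) * cos (of_int q * x) =
     (cos (of_int (p - q) * x) + cos (of_int (p + q) * x)) / 2" for x :: real
    by (simp add: cos_times_cos algebra_simps)
  show ?thesis unfolding e
    by (rule has_bochner_integral_cong[THEN iffD1, OF refl refl _
        has_bochner_integral_divide_zero[OF has_bochner_integral_add[OF circ_cos[of "p-q"] circ_cos[of "p+q"]]]])
      auto
qed

lemma circ_sin_sin: "has_bochner_integral circ (\<lambda>x. sin (of_int p * x) * sin (of_int q * x))
   (pi * (of_bool (p = q) - of_bool (p = - q)))"
proof -
  have e: "sin (of_int p * x) * sin (of_int q * x) =
     (cos (of_int (p - q) * x) - cos (of_int (p + q) * x)) / 2" for x :: real
    by (simp add: sin_times_sin algebra_simps)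
  show ?thesis unfolding e
    by (rule has_bochner_integral_cong[THEN iffD1, OF refl refl _
        has_bochner_integral_divide_zero[OF has_bochner_integral_diff[OF circ_cos[of "p-q"] circ_cos[of "p+q"]]]])
      auto
qed

lemma circ_sin_cos: "has_bochner_integral circ (\<lambda>x. sin (of_int p * x) * cos (of_int q * x)) 0"
proof -
  have e: "sin (of_int p * x) * cos (of_int q * x) =
     (sin (of_int (p + q) * x) + sin (of_int (p - q) * x)) / 2" for x :: real
    by (simp add: distrib_right left_diff_distrib sin_add sin_diff)
  show ?thesis unfolding e
    using has_bochner_integral_divide_zero[OF has_bochner_integral_add[OF circ_sin[of "p+q"] circ_sin[of "p-q"]], of 2]
    by simp
qed

text \<open>Convolution with a cosine is diagonal in this Fourier system: each of the frequencies p
  and -p that meets m contributes pi. For p = m = 0 both indicators are true, which yields the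
  required 2 * pi.\<close>

lemma circ_cos_ang:
  "has_bochner_integral circ (\<lambda>x. cos (of_int p * (x - t)) * ang m x)
     (pi * (of_bool (p = m) + of_bool (p = - m)) * ang m t)"
proof -
  have e: "cos (of_int p * (x - t)) = cos (of_int p * t) * cos (of_int p * x) + sin (of_int p * t) * sin (of_int p * x)"
    for x by (simp add: right_diff_distrib cos_diff)
  consider "m > 0" | "m = 0" | "m < 0" by linarith
  then show ?thesis
  proof cases
    case 1
    have h: "has_bochner_integral circ (\<lambda>x. sqrt 2 * cos (of_int p * t) * (cos (of_int p * x) * cos (of_int m * x))
        + sqrt 2 * sin (of_int p * t) * (sin (of_int p * x) * cos (of_int m * x)))
       (sqrt 2 * cos (of_int p * t) * (pi * (of_bool (p = m) + of_bool (p = - m))) + sqrt 2 * sin (of_int p * t) * 0)"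
      by (intro has_bochner_integral_add has_bochner_integral_mult_right circ_cos_cos circ_sin_cos)
    show ?thesis unfolding e
      by (rule has_bochner_integral_cong[THEN iffD1, OF refl _ _ h])
        (use 1 in \<open>auto simp: ang_def algebra_simps of_bool_def\<close>)
  next
    case 2
    have h: "has_bochner_integral circ (\<lambda>x. cos (of_int p * t) * cos (of_int p * x) + sin (of_int p * t) * sin (of_int p * x))
       (cos (of_int p * t) * (if p = 0 then 2 * pi else 0) + sin (of_int p * t) * 0)"
      by (intro has_bochner_integral_add has_bochner_integral_mult_right circ_cos circ_sin)
    show ?thesis unfolding e
      by (rule has_bochner_integral_cong[THEN iffD1, OF refl _ _ h])
        (use 2 in \<open>auto simp: ang_def algebra_simps of_bool_def\<close>)
  next
    case 3
    have sc: "has_bochner_integral circ (\<lambda>x. cos (of_int p * x) * sin (of_int m * x)) 0"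
      using circ_sin_cos[of m p] by (simp add: mult.commute)
    have h: "has_bochner_integral circ (\<lambda>x. sqrt 2 * cos (of_int p * t) * (cos (of_int p * x) * sin (of_int m * x))
        + sqrt 2 * sin (of_int p * t) * (sin (of_int p * x) * sin (of_int m * x)))
       (sqrt 2 * cos (of_int p * t) * 0 + sqrt 2 * sin (of_int p * t) * (pi * (of_bool (p = m) - of_bool (p = - m))))"
      by (intro has_bochner_integral_add has_bochner_integral_mult_right sc circ_sin_sin)
    show ?thesis unfolding e
      by (rule has_bochner_integral_cong[THEN iffD1, OF refl _ _ h])
        (use 3 in \<open>auto simp: ang_def algebra_simps of_bool_def\<close>)
  qed
qed

lemma circ_ang_ang:
  "has_bochner_integral circ (\<lambda>x. ang m x * ang k x) (2 * pi * of_bool (m = k))"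
proof -
  have c: "has_bochner_integral circ (\<lambda>x. cos (of_int p * x) * ang k x)
     (pi * (of_bool (p = k) + of_bool (p = - k)) * ang k 0)" for p
    using circ_cos_ang[of p 0 k] by simp
  consider "m \<ge> 0" | "m < 0" "k \<ge> 0" | "m < 0" "k < 0" by linarith
  then show ?thesis
  proof cases
    case 1
    have h: "has_bochner_integral circ (\<lambda>x. (if m = 0 then 1 else sqrt 2) * (cos (of_int m * x) * ang k x))
       ((if m = 0 then 1 else sqrt 2) * (pi * (of_bool (m = k) + of_bool (m = - k)) * ang k 0))"
      by (intro has_bochner_integral_mult_right c)
    show ?thesis
      by (rule has_bochner_integral_cong[THEN iffD1, OF refl _ _ h])
        (use 1 in \<open>auto simp: ang_def of_bool_def\<close>)
  next
    case 2
    have h: "has_bochner_integral circ (\<lambda>x. (sqrt 2 * (if k = 0 then 1 else sqrt 2)) * (sin (of_int m * x) * cos (of_int k * x)))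
       ((sqrt 2 * (if k = 0 then 1 else sqrt 2)) * 0)"
      by (intro has_bochner_integral_mult_right circ_sin_cos)
    show ?thesis
      by (rule has_bochner_integral_cong[THEN iffD1, OF refl _ _ h])
        (use 2 in \<open>auto simp: ang_def of_bool_def\<close>)
  next
    case 3
    have h: "has_bochner_integral circ (\<lambda>x. 2 * (sin (of_int m * x) * sin (of_int k * x)))
       (2 * (pi * (of_bool (m = k) - of_bool (m = - k))))"
      by (intro has_bochner_integral_mult_right circ_sin_sin)
    show ?thesis
      by (rule has_bochner_integral_cong[THEN iffD1, OF refl _ _ h])
        (use 3 in \<open>auto simp: ang_def of_bool_def\<close>)
  qed
qed

section \<open>Chebyshev polynomials of the second kind\<close>

text \<open>The monomial form is chosen because it integrates term by term to the Zernike
  coefficients. The range l \<le> n needs no halving: for 2 * l > n the binomial coefficient is 0,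
  so the truncated exponent is harmless.\<close>

definition cheb :: "nat \<Rightarrow> real \<Rightarrow> real" where
  "cheb n x = (\<Sum>l\<le>n. (-1) ^ l * real ((n - l) choose l) * (2 * x) ^ (n - 2 * l))"

lemma cheb_0: "cheb 0 x = 1" and cheb_1: "cheb (Suc 0) x = 2 * x"
  by (simp_all add: cheb_def)

lemma cheb_rec: "cheb (Suc (Suc n)) x = 2 * x * cheb (Suc n) x - cheb n x"
proof -
  let ?y = "2 * x"
  let ?a = "\<lambda>l. (-1) ^ l * real ((Suc n - l) choose l) * ?y ^ (n + 2 - 2 * l)"
  let ?b = "\<lambda>l. (-1) ^ l * real ((n - l) choose l) * ?y ^ (n - 2 * l)"
  \<comment> \<open>Pascal's rule splits the coefficient of index l + 1; the sign change turns the
    second part into minus a term of \<open>cheb n\<close>.\<close>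
  have t: "(-1) ^ Suc l * real ((Suc (Suc n) - Suc l) choose Suc l) * ?y ^ (Suc (Suc n) - 2 * Suc l)
    = ?a (Suc l) - ?b l" if "l \<le> n" for l
  proof -
    have "Suc (Suc n) - Suc l = Suc (n - l)" "Suc n - Suc l = n - l"
      "n + 2 - 2 * Suc l = n - 2 * l" "Suc (Suc n) - 2 * Suc l = n - 2 * l"
      using that by auto
    then show ?thesis by (simp add: algebra_simps)
  qed
  have "cheb (Suc (Suc n)) x = (\<Sum>l\<le>Suc n. (-1) ^ l * real ((Suc (Suc n) - l) choose l) * ?y ^ (Suc (Suc n) - 2 * l))"
    by (simp add: cheb_def)
  also have "\<dots> = ?y ^ (n + 2) + (\<Sum>l\<le>n. ?a (Suc l) - ?b l)"
    by (subst sum.atMost_Suc_shift) (use t in \<open>simp del: binomial_Suc_Suc power_Suc mult_Suc_right\<close>)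
  also have "\<dots> = ((\<Sum>l\<le>Suc n. ?a l)) - cheb n x"
    by (subst sum.atMost_Suc_shift) (simp add: sum_subtractf cheb_def del: binomial_Suc_Suc power_Suc mult_Suc_right)
  also have "(\<Sum>l\<le>Suc n. ?a l) = 2 * x * cheb (Suc n) x"
    unfolding cheb_def sum_distrib_left
  proof (rule sum.cong[OF refl])
    fix l
    show "?a l = 2 * x * ((-1) ^ l * real ((Suc n - l) choose l) * ?y ^ (Suc n - 2 * l))"
    proof (cases "2 * l \<le> Suc n")
      case True
      then have "n + 2 - 2 * l = Suc (Suc n - 2 * l)" by simp
      then show ?thesis by simp
    next
      \<comment> \<open>Only here does truncated subtraction make the two exponents disagree, and
        the coefficient vanishes.\<close>
      case False
      then have "(Suc n - l) choose l = 0" by (intro binomial_eq_0) simp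
      then show ?thesis by simp
    qed
  qed
  finally show ?thesis .
qed

lemma cheb_measurable [measurable]: "cheb n \<in> borel_measurable borel"
  unfolding cheb_def by simp

lemma continuous_on_cheb [continuous_intros]:
  "continuous_on S f \<Longrightarrow> continuous_on S (\<lambda>x. cheb n (f x))"
  unfolding cheb_def by (intro continuous_intros)

text \<open>Identifies the explicit sum as the Chebyshev polynomial of the second kind. The product
  form avoids the zeros of the sine.\<close>

lemma sin_cheb: "sin x * cheb n (cos x) = sin (real (Suc n) * x)"
proof (induction n rule: induct_nat_012)
  case 0
  then show ?case by (simp add: cheb_0)
next
  case 1
  then show ?case by (simp add: cheb_1 sin_double)
next
  case (ge2 n)
  have "sin x * cheb (Suc (Suc n)) (cos x) = 2 * cos x * sin (real (Suc (Suc n)) * x) - sin (real (Suc n) * x)"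
    using ge2 by (simp add: cheb_rec algebra_simps)
  also have "\<dots> = sin (real (Suc (Suc (Suc n))) * x)"
  proof -
    let ?z = "real (Suc (Suc n)) * x"
    have "real (Suc (Suc (Suc n))) * x = ?z + x" "real (Suc n) * x = ?z - x"
      by (simp_all add: algebra_simps)
    then show ?thesis by (simp only: sin_add sin_diff) simp
  qed
  finally show ?case .
qed

text \<open>The Dirichlet-type kernel with frequencies n, n - 2, ..., -n. In the recursion the
  factor 2 cos x shifts every frequency up and down by one. The form is free of division, so it also
  gives the sharp bound n + 1 on [-1, 1].\<close>

lemma cheb_cos: "cheb n (cos x) = (\<Sum>k\<le>n. cos (of_int (int n - 2 * int k) * x))"
proof (induction n rule: induct_nat_012)
  case 0
  then show ?case by (simp add: cheb_0)
next
  case 1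
  then show ?case by (simp add: cheb_1)
next
  case (ge2 n)
  let ?S = "\<lambda>n. \<Sum>k\<le>n. cos (of_int (int n - 2 * int k) * x)"
  have a: "2 * cos x * ?S (Suc n) = (\<Sum>k\<le>Suc n. cos (of_int (int (Suc (Suc n)) - 2 * int k) * x)
      + cos (of_int (int n - 2 * int k) * x))"
    unfolding sum_distrib_left
  proof (rule sum.cong[OF refl])
    fix k
    let ?z = "of_int (int (Suc n) - 2 * int k) * x"
    have "of_int (int (Suc (Suc n)) - 2 * int k) * x = ?z + x" "of_int (int n - 2 * int k) * x = ?z - x"
      by (simp_all add: algebra_simps)
    then show "2 * cos x * cos ?z = cos (of_int (int (Suc (Suc n)) - 2 * int k) * x)
      + cos (of_int (int n - 2 * int k) * x)"
      by (simp only: cos_add cos_diff) simp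
  qed
  \<comment> \<open>The downward shift of the last term supplies the lowest frequency -(n + 2),
    which the upward shifts do not reach.\<close>
  have b: "cos (of_int (int n - 2 * int (Suc n)) * x) = cos (of_int (int (Suc (Suc n)) - 2 * int (Suc (Suc n))) * x)"
    by (intro arg_cong[of _ _ cos]) simp
  show ?case
    using a b ge2 by (simp add: cheb_rec sum.distrib)
qed

lemma abs_cheb_le:
  assumes "\<bar>x\<bar> \<le> 1" shows "\<bar>cheb n x\<bar> \<le> real (Suc n)"
proof -
  have "\<bar>cheb n (cos (arccos x))\<bar> \<le> (\<Sum>k\<le>n. 1)"
    unfolding cheb_cos by (rule order_trans[OF sum_abs]) (intro sum_mono; simp)
  then show ?thesis using assms by (simp add: cos_arccos_abs)
qed

lemma cheb_uminus: "cheb n (- x) = (-1) ^ n * cheb n x"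
proof (induction n rule: induct_nat_012)
  case (ge2 n)
  then show ?case by (simp add: cheb_rec algebra_simps)
qed (simp_all add: cheb_0 cheb_1)

section \<open>Zernike polynomials as averages of ridge functions\<close>

lemma power_two_cos: "(2 * cos x) ^ N = (\<Sum>k\<le>N. real (N choose k) * cos (of_int (int N - 2 * int k) * x))"
proof -
  have "complex_of_real ((2 * cos x) ^ N) = (cis (- x) + cis x) ^ N"
    by (simp add: complex_eq_iff flip: of_real_power)
  also have "\<dots> = (\<Sum>k\<le>N. of_nat (N choose k) * cis (- x) ^ k * cis x ^ (N - k))"
    by (rule binomial_ring)
  also have "\<dots> = (\<Sum>k\<le>N. of_nat (N choose k) * cis (of_int (int N - 2 * int k) * x))"
  proof (rule sum.cong[OF refl])
    fix k assume "k \<in> {..N}"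
    then have "real k * (- x) + real (N - k) * x = of_int (int N - 2 * int k) * x"
      by (simp add: of_nat_diff algebra_simps)
    then show "of_nat (N choose k) * cis (- x) ^ k * cis x ^ (N - k)
        = of_nat (N choose k) * cis (of_int (int N - 2 * int k) * x)"
      by (simp only: Complex.DeMoivre cis_mult mult.assoc)
  qed
  finally have "Re (complex_of_real ((2 * cos x) ^ N)) =
      Re (\<Sum>k\<le>N. of_nat (N choose k) * cis (of_int (int N - 2 * int k) * x))"
    by (rule arg_cong)
  then show ?thesis by simp
qed

text \<open>Picks the frequencies m and -m out of the expansion of (2 cos x)^N. They sit at the
  indices k - l and j - l, whose binomial coefficients agree by symmetry; for j = k one index is
  counted twice. If l exceeds the smaller of j and k, then N < |m| and neither frequency
  occurs.\<close>

lemma sum_binomial_select: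
  fixes j k l :: nat
  assumes N: "2 * l \<le> j + k"
  defines "N \<equiv> j + k - 2 * l" and "m \<equiv> int j - int k"
  shows "(\<Sum>i\<le>N. real (N choose i) * (of_bool (int N - 2 * int i = m) + of_bool (int N - 2 * int i = - m)))
    = (if l \<le> j \<and> l \<le> k then 2 * real (N choose (j - l)) else 0)"
proof (cases "l \<le> j \<and> l \<le> k")
  case True
  have e: "int N - 2 * int i = m \<longleftrightarrow> i = k - l" "int N - 2 * int i = - m \<longleftrightarrow> i = j - l" for i
    using True N unfolding N_def m_def by auto
  have s: "N choose (k - l) = N choose (j - l)"
    using True by (subst binomial_symmetric) (auto simp: N_def intro!: arg_cong[where f="(choose) _"])
  have "k - l \<le> N" "j - l \<le> N" using True unfolding N_def by auto
  then show ?thesis unfolding e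
    using True s by (simp add: distrib_left sum.distrib of_bool_def if_distrib[of "(*) _"] cong: if_cong)
next
  case False
  have "\<not> (int N - 2 * int i = m)" "\<not> (int N - 2 * int i = - m)" if "i \<le> N" for i
    using that False N unfolding N_def m_def by auto
  then show ?thesis unfolding if_not_P[OF False] by (intro sum.neutral) auto
qed

text \<open>The Zernike polynomial is the angular Fourier coefficient of a ridge function. Expanding
  in powers of the cosine, the coefficient of \<open>cheb\<close> times the selected binomial is
  (n-l choose l) * (n-2l choose j-l) = (n-l)! / (l! (j-l)! (k-l)!), which is the Zernike
  coefficient.\<close>

lemma circ_cheb_ang:
  "has_bochner_integral circ (\<lambda>x. cheb (j + k) (r * cos (x - t)) * ang (int j - int k) x)
     (2 * pi * zernike (j + k) (nat \<bar>int j - int k\<bar>) r * ang (int j - int k) t)"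
proof -
  let ?n = "j + k" and ?m = "int j - int k"
  let ?s = "\<lambda>N. \<Sum>i\<le>N. real (N choose i) * (of_bool (int N - 2 * int i = ?m) + of_bool (int N - 2 * int i = - ?m))"
  have p: "has_bochner_integral circ (\<lambda>x. (2 * (r * cos (x - t))) ^ N * ang ?m x) (r ^ N * (pi * ?s N * ang ?m t))"
    for N
  proof -
    have "has_bochner_integral circ
       (\<lambda>x. r ^ N * (\<Sum>i\<le>N. real (N choose i) * (cos (of_int (int N - 2 * int i) * (x - t)) * ang ?m x)))
       (r ^ N * (\<Sum>i\<le>N. real (N choose i) * (pi * (of_bool (int N - 2 * int i = ?m) + of_bool (int N - 2 * int i = - ?m)) * ang ?m t)))"
      by (intro has_bochner_integral_mult_right has_bochner_integral_sum circ_cos_ang)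
    moreover have "r ^ N * (\<Sum>i\<le>N. real (N choose i) * (cos (of_int (int N - 2 * int i) * (x - t)) * ang ?m x))
       = (2 * (r * cos (x - t))) ^ N * ang ?m x" for x
    proof -
      have "(2 * (r * cos (x - t))) ^ N = r ^ N * (2 * cos (x - t)) ^ N"
        by (simp add: mult.left_commute power_mult_distrib)
      then show ?thesis by (simp only: power_two_cos sum_distrib_left sum_distrib_right mult.assoc)
    qed
    moreover have "(\<Sum>i\<le>N. real (N choose i) * (pi * (of_bool (int N - 2 * int i = ?m) + of_bool (int N - 2 * int i = - ?m)) * ang ?m t))
       = pi * ?s N * ang ?m t"
      by (simp only: sum_distrib_left sum_distrib_right mult_ac)
    ultimately show ?thesis by simp
  qed
  have i: "has_bochner_integral circ
     (\<lambda>x. \<Sum>l\<le>?n. ((-1) ^ l * real ((?n - l) choose l)) * ((2 * (r * cos (x - t))) ^ (?n - 2 * l) * ang ?m x))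
     (\<Sum>l\<le>?n. ((-1) ^ l * real ((?n - l) choose l)) * (r ^ (?n - 2 * l) * (pi * ?s (?n - 2 * l) * ang ?m t)))"
    by (intro has_bochner_integral_mult_right has_bochner_integral_sum p)
  \<comment> \<open>The terms beyond \<open>min j k\<close> drop out: either the frequency j - k is
    too high for the remaining power of the cosine, or the coefficient of \<open>cheb\<close> is
    already 0.\<close>
  have "(\<Sum>l\<le>?n. ((-1) ^ l * real ((?n - l) choose l)) * (r ^ (?n - 2 * l) * (pi * ?s (?n - 2 * l) * ang ?m t)))
    = (\<Sum>l\<in>{0..min j k}. 2 * pi * ((-1) ^ l * fact (?n - l) / (fact l * fact (max j k - l) * fact (min j k - l)) * r ^ (?n - 2 * l)) * ang ?m t)"
  proof (rule sum.mono_neutral_cong_right)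
    show "\<forall>l\<in>{..?n} - {0..min j k}. ((-1) ^ l * real ((?n - l) choose l)) * (r ^ (?n - 2 * l) * (pi * ?s (?n - 2 * l) * ang ?m t)) = 0"
    proof
      fix l assume l: "l \<in> {..?n} - {0..min j k}"
      show "((-1) ^ l * real ((?n - l) choose l)) * (r ^ (?n - 2 * l) * (pi * ?s (?n - 2 * l) * ang ?m t)) = 0"
      proof (cases "2 * l \<le> ?n")
        case True
        have "\<not> (l \<le> j \<and> l \<le> k)" using l by auto
        then have "?s (?n - 2 * l) = 0"
          by (subst sum_binomial_select[OF True]) auto
        then show ?thesis by simp
      next
        case False
        then have "(?n - l) choose l = 0" by (intro binomial_eq_0) simp
        then show ?thesis by simp
      qed
    qed
  next
    fix l assume "l \<in> {0..min j k}"
    then have l: "l \<le> j" "l \<le> k" and n: "2 * l \<le> ?n" by auto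
    have s: "?s (?n - 2 * l) = 2 * real ((?n - 2 * l) choose (j - l))"
      using l by (subst sum_binomial_select[OF n]) simp
    have b1: "real ((?n - l) choose l) = fact (?n - l) / (fact l * fact (?n - 2 * l))"
    proof -
      have "?n - l - l = ?n - 2 * l" by simp
      then show ?thesis using n by (subst binomial_fact) auto
    qed
    have b2: "real ((?n - 2 * l) choose (j - l)) = fact (?n - 2 * l) / (fact (j - l) * fact (k - l))"
    proof -
      have "?n - 2 * l - (j - l) = k - l" using l by simp
      then show ?thesis using l by (subst binomial_fact) auto
    qed
    have "fact (max j k - l) * fact (min j k - l) = (fact (j - l) * fact (k - l) :: real)"
      by (auto simp: max_def min_def)
    then show "((-1) ^ l * real ((?n - l) choose l)) * (r ^ (?n - 2 * l) * (pi * ?s (?n - 2 * l) * ang ?m t))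
      = 2 * pi * ((-1) ^ l * fact (?n - l) / (fact l * fact (max j k - l) * fact (min j k - l)) * r ^ (?n - 2 * l)) * ang ?m t"
      unfolding s b1 b2 by (simp add: mult.assoc)
  qed auto
  also have "\<dots> = 2 * pi * zernike ?n (nat \<bar>?m\<bar>) r * ang ?m t"
  proof -
    have "(?n - nat \<bar>?m\<bar>) div 2 = min j k" "(?n + nat \<bar>?m\<bar>) div 2 = max j k"
      by (auto simp: min_def max_def)
    then show ?thesis
      by (simp add: zernike_def sum_distrib_left sum_distrib_right)
  qed
  finally have v: "(\<Sum>l\<le>?n. ((-1) ^ l * real ((?n - l) choose l)) * (r ^ (?n - 2 * l) * (pi * ?s (?n - 2 * l) * ang ?m t)))
    = 2 * pi * zernike ?n (nat \<bar>?m\<bar>) r * ang ?m t" .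
  show ?thesis
    using i unfolding v by (simp add: cheb_def sum_distrib_right mult.assoc)
qed

text \<open>The case r = 1, where the ridge function is the sum of all frequencies n, n - 2, ..., -n
  with coefficient 1, so no binomial sums are needed.\<close>

lemma circ_cheb_cos_ang:
  "has_bochner_integral circ (\<lambda>x. cheb (j + k) (cos (x - t)) * ang (int j - int k) x) (2 * pi * ang (int j - int k) t)"
proof -
  let ?n = "j + k" and ?m = "int j - int k"
  have i: "has_bochner_integral circ (\<lambda>x. \<Sum>i\<le>?n. cos (of_int (int ?n - 2 * int i) * (x - t)) * ang ?m x)
     (\<Sum>i\<le>?n. pi * (of_bool (int ?n - 2 * int i = ?m) + of_bool (int ?n - 2 * int i = - ?m)) * ang ?m t)"
    by (intro has_bochner_integral_sum circ_cos_ang)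
  have e: "int ?n - 2 * int i = ?m \<longleftrightarrow> i = k" "int ?n - 2 * int i = - ?m \<longleftrightarrow> i = j" for i
    by auto
  have v: "(\<Sum>i\<le>?n. pi * (of_bool (int ?n - 2 * int i = ?m) + of_bool (int ?n - 2 * int i = - ?m)) * ang ?m t) = 2 * pi * ang ?m t"
    unfolding e by (simp add: sum.distrib of_bool_def distrib_left distrib_right if_distrib[of "(*) _"] if_distrib[of "\<lambda>x. x * _"] cong: if_cong)
  show ?thesis using i unfolding v by (simp add: cheb_cos sum_distrib_right)
qed

definition ridge :: "real \<times> real \<Rightarrow> real \<Rightarrow> real" where
  "ridge x t = fst x * cos t + snd x * sin t"

text \<open>Normalising factor of the basis in degree n. The singular value of that degree is sqrt
  pi / \<open>nrm n\<close> = pi / sqrt (n + 1).\<close>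

definition nrm :: "nat \<Rightarrow> real" where
  "nrm n = sqrt (real (Suc n) / pi)"

text \<open>In polar coordinates the ridge variable is r cos (s - t), so
  \<open>circ_cheb_ang\<close> applies. The polar form through \<open>Arg\<close> is valid at the
  origin too, and no point is excluded.\<close>

lemma basis_eq_circ:
  "has_bochner_integral circ (\<lambda>t. nrm (j + k) / (2 * pi) * (cheb (j + k) (ridge x t) * ang (int j - int k) t)) (basis j k x)"
proof -
  define t where "t = Arg (Complex (fst x) (snd x))"
  have n: "norm x = cmod (Complex (fst x) (snd x))"
    by (cases x) (simp add: norm_Pair cmod_def)
  have "Complex (fst x) (snd x) = rcis (norm x) t"
    unfolding n t_def by (simp add: rcis_cmod_Arg)
  then have c: "fst x = norm x * cos t" "snd x = norm x * sin t"
    by (metis Re_rcis complex.sel(1), metis Im_rcis complex.sel(2))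
  have r: "ridge x s = norm x * cos (s - t)" for s
    unfolding ridge_def by (subst c(1), subst c(2)) (simp add: cos_diff algebra_simps)
  have "pi powr (-1/2) * real (j + k + 1) powr (1/2) = nrm (j + k)"
    by (simp add: nrm_def powr_minus powr_half_sqrt real_sqrt_divide field_simps)
  then have b: "basis j k x = nrm (j + k) * zernike (j + k) (nat \<bar>int j - int k\<bar>) (norm x) * ang (int j - int k) t"
    unfolding basis_def basis_complex_def basis_polar_def t_def[symmetric]
    by (auto simp: ang_def)
  show ?thesis
    using has_bochner_integral_mult_right[OF circ_cheb_ang[of j k "norm x" t], of "nrm (j + k) / (2 * pi)"]
    unfolding r b by (simp add: mult.assoc)
qed

section \<open>Rotations of the plane\<close>

text \<open>For fixed a, the point \<open>rot a (u, t)\<close> runs in t along the line with unit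
  normal (cos a, sin a) and offset u, which is the path of integration of
  \<open>radon\<close>.\<close>

definition rot :: "real \<Rightarrow> real \<times> real \<Rightarrow> real \<times> real" where
  "rot a z = (fst z * cos a - snd z * sin a, fst z * sin a + snd z * cos a)"

lemma rot_rot: "rot a (rot b z) = rot (a + b) z"
  by (simp add: rot_def cos_add sin_add algebra_simps)

lemma norm_rot: "norm (rot a z) = norm z"
proof -
  have "(fst z * cos a - snd z * sin a)\<^sup>2 + (fst z * sin a + snd z * cos a)\<^sup>2
      = ((fst z)\<^sup>2 + (snd z)\<^sup>2) * ((sin a)\<^sup>2 + (cos a)\<^sup>2)"
    by algebra
  then show ?thesis by (simp add: rot_def norm_prod_def)
qed

lemma ridge_rot: "ridge (rot a z) a = fst z"
proof -
  have "ridge (rot a z) a = fst z * ((sin a)\<^sup>2 + (cos a)\<^sup>2)"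
    unfolding ridge_def rot_def fst_conv snd_conv by algebra
  then show ?thesis by simp
qed

lemma abs_ridge_le: "\<bar>ridge x a\<bar> \<le> norm x"
proof -
  have "ridge x a = x \<bullet> (cos a, sin a)"
    by (cases x) (simp add: ridge_def inner_prod_def)
  then show ?thesis
    using Cauchy_Schwarz_ineq2[of x "(cos a, sin a)"] by (simp add: norm_Pair)
qed

lemma rot_measurable [measurable]: "(\<lambda>(a, z). rot a z) \<in> borel \<Otimes>\<^sub>M borel \<rightarrow>\<^sub>M borel"
  unfolding rot_def borel_prod[symmetric] by measurable

lemma rot_measurable1 [measurable]: "rot a \<in> borel \<rightarrow>\<^sub>M borel"
  unfolding rot_def borel_prod[symmetric] by measurable

lemma nn_integral_shear1:
  assumes [measurable]: "g \<in> borel_measurable borel"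
  shows "(\<integral>\<^sup>+z. g (fst z + c * snd z, snd z) \<partial>lborel) = (\<integral>\<^sup>+z. g z \<partial>(lborel :: (real \<times> real) measure))"
proof -
  have [measurable]: "g \<in> borel_measurable (borel \<Otimes>\<^sub>M borel)"
    unfolding borel_prod by measurable
  have "(\<integral>\<^sup>+z. g (fst z + c * snd z, snd z) \<partial>(lborel \<Otimes>\<^sub>M lborel)) = (\<integral>\<^sup>+y. \<integral>\<^sup>+x. g (x + c * y, y) \<partial>lborel \<partial>lborel)"
    by (subst lborel_pair.nn_integral_snd[symmetric]) simp_all
  also have "\<dots> = (\<integral>\<^sup>+y. \<integral>\<^sup>+x. g (x, y) \<partial>lborel \<partial>lborel)"
  proof (rule nn_integral_cong)
    fix y :: real
    show "(\<integral>\<^sup>+x. g (x + c * y, y) \<partial>lborel) = (\<integral>\<^sup>+x. g (x, y) \<partial>lborel)"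
      by (subst nn_integral_real_affine[of "\<lambda>x. g (x, y)" 1 "c * y"]) (simp_all add: add.commute)
  qed
  also have "\<dots> = (\<integral>\<^sup>+z. g z \<partial>(lborel \<Otimes>\<^sub>M lborel))"
    by (subst lborel_pair.nn_integral_snd[symmetric]) simp_all
  finally show ?thesis unfolding lborel_prod .
qed

lemma nn_integral_shear2:
  assumes [measurable]: "g \<in> borel_measurable borel"
  shows "(\<integral>\<^sup>+z. g (fst z, snd z + c * fst z) \<partial>lborel) = (\<integral>\<^sup>+z. g z \<partial>(lborel :: (real \<times> real) measure))"
proof -
  have [measurable]: "g \<in> borel_measurable (borel \<Otimes>\<^sub>M borel)"
    unfolding borel_prod by measurable
  have "(\<integral>\<^sup>+z. g (fst z, snd z + c * fst z) \<partial>(lborel \<Otimes>\<^sub>M lborel)) = (\<integral>\<^sup>+x. \<integral>\<^sup>+y. g (x, y + c * x) \<partial>lborel \<partial>lborel)"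
    by (subst lborel.nn_integral_fst[symmetric]) simp_all
  also have "\<dots> = (\<integral>\<^sup>+x. \<integral>\<^sup>+y. g (x, y) \<partial>lborel \<partial>lborel)"
  proof (rule nn_integral_cong)
    fix x :: real
    show "(\<integral>\<^sup>+y. g (x, y + c * x) \<partial>lborel) = (\<integral>\<^sup>+y. g (x, y) \<partial>lborel)"
      by (subst nn_integral_real_affine[of "\<lambda>y. g (x, y)" 1 "c * x"]) (simp_all add: add.commute)
  qed
  also have "\<dots> = (\<integral>\<^sup>+z. g z \<partial>(lborel \<Otimes>\<^sub>M lborel))"
    by (subst lborel.nn_integral_fst[symmetric]) simp_all
  finally show ?thesis unfolding lborel_prod .
qed

text \<open>A rotation by less than a half turn is a product of three shears; a half turn is handled by
  halving the angle.\<close>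

lemma nn_integral_rot:
  assumes g: "g \<in> borel_measurable borel"
  shows "(\<integral>\<^sup>+z. g (rot a z) \<partial>lborel) = (\<integral>\<^sup>+z. g z \<partial>lborel)"
proof -
  have small: "(\<integral>\<^sup>+z. g (rot (2 * b) z) \<partial>lborel) = (\<integral>\<^sup>+z. g z \<partial>lborel)"
    if b: "cos b \<noteq> 0" and g [measurable]: "g \<in> borel_measurable borel" for b and g :: "real \<times> real \<Rightarrow> ennreal"
  proof -
    \<comment> \<open>Horizontal shears by - tan b on both sides of a vertical shear by sin (2 b);
      the tangent is the reason for asking cos b to be nonzero.\<close>
    define c where "c = - tan b"
    define S where "S = (\<lambda>z :: real \<times> real. (fst z + c * snd z, snd z))"
    define V where "V = (\<lambda>z :: real \<times> real. (fst z, snd z + sin (2 * b) * fst z))"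
    have [measurable]: "S \<in> borel \<rightarrow>\<^sub>M borel" "V \<in> borel \<rightarrow>\<^sub>M borel"
      unfolding S_def V_def borel_prod[symmetric] by measurable
    have c1: "1 + c * sin (2 * b) = cos (2 * b)"
      using b unfolding c_def tan_def sin_double cos_double_sin by (simp add: field_simps power2_eq_square)
    have c2: "c + c * (1 + sin (2 * b) * c) = - sin (2 * b)"
    proof -
      have "1 + sin (2 * b) * c = cos (2 * b)" using c1 by (simp add: mult.commute)
      then have "c + c * (1 + sin (2 * b) * c) = c * (1 + cos (2 * b))" by (simp add: algebra_simps)
      also have "\<dots> = c * (2 * (cos b)\<^sup>2)" by (simp add: cos_double_cos)
      also have "\<dots> = - sin (2 * b)"
        using b unfolding c_def tan_def sin_double by (simp add: power2_eq_square)
      finally show ?thesis .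
    qed
    have r: "rot (2 * b) z = S (V (S z))" for z
    proof (rule prod_eqI)
      show "snd (rot (2 * b) z) = snd (S (V (S z)))"
        using c1 unfolding rot_def S_def V_def by (simp add: algebra_simps) (metis c1 distrib_left mult.commute mult.left_commute mult_1 mult.right_neutral)
      have "fst (S (V (S z))) = fst z * (1 + c * sin (2 * b)) + snd z * (c + c * (1 + sin (2 * b) * c))"
        unfolding S_def V_def by (simp add: algebra_simps)
      then show "fst (rot (2 * b) z) = fst (S (V (S z)))"
        unfolding c1 c2 by (simp add: rot_def)
    qed
    have m: "(\<lambda>z. g (S (V z))) \<in> borel_measurable borel"
      by measurable
    have "(\<integral>\<^sup>+z. g (rot (2 * b) z) \<partial>lborel) = (\<integral>\<^sup>+z. (\<lambda>z. g (S (V z))) (S z) \<partial>lborel)"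
      by (simp add: r)
    also have "\<dots> = (\<integral>\<^sup>+z. (\<lambda>z. g (S z)) (V z) \<partial>lborel)"
      using nn_integral_shear1[OF m, of c] by (simp only: S_def)
    also have "\<dots> = (\<integral>\<^sup>+z. g (S z) \<partial>lborel)"
      unfolding V_def by (rule nn_integral_shear2) measurable
    also have "\<dots> = (\<integral>\<^sup>+z. g z \<partial>lborel)"
      unfolding S_def by (rule nn_integral_shear1) measurable
    finally show ?thesis .
  qed
  show ?thesis
  proof (cases "cos (a / 2) = 0")
    case False
    then show ?thesis using small[of "a / 2" g] g by simp
  next
    case True
    have "cos (a / 4) \<noteq> 0"
    proof
      assume "cos (a / 4) = 0"
      then have "cos (2 * (a / 4)) = - 1" by (simp only: cos_double_cos) simp
      with True show False by simp
    qed
    note s = small[OF this]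
    have "(\<integral>\<^sup>+z. g (rot a z) \<partial>lborel) = (\<integral>\<^sup>+z. (\<lambda>z. g (rot (a / 2) z)) (rot (2 * (a / 4)) z) \<partial>lborel)"
      by (simp add: rot_rot)
    also have "\<dots> = (\<integral>\<^sup>+z. g (rot (2 * (a / 4)) z) \<partial>lborel)"
      using g by (subst s) (simp_all add: rot_measurable1 measurable_compose[OF rot_measurable1])
    also have "\<dots> = (\<integral>\<^sup>+z. g z \<partial>lborel)"
      using g by (rule s)
    finally show ?thesis .
  qed
qed

lemma distr_rot: "distr lborel borel (rot a) = lborel"
proof (rule measure_eqI)
  fix A assume "A \<in> sets (distr lborel borel (rot a))"
  then have [measurable]: "A \<in> sets borel" by simp
  have "emeasure (distr lborel borel (rot a)) A = (\<integral>\<^sup>+z. indicator A z \<partial>distr lborel borel (rot a))"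
    by simp
  also have "\<dots> = (\<integral>\<^sup>+z. indicator A (rot a z) \<partial>lborel)"
    by (rule nn_integral_distr) simp_all
  also have "\<dots> = emeasure lborel A"
    by (subst nn_integral_rot) simp_all
  finally show "emeasure (distr lborel borel (rot a)) A = emeasure lborel A" .
qed simp

lemma integral_rot:
  fixes g :: "real \<times> real \<Rightarrow> real"
  assumes "g \<in> borel_measurable borel"
  shows "(\<integral>z. g (rot a z) \<partial>lborel) = (\<integral>z. g z \<partial>lborel)"
  using integral_distr[of "rot a" lborel borel g] assms by (simp add: distr_rot)

section \<open>Circle integrals in terms of Lebesgue measure, and their invariance under a half
  turn\<close>

interpretation circ: finite_measure circ
  by (rule finite_measure_circ)

lemma circ_integral_lborel:
  fixes k :: "real \<Rightarrow> real"
  shows "(\<integral>x. k x \<partial>circ) = (\<integral>x. indicator {0..<2 * pi} x * k x \<partial>lborel)"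
  unfolding circ_def by (subst integral_restrict_space) auto

lemma circ_nn_integral_lborel:
  "(\<integral>\<^sup>+x. k x \<partial>circ) = (\<integral>\<^sup>+x. k x * indicator {0..<2 * pi} x \<partial>lborel)"
  unfolding circ_def by (subst nn_integral_restrict_space) auto

lemma emeasure_circ: "emeasure circ (space circ) = ennreal (2 * pi)"
  by (simp add: circ_def emeasure_restrict_space space_restrict_space)

lemma integrable_circ_bounded:
  fixes k :: "real \<Rightarrow> real"
  assumes "k \<in> borel_measurable borel" "\<And>x. \<bar>k x\<bar> \<le> B"
  shows "integrable circ k"
  by (rule circ.integrable_const_bound[of _ B]) (use assms in \<open>auto simp: measurable_circ\<close>)

text \<open>The part of the translated period beyond 2 * pi is moved back by periodicity. The half
  turn is the translation that changes the sign of \<open>ridge x\<close>.\<close>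

lemma circ_shift_pi:
  fixes k :: "real \<Rightarrow> real"
  assumes k [measurable]: "k \<in> borel_measurable borel" and B: "\<And>x. \<bar>k x\<bar> \<le> B"
    and p: "\<And>x. k (x + 2 * pi) = k x"
  shows "(\<integral>x. k (x + pi) \<partial>circ) = (\<integral>x. k x \<partial>circ)"
proof -
  have i: "integrable lborel (\<lambda>x. indicator {a..<b} x * k x)" for a b :: real
  proof (rule Bochner_Integration.integrable_bound[of _ "\<lambda>x. indicator {a..<b} x * B"])
    show "integrable lborel (\<lambda>x. indicator {a..<b} x * B)"
      by (cases "a \<le> b") (auto intro!: integrable_mult_left integrable_real_indicator)
    have "B \<ge> 0" using B[of 0] by linarith
    then show "AE x in lborel. norm (indicator {a..<b} x * k x) \<le> norm (indicator {a..<b} x * B)"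
      using B by (auto simp: indicator_def)
  qed measurable
  have "(\<integral>x. k (x + pi) \<partial>circ) = (\<integral>x. indicator {0..<2 * pi} x * k (x + pi) \<partial>lborel)"
    by (rule circ_integral_lborel)
  also have "\<dots> = (\<integral>x. indicator {pi..<3 * pi} x * k x \<partial>lborel)"
    by (subst (2) lborel_integral_real_affine[of 1 _ pi])
      (auto simp: indicator_def add.commute intro!: Bochner_Integration.integral_cong)
  also have "\<dots> = (\<integral>x. indicator {pi..<2 * pi} x * k x + indicator {2 * pi..<3 * pi} x * k x \<partial>lborel)"
    by (rule Bochner_Integration.integral_cong) (auto simp: indicator_def)
  also have "\<dots> = (\<integral>x. indicator {pi..<2 * pi} x * k x \<partial>lborel) + (\<integral>x. indicator {2 * pi..<3 * pi} x * k x \<partial>lborel)"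
    by (rule Bochner_Integration.integral_add[OF i i])
  also have "(\<integral>x. indicator {2 * pi..<3 * pi} x * k x \<partial>lborel) = (\<integral>x. indicator {0..<pi} x * k x \<partial>lborel)"
    using p by (subst lborel_integral_real_affine[of 1 _ "2 * pi"])
      (auto simp: indicator_def add.commute intro!: Bochner_Integration.integral_cong)
  also have "(\<integral>x. indicator {pi..<2 * pi} x * k x \<partial>lborel) + \<dots>
     = (\<integral>x. indicator {pi..<2 * pi} x * k x + indicator {0..<pi} x * k x \<partial>lborel)"
    by (rule Bochner_Integration.integral_add[OF i i, symmetric])
  also have "\<dots> = (\<integral>x. indicator {0..<2 * pi} x * k x \<partial>lborel)"
    by (rule Bochner_Integration.integral_cong) (auto simp: indicator_def)
  also have "\<dots> = (\<integral>x. k x \<partial>circ)"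
    by (rule circ_integral_lborel[symmetric])
  finally show ?thesis .
qed

section \<open>Integration over the disk and the cylinder\<close>

text \<open>Extension by zero turns integrals over chords and over the disk into integrals over the
  line and the plane, where Fubini and rotation invariance apply without bookkeeping of the
  domain.\<close>

definition dext :: "(real \<times> real \<Rightarrow> real) \<Rightarrow> real \<times> real \<Rightarrow> real" where
  "dext f x = indicator (cball 0 1) x * f x"

lemma dext_measurable:
  "f \<in> borel_measurable disk \<Longrightarrow> dext f \<in> borel_measurable borel"
  unfolding dext_def disk_def
  by (subst (asm) borel_measurable_restrict_space_iff) (auto simp: ac_simps)

lemma disk_integral: "(\<integral>x. f x \<partial>disk) = (\<integral>x. dext f x \<partial>lborel)"
  unfolding disk_def dext_def by (subst integral_restrict_space) auto

lemma disk_integrable: "integrable disk f \<longleftrightarrow> integrable lborel (dext f)"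
  unfolding disk_def dext_def[abs_def] by (subst integrable_restrict_space) auto

lemma space_disk [simp]: "space disk = cball 0 1"
  by (simp add: disk_def space_restrict_space)

lemma finite_measure_disk: "finite_measure disk"
proof (rule finite_measureI)
  have "emeasure lborel (cball 0 1 :: (real \<times> real) set) < \<infinity>"
    by (rule emeasure_bounded_finite) simp
  then show "emeasure disk (space disk) \<noteq> \<infinity>"
    by (simp add: disk_def emeasure_restrict_space space_restrict_space)
qed

lemma borel_measurable_disk: "f \<in> borel_measurable borel \<Longrightarrow> f \<in> borel_measurable disk"
  unfolding disk_def by (simp add: measurable_restrict_space1)

lemma norm_rot_pair: "norm (rot a (u, t)) \<le> 1 \<longleftrightarrow> u\<^sup>2 + t\<^sup>2 \<le> 1"
  by (simp add: norm_rot norm_Pair)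

lemma disk_section: "\<bar>t\<bar> \<le> sqrt (1 - u\<^sup>2) \<longleftrightarrow> u\<^sup>2 + t\<^sup>2 \<le> (1 :: real)"
proof -
  have "\<bar>t\<bar> \<le> sqrt (1 - u\<^sup>2) \<longleftrightarrow> sqrt (t\<^sup>2) \<le> sqrt (1 - u\<^sup>2)" by simp
  also have "\<dots> \<longleftrightarrow> t\<^sup>2 \<le> 1 - u\<^sup>2" by (rule real_sqrt_le_iff)
  finally show ?thesis by linarith
qed

lemma radon_eq_dext:
  "radon f (u, a) = pi / (2 * sqrt (1 - u\<^sup>2)) * (\<integral>t. dext f (rot a (u, t)) \<partial>lborel)"
proof -
  have "indicator {- sqrt (1 - u\<^sup>2) .. sqrt (1 - u\<^sup>2)} t *\<^sub>R
       f (u * cos a - t * sin a, u * sin a + t * cos a) = dext f (rot a (u, t))" for t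
  proof -
    have "t \<in> {- sqrt (1 - u\<^sup>2) .. sqrt (1 - u\<^sup>2)} \<longleftrightarrow> rot a (u, t) \<in> cball 0 1"
      using disk_section[of t u] norm_rot_pair[of a u t] by auto
    then show ?thesis
      by (auto simp: dext_def indicator_def rot_def)
  qed
  then show ?thesis
    by (simp add: radon_def set_lebesgue_integral_def)
qed

lemma radon_measurable:
  assumes "f \<in> borel_measurable disk"
  shows "radon f \<in> borel_measurable borel"
proof -
  note [measurable] = dext_measurable[OF assms]
  have [measurable]: "(\<lambda>x. dext f (rot (snd (fst x)) (fst (fst x), snd x))) \<in> borel_measurable ((borel \<Otimes>\<^sub>M borel) \<Otimes>\<^sub>M lborel)"
    unfolding rot_def borel_prod[symmetric] by measurable
  have "(\<lambda>z. pi / (2 * sqrt (1 - (fst z)\<^sup>2)) * (\<integral>t. dext f (rot (snd z) (fst z, t)) \<partial>lborel))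
      \<in> borel_measurable (borel \<Otimes>\<^sub>M borel)"
    by measurable
  moreover have "radon f = (\<lambda>z. pi / (2 * sqrt (1 - (fst z)\<^sup>2)) * (\<integral>t. dext f (rot (snd z) (fst z, t)) \<partial>lborel))"
    by (auto simp: radon_eq_dext)
  ultimately show ?thesis by (simp add: borel_prod)
qed

definition cyl_weight :: "real \<Rightarrow> real" where
  "cyl_weight u = 2 / pi * sqrt (1 - u\<^sup>2)"

lemma cyl_weight_nonneg: "u \<in> {0..1} \<Longrightarrow> cyl_weight u \<ge> 0"
  by (simp add: cyl_weight_def abs_square_le_1)

lemma cyl_weight_measurable [measurable]: "cyl_weight \<in> borel_measurable borel"
  unfolding cyl_weight_def by measurable

lemma cyl_eq: "cyl = density (restrict_space lborel ({0..1} \<times> {0..<2 * pi})) (\<lambda>z. ennreal (cyl_weight (fst z)))"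
  by (simp add: cyl_def cyl_weight_def case_prod_beta')

lemma space_cyl: "space cyl = {0..1} \<times> {0..<2 * pi}"
  by (simp add: cyl_def space_restrict_space)

lemma borel_measurable_cyl: "f \<in> borel_measurable borel \<Longrightarrow> f \<in> borel_measurable cyl"
  unfolding cyl_def by (simp add: measurable_restrict_space1)

lemma cyl_weight_meas2 [measurable]: "(\<lambda>z. cyl_weight (fst z)) \<in> borel_measurable (borel :: (real \<times> real) measure)"
  unfolding borel_prod[symmetric] by measurable

lemma rect_borel [measurable]: "{0..1} \<times> {0..<2 * pi} \<in> sets (borel :: (real \<times> real) measure)"
  by (simp add: borel_Times)

text \<open>The angle is the outer variable, so that for each fixed angle the inner integral can be
  treated by a rotation of the plane.\<close>

lemma nn_integral_cyl:
  assumes [measurable]: "g \<in> borel_measurable borel"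
  shows "(\<integral>\<^sup>+z. g z \<partial>cyl) =
    (\<integral>\<^sup>+a. \<integral>\<^sup>+u. indicator {0..1} u * (ennreal (cyl_weight u) * g (u, a)) \<partial>lborel \<partial>circ)"
proof -
  have [measurable]: "g \<in> borel_measurable (borel \<Otimes>\<^sub>M borel)"
    unfolding borel_prod by measurable
  have "(\<integral>\<^sup>+z. g z \<partial>cyl) = (\<integral>\<^sup>+z. ennreal (cyl_weight (fst z)) * g z \<partial>restrict_space lborel ({0..1} \<times> {0..<2 * pi}))"
    unfolding cyl_eq by (rule nn_integral_density) (simp_all add: measurable_restrict_space1)
  also have "\<dots> = (\<integral>\<^sup>+z. ennreal (cyl_weight (fst z)) * g z * indicator ({0..1} \<times> {0..<2 * pi}) z \<partial>(lborel \<Otimes>\<^sub>M lborel))"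
    by (subst nn_integral_restrict_space) (simp_all add: lborel_prod)
  also have "\<dots> = (\<integral>\<^sup>+a. \<integral>\<^sup>+u. ennreal (cyl_weight u) * g (u, a) * indicator ({0..1} \<times> {0..<2 * pi}) (u, a) \<partial>lborel \<partial>lborel)"
    by (subst lborel_pair.nn_integral_snd[symmetric]) simp_all
  also have "\<dots> = (\<integral>\<^sup>+a. (\<integral>\<^sup>+u. indicator {0..1} u * (ennreal (cyl_weight u) * g (u, a)) \<partial>lborel) * indicator {0..<2 * pi} a \<partial>lborel)"
    by (rule nn_integral_cong) (auto simp: indicator_def mult.commute intro!: nn_integral_cong)
  also have "\<dots> = (\<integral>\<^sup>+a. \<integral>\<^sup>+u. indicator {0..1} u * (ennreal (cyl_weight u) * g (u, a)) \<partial>lborel \<partial>circ)"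
    by (rule circ_nn_integral_lborel[symmetric])
  finally show ?thesis .
qed

lemma integral_cyl:
  fixes g :: "real \<times> real \<Rightarrow> real"
  assumes [measurable]: "g \<in> borel_measurable borel" and i: "integrable cyl g"
  shows "(\<integral>z. g z \<partial>cyl) = (\<integral>a. \<integral>u. indicator {0..1} u * (cyl_weight u * g (u, a)) \<partial>lborel \<partial>circ)"
proof -
  let ?R = "{0..1} \<times> {0..<2 * pi} :: (real \<times> real) set"
  have m: "g \<in> borel_measurable (restrict_space lborel ?R)" "(\<lambda>z. cyl_weight (fst z)) \<in> borel_measurable (restrict_space lborel ?R)"
    by (simp_all add: measurable_restrict_space1)
  have ae: "AE z in restrict_space lborel ?R. 0 \<le> cyl_weight (fst z)"
    by (rule AE_I2) (auto simp: space_restrict_space cyl_weight_nonneg)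
  have i1: "integrable (restrict_space lborel ?R) (\<lambda>z. cyl_weight (fst z) *\<^sub>R g z)"
    using i integrable_density[OF m ae] unfolding cyl_eq by simp
  then have i2: "integrable (lborel \<Otimes>\<^sub>M lborel) (\<lambda>z. indicator ?R z *\<^sub>R (cyl_weight (fst z) *\<^sub>R g z))"
    by (subst (asm) integrable_restrict_space) (auto simp: lborel_prod)
  have "(\<integral>z. g z \<partial>cyl) = (\<integral>z. cyl_weight (fst z) *\<^sub>R g z \<partial>restrict_space lborel ?R)"
    unfolding cyl_eq by (rule integral_density[OF m ae])
  also have "\<dots> = (\<integral>z. indicator ?R z *\<^sub>R (cyl_weight (fst z) *\<^sub>R g z) \<partial>(lborel \<Otimes>\<^sub>M lborel))"
    by (subst integral_restrict_space) (auto simp: lborel_prod)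
  also have "\<dots> = (\<integral>a. \<integral>u. indicator ?R (u, a) *\<^sub>R (cyl_weight (fst (u, a)) *\<^sub>R g (u, a)) \<partial>lborel \<partial>lborel)"
    using lborel_pair.integral_snd[of "\<lambda>u a. indicator ?R (u, a) *\<^sub>R (cyl_weight u *\<^sub>R g (u, a))"] i2
    by (simp add: case_prod_beta')
  also have "\<dots> = (\<integral>a. indicator {0..<2 * pi} a * (\<integral>u. indicator {0..1} u * (cyl_weight u * g (u, a)) \<partial>lborel) \<partial>lborel)"
    by (rule Bochner_Integration.integral_cong) (auto simp: indicator_def intro!: Bochner_Integration.integral_cong)
  also have "\<dots> = (\<integral>a. \<integral>u. indicator {0..1} u * (cyl_weight u * g (u, a)) \<partial>lborel \<partial>circ)"
    by (rule circ_integral_lborel[symmetric])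
  finally show ?thesis .
qed

text \<open>The density of the cylinder and the prefactor of the transform are reciprocal as long as
  the square root is positive, hence the restriction to u < 1.\<close>

lemma cyl_weight_radon:
  assumes "0 \<le> u" "u < 1"
  shows "cyl_weight u * radon f (u, a) = (\<integral>t. dext f (rot a (u, t)) \<partial>lborel)"
proof -
  have "u\<^sup>2 < 1" using assms by (simp add: power_less_one_iff abs_square_less_1)
  then show ?thesis by (simp add: radon_eq_dext cyl_weight_def)
qed

text \<open>Cauchy-Schwarz on a chord of length 2 sqrt (1 - u^2). That length cancels what remains
  of the squared prefactor after multiplication by the weight, so the constant pi is uniform in
  u.\<close>

lemma radon_sq_le:
  assumes f: "f \<in> borel_measurable disk" and u: "0 \<le> u" "u < 1"
  shows "ennreal (cyl_weight u) * ennreal ((radon f (u, a))\<^sup>2) \<le> ennreal pi * (\<integral>\<^sup>+t. ennreal ((dext f (rot a (u, t)))\<^sup>2) \<partial>lborel)"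
proof -
  note [measurable] = dext_measurable[OF f]
  let ?s = "sqrt (1 - u\<^sup>2)"
  let ?F = "\<lambda>t. dext f (rot a (u, t))"
  have u2: "u\<^sup>2 < 1" using u by (simp add: abs_square_less_1)
  then have s: "?s > 0" by simp
  have m [measurable]: "?F \<in> borel_measurable borel"
    unfolding rot_def fst_conv snd_conv using borel_prod[where ?'a=real and ?'b=real] by measurable
  \<comment> \<open>A function that is not integrable along the line has integral 0 by convention,
    so the bound needs no integrability.\<close>
  have "ennreal \<bar>\<integral>t. ?F t \<partial>lborel\<bar> \<le> (\<integral>\<^sup>+t. ennreal \<bar>?F t\<bar> \<partial>lborel)"
    by (cases "integrable lborel ?F")
      (use integral_norm_bound_ennreal[of lborel ?F] in \<open>auto simp: not_integrable_integral_eq\<close>)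
  then have "(ennreal \<bar>\<integral>t. ?F t \<partial>lborel\<bar>)\<^sup>2 \<le> (\<integral>\<^sup>+t. ennreal \<bar>?F t\<bar> \<partial>lborel)\<^sup>2"
    by (intro power_mono) auto
  also have "(\<integral>\<^sup>+t. ennreal \<bar>?F t\<bar> \<partial>lborel) = (\<integral>\<^sup>+t. ennreal \<bar>?F t\<bar> * indicator {-?s..?s} t \<partial>lborel)"
  proof (rule nn_integral_cong)
    fix t
    have "?F t = 0" if "t \<notin> {-?s..?s}"
      using that disk_section[of t u] norm_rot_pair[of a u t] by (auto simp: dext_def)
    then show "ennreal \<bar>?F t\<bar> = ennreal \<bar>?F t\<bar> * indicator {-?s..?s} t"
      by (auto simp: indicator_def)
  qed
  also have "(\<integral>\<^sup>+t. ennreal \<bar>?F t\<bar> * indicator {-?s..?s} t \<partial>lborel)\<^sup>2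
      \<le> (\<integral>\<^sup>+t. (ennreal \<bar>?F t\<bar>)\<^sup>2 \<partial>lborel) * (\<integral>\<^sup>+t. (indicator {-?s..?s} t)\<^sup>2 \<partial>lborel)"
    by (rule Cauchy_Schwarz_nn_integral) auto
  also have "(\<integral>\<^sup>+t. (indicator {-?s..?s} t)\<^sup>2 \<partial>lborel) = (\<integral>\<^sup>+t. indicator {-?s..?s} t \<partial>lborel)"
    by (rule nn_integral_cong) (auto simp: indicator_def)
  also have "\<dots> = ennreal (2 * ?s)"
    using s by simp
  also have "(\<integral>\<^sup>+t. (ennreal \<bar>?F t\<bar>)\<^sup>2 \<partial>lborel) = (\<integral>\<^sup>+t. ennreal ((?F t)\<^sup>2) \<partial>lborel)"
    by (simp add: ennreal_power)
  finally have le: "ennreal ((\<integral>t. ?F t \<partial>lborel)\<^sup>2) \<le> (\<integral>\<^sup>+t. ennreal ((?F t)\<^sup>2) \<partial>lborel) * ennreal (2 * ?s)"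
    by (simp add: ennreal_power)
  have "cyl_weight u * (radon f (u, a))\<^sup>2 = pi / (2 * ?s) * (\<integral>t. ?F t \<partial>lborel)\<^sup>2"
  proof -
    have "2 / pi * w * (pi / (2 * w) * I)\<^sup>2 = pi / (2 * w) * I\<^sup>2" if "w > 0" for w I :: real
      using that by (simp add: power2_eq_square field_simps)
    from this[OF s] show ?thesis by (simp add: radon_eq_dext cyl_weight_def)
  qed
  then have "ennreal (cyl_weight u) * ennreal ((radon f (u, a))\<^sup>2) = ennreal (pi / (2 * ?s)) * ennreal ((\<integral>t. ?F t \<partial>lborel)\<^sup>2)"
    using s u by (simp flip: ennreal_mult add: cyl_weight_nonneg)
  also have "\<dots> \<le> ennreal (pi / (2 * ?s)) * ((\<integral>\<^sup>+t. ennreal ((?F t)\<^sup>2) \<partial>lborel) * ennreal (2 * ?s))"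
    by (rule mult_left_mono[OF le]) simp
  also have "\<dots> = (ennreal (pi / (2 * ?s)) * ennreal (2 * ?s)) * (\<integral>\<^sup>+t. ennreal ((?F t)\<^sup>2) \<partial>lborel)"
    by (simp add: ac_simps)
  also have "ennreal (pi / (2 * ?s)) * ennreal (2 * ?s) = ennreal pi"
    using s by (subst ennreal_mult[symmetric]) auto
  finally show ?thesis .
qed

lemma dext_sq: "(dext f x)\<^sup>2 = dext (\<lambda>x. (f x)\<^sup>2) x"
  by (simp add: dext_def indicator_def)

text \<open>For each angle the chord bounds integrate, after a rotation, to pi times the full
  squared norm; the angles contribute the finite mass of the circle.\<close>

lemma radon_L2:
  assumes f: "f \<in> L2 disk"
  shows "radon f \<in> L2 cyl"
proof -
  have fm: "f \<in> borel_measurable disk" and fi: "integrable disk (\<lambda>x. (f x)\<^sup>2)"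
    using f by (auto simp: L2_def)
  note [measurable] = dext_measurable[OF fm] radon_measurable[OF fm]
  have fin: "(\<integral>\<^sup>+x. ennreal ((dext f x)\<^sup>2) \<partial>lborel) < \<infinity>"
  proof -
    have "(\<lambda>x. (dext f x)\<^sup>2) = dext (\<lambda>x. (f x)\<^sup>2)"
      by (auto simp: dext_sq)
    then have "integrable lborel (\<lambda>x. (dext f x)\<^sup>2)"
      using fi unfolding disk_integrable by simp
    then show ?thesis by (simp add: integrable_iff_bounded)
  qed
  have [measurable]: "(\<lambda>x. dext f (rot a x)) \<in> borel_measurable (borel \<Otimes>\<^sub>M borel)" for a
    unfolding borel_prod by measurable
  have "(\<integral>\<^sup>+z. ennreal ((radon f z)\<^sup>2) \<partial>cyl)
     = (\<integral>\<^sup>+a. \<integral>\<^sup>+u. indicator {0..1} u * (ennreal (cyl_weight u) * ennreal ((radon f (u, a))\<^sup>2)) \<partial>lborel \<partial>circ)"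
    by (rule nn_integral_cyl) measurable
  also have "\<dots> \<le> (\<integral>\<^sup>+a. ennreal pi * (\<integral>\<^sup>+z. ennreal ((dext f z)\<^sup>2) \<partial>lborel) \<partial>circ)"
  proof (rule nn_integral_mono)
    fix a
    have "(\<integral>\<^sup>+u. indicator {0..1} u * (ennreal (cyl_weight u) * ennreal ((radon f (u, a))\<^sup>2)) \<partial>lborel)
       \<le> (\<integral>\<^sup>+u. ennreal pi * (\<integral>\<^sup>+t. ennreal ((dext f (rot a (u, t)))\<^sup>2) \<partial>lborel) \<partial>lborel)"
    proof (rule nn_integral_mono)
      fix u :: real
      \<comment> \<open>At u = 1, which the chord bound excludes, the weight is 0.\<close>
      show "indicator {0..1} u * (ennreal (cyl_weight u) * ennreal ((radon f (u, a))\<^sup>2))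
        \<le> ennreal pi * (\<integral>\<^sup>+t. ennreal ((dext f (rot a (u, t)))\<^sup>2) \<partial>lborel)"
        using radon_sq_le[OF fm, of u a] by (cases "0 \<le> u \<and> u < 1"; cases "u = 1") (auto simp: indicator_def cyl_weight_def)
    qed
    also have "\<dots> = ennreal pi * (\<integral>\<^sup>+u. \<integral>\<^sup>+t. ennreal ((dext f (rot a (u, t)))\<^sup>2) \<partial>lborel \<partial>lborel)"
      by (rule nn_integral_cmult) measurable
    also have "(\<integral>\<^sup>+u. \<integral>\<^sup>+t. ennreal ((dext f (rot a (u, t)))\<^sup>2) \<partial>lborel \<partial>lborel)
       = (\<integral>\<^sup>+z. ennreal ((dext f (rot a z))\<^sup>2) \<partial>(lborel \<Otimes>\<^sub>M lborel))"
      by (subst lborel.nn_integral_fst[symmetric]) simp_all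
    also have "\<dots> = (\<integral>\<^sup>+z. ennreal ((dext f z)\<^sup>2) \<partial>lborel)"
      unfolding lborel_prod by (rule nn_integral_rot) measurable
    finally show "(\<integral>\<^sup>+u. indicator {0..1} u * (ennreal (cyl_weight u) * ennreal ((radon f (u, a))\<^sup>2)) \<partial>lborel)
       \<le> ennreal pi * (\<integral>\<^sup>+z. ennreal ((dext f z)\<^sup>2) \<partial>lborel)" .
  qed
  also have "\<dots> < \<infinity>"
    using fin by (simp add: emeasure_circ[unfolded space_circ] ennreal_mult_less_top)
  finally show ?thesis
    by (simp add: L2_def integrable_iff_bounded borel_measurable_cyl)
qed

section \<open>Square-integrable functions\<close>

lemma L2_add: "f \<in> L2 M \<Longrightarrow> g \<in> L2 M \<Longrightarrow> (\<lambda>x. f x + g x) \<in> L2 M"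
  and L2_mult: "f \<in> L2 M \<Longrightarrow> g \<in> L2 M \<Longrightarrow> integrable M (\<lambda>x. f x * g x)"
proof -
  assume f: "f \<in> L2 M" and g: "g \<in> L2 M"
  have m [measurable]: "f \<in> borel_measurable M" "g \<in> borel_measurable M"
    using f g by (auto simp: L2_def)
  have i: "integrable M (\<lambda>x. (f x)\<^sup>2 + (g x)\<^sup>2)"
    using f g by (auto simp: L2_def)
  show fg: "integrable M (\<lambda>x. f x * g x)"
  proof (rule Bochner_Integration.integrable_bound[OF i])
    have "\<bar>a * b\<bar> \<le> a\<^sup>2 + b\<^sup>2" for a b :: real
      using sum_squares_bound[of a b] sum_squares_bound[of a "-b"] by (auto simp: abs_le_iff)
    then show "AE x in M. norm (f x * g x) \<le> norm ((f x)\<^sup>2 + (g x)\<^sup>2)"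
      by simp
  qed measurable
  have "integrable M (\<lambda>x. ((f x)\<^sup>2 + (g x)\<^sup>2) + 2 * (f x * g x))"
    by (intro Bochner_Integration.integrable_add i integrable_mult_right fg)
  then show "(\<lambda>x. f x + g x) \<in> L2 M"
    by (simp add: L2_def power2_sum mult.assoc)
qed

lemma L2_scale: "f \<in> L2 M \<Longrightarrow> (\<lambda>x. c * f x) \<in> L2 M"
  by (auto simp: L2_def power_mult_distrib)

lemma L2_diff: "f \<in> L2 M \<Longrightarrow> g \<in> L2 M \<Longrightarrow> (\<lambda>x. f x - g x) \<in> L2 M"
  using L2_add[of f M "\<lambda>x. - 1 * g x"] L2_scale[of g M "-1"] by simp

lemma L2_zero: "(\<lambda>x. 0) \<in> L2 M"
  by (simp add: L2_def)

lemma L2_sum: "(\<And>i. i \<in> S \<Longrightarrow> f i \<in> L2 M) \<Longrightarrow> (\<lambda>x. \<Sum>i\<in>S. f i x) \<in> L2 M"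
  by (induction S rule: infinite_finite_induct) (auto simp: L2_zero intro: L2_add)

lemma l2_inner_commute: "l2_inner M f g = l2_inner M g f"
  by (simp add: l2_inner_def mult.commute)

lemma l2_inner_add: "f \<in> L2 M \<Longrightarrow> g \<in> L2 M \<Longrightarrow> h \<in> L2 M \<Longrightarrow>
    l2_inner M (\<lambda>x. f x + g x) h = l2_inner M f h + l2_inner M g h"
  by (simp add: l2_inner_def distrib_right L2_mult)

lemma l2_inner_diff: "f \<in> L2 M \<Longrightarrow> g \<in> L2 M \<Longrightarrow> h \<in> L2 M \<Longrightarrow>
    l2_inner M (\<lambda>x. f x - g x) h = l2_inner M f h - l2_inner M g h"
  by (simp add: l2_inner_def left_diff_distrib L2_mult)

lemma l2_inner_scale: "l2_inner M (\<lambda>x. c * f x) h = c * l2_inner M f h"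
  by (simp add: l2_inner_def mult.assoc)

lemma l2_inner_sum: "(\<And>i. i \<in> S \<Longrightarrow> f i \<in> L2 M) \<Longrightarrow> h \<in> L2 M \<Longrightarrow>
    l2_inner M (\<lambda>x. \<Sum>i\<in>S. f i x) h = (\<Sum>i\<in>S. l2_inner M (f i) h)"
  by (simp add: l2_inner_def sum_distrib_right L2_mult)

lemma l2_inner_diff_right: "f \<in> L2 M \<Longrightarrow> g \<in> L2 M \<Longrightarrow> h \<in> L2 M \<Longrightarrow>
    l2_inner M h (\<lambda>x. f x - g x) = l2_inner M h f - l2_inner M h g"
  using l2_inner_diff[of f M g h] by (simp only: l2_inner_commute[of M h])

lemma l2_norm_sq: "(l2_norm M f)\<^sup>2 = l2_inner M f f"
  by (simp add: l2_norm_def l2_inner_def power2_eq_square)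

lemma l2_norm_nonneg [simp]: "l2_norm M f \<ge> 0"
  by (simp add: l2_norm_def)

lemma l2_inner_self_nonneg [simp]: "l2_inner M f f \<ge> 0"
  by (simp add: l2_inner_def)

lemma l2_norm_sq_diff:
  assumes "f \<in> L2 M" "g \<in> L2 M"
  shows "(l2_norm M (\<lambda>x. f x - g x))\<^sup>2 = (l2_norm M f)\<^sup>2 - 2 * l2_inner M f g + (l2_norm M g)\<^sup>2"
proof -
  have "(l2_norm M (\<lambda>x. f x - g x))\<^sup>2 = l2_inner M f (\<lambda>x. f x - g x) - l2_inner M g (\<lambda>x. f x - g x)"
    unfolding l2_norm_sq by (rule l2_inner_diff[OF assms L2_diff[OF assms]])
  also have "l2_inner M f (\<lambda>x. f x - g x) = l2_inner M f f - l2_inner M f g"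
    by (rule l2_inner_diff_right[OF assms(1,2,1)])
  also have "l2_inner M g (\<lambda>x. f x - g x) = l2_inner M g f - l2_inner M g g"
    by (rule l2_inner_diff_right[OF assms(1,2,2)])
  finally show ?thesis
    unfolding l2_norm_sq l2_inner_commute[of M g f] by linarith
qed

lemma l2_norm_sq_add:
  assumes "f \<in> L2 M" "g \<in> L2 M"
  shows "(l2_norm M (\<lambda>x. f x + g x))\<^sup>2 = (l2_norm M f)\<^sup>2 + 2 * l2_inner M f g + (l2_norm M g)\<^sup>2"
  using l2_norm_sq_diff[OF assms(1) L2_scale[OF assms(2), of "-1"]]
  by (simp add: l2_norm_sq l2_inner_def)

lemma l2_inner_le:
  assumes f: "f \<in> L2 M" and g: "g \<in> L2 M"
  shows "\<bar>l2_inner M f g\<bar> \<le> l2_norm M f * l2_norm M g"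
proof -
  let ?A = "l2_inner M f f" and ?B = "l2_inner M f g" and ?C = "l2_inner M g g"
  have q: "0 \<le> ?A - 2 * t * ?B + t\<^sup>2 * ?C" for t
  proof -
    have "0 \<le> (l2_norm M (\<lambda>x. f x - t * g x))\<^sup>2" by simp
    also have "\<dots> = ?A - 2 * t * ?B + t\<^sup>2 * ?C"
    proof -
      have "l2_inner M (\<lambda>x. t * g x) (\<lambda>x. t * g x) = t\<^sup>2 * ?C"
        by (simp add: l2_inner_def power2_eq_square mult_ac)
      moreover have "l2_inner M f (\<lambda>x. t * g x) = t * ?B"
        by (simp add: l2_inner_def mult.left_commute)
      ultimately show ?thesis
        using l2_norm_sq_diff[OF f L2_scale[OF g, of t]] by (simp add: l2_norm_sq)
    qed
    finally show ?thesis .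
  qed
  have "?B\<^sup>2 \<le> ?A * ?C"
  proof (cases "?C = 0")
    case True
    have "?B = 0"
    proof (rule ccontr)
      \<comment> \<open>With \<open>?C = 0\<close> the quadratic is affine in t, and the value of t
        chosen below makes it -1.\<close>
      assume "?B \<noteq> 0"
      then show False using q[of "(?A + 1) / (2 * ?B)"] True by simp
    qed
    with True show ?thesis by simp
  next
    case False
    then have C: "?C > 0" using l2_inner_self_nonneg[of M g] by linarith
    have "0 \<le> (?A - 2 * (?B / ?C) * ?B + (?B / ?C)\<^sup>2 * ?C) * ?C"
      using q[of "?B / ?C"] C by (intro mult_nonneg_nonneg) auto
    also have "\<dots> = ?A * ?C - ?B\<^sup>2"
      using C by (simp add: field_simps power2_eq_square)
    finally show ?thesis by simp
  qed
  also have "\<dots> = (l2_norm M f * l2_norm M g)\<^sup>2"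
    by (simp add: power_mult_distrib l2_norm_sq)
  finally show ?thesis
    by (rule power2_le_imp_le[OF order_trans[OF eq_refl[OF power2_abs]]]) simp
qed

lemma L2_bounded:
  assumes "finite_measure M" "f \<in> borel_measurable M" "\<And>x. x \<in> space M \<Longrightarrow> \<bar>f x\<bar> \<le> B"
  shows "f \<in> L2 M"
proof -
  interpret finite_measure M by fact
  have "integrable M (\<lambda>x. (f x)\<^sup>2)"
  proof (rule integrable_const_bound[of _ "B\<^sup>2"])
    show "AE x in M. norm ((f x)\<^sup>2) \<le> B\<^sup>2"
    proof (rule AE_I2)
      fix x assume "x \<in> space M"
      then have "\<bar>f x\<bar>\<^sup>2 \<le> B\<^sup>2" using assms(3) by (intro power_mono) auto
      then show "norm ((f x)\<^sup>2) \<le> B\<^sup>2" by simp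
    qed
  qed (use assms in simp)
  then show ?thesis using assms by (simp add: L2_def)
qed

lemma L2_integrable_finite:
  assumes "finite_measure M" "f \<in> L2 M"
  shows "integrable M f"
proof -
  interpret finite_measure M by fact
  have "(\<lambda>x. 1) \<in> L2 M" by (simp add: L2_def)
  from L2_mult[OF assms(2) this] show ?thesis by simp
qed

lemma AE_eq_of_l2_dist_0:
  assumes "f \<in> L2 M" "g \<in> L2 M" "l2_norm M (\<lambda>x. f x - g x) = 0"
  shows "AE x in M. f x = g x"
proof -
  have "integrable M (\<lambda>x. (f x - g x)\<^sup>2)"
    using L2_diff[OF assms(1,2)] by (simp add: L2_def)
  moreover have "(\<integral>x. (f x - g x)\<^sup>2 \<partial>M) = 0"
    using assms(3) by (simp add: l2_norm_def)
  ultimately have "AE x in M. (f x - g x)\<^sup>2 = 0"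
    using integral_nonneg_eq_0_iff_AE[of M "\<lambda>x. (f x - g x)\<^sup>2"] by simp
  then show ?thesis by simp
qed

lemma l2_inner_AE_cong:
  assumes "f \<in> L2 M" "g \<in> L2 M" "f' \<in> L2 M" "AE x in M. f x = f' x"
  shows "l2_inner M f g = l2_inner M f' g"
  unfolding l2_inner_def
proof (rule integral_cong_AE)
  show "(\<lambda>x. f x * g x) \<in> borel_measurable M" "(\<lambda>x. f' x * g x) \<in> borel_measurable M"
    using assms by (auto simp: L2_def)
  show "AE x in M. f x * g x = f' x * g x"
    using assms(4) by eventually_elim simp
qed

section \<open>The adjoint of the Radon transform\<close>

text \<open>The singular functions on the cylinder up to scaling; their squared norm is pi. They are
  given by the same formula for negative u, which the symmetry argument uses.\<close>

definition psi :: "nat \<Rightarrow> nat \<Rightarrow> real \<times> real \<Rightarrow> real" where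
  "psi j k z = cheb (j + k) (fst z) * ang (int j - int k) (snd z)"

lemma psi_measurable: "psi j k \<in> borel_measurable borel"
  unfolding psi_def borel_prod[symmetric] by measurable

lemma abs_psi_le: "\<bar>u\<bar> \<le> 1 \<Longrightarrow> \<bar>psi j k (u, a)\<bar> \<le> real (Suc (j + k)) * 2"
  unfolding psi_def abs_mult fst_conv snd_conv by (intro mult_mono abs_cheb_le abs_ang_le) auto

lemma ang_add_pi: "ang m (a + pi) = (if even m then 1 else - 1) * ang m a"
proof -
  have c: "cos (of_int m * pi) = (if even m then 1 else - 1)" and s: "sin (of_int m * pi) = 0"
    using cos_npi_int[of m] sin_npi_int[of m] by (simp_all add: mult.commute)
  show ?thesis
    unfolding ang_def distrib_left cos_add sin_add c s by simp
qed

text \<open>The parameters (u, a) and (-u, a + pi) describe the same line. The two signs cancel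
  since j + k and j - k have the same parity.\<close>

lemma psi_symmetric: "psi j k (- u, a + pi) = psi j k (u, a)"
proof -
  have "even (int j - int k) \<longleftrightarrow> even (j + k)" by simp
  then show ?thesis by (simp add: psi_def cheb_uminus ang_add_pi)
qed

lemma psi_periodic: "psi j k (u, a + 2 * pi) = psi j k (u, a)"
  using psi_symmetric[of j k "- u" "a + pi"] psi_symmetric[of j k u a] by (simp add: add.assoc)

text \<open>The value 1/2 at 0 makes \<open>chi u + chi (- u) = 1\<close> hold everywhere.\<close>

definition chi :: "real \<Rightarrow> real" where
  "chi u = (1 + sgn u) / 2"

lemma chi_measurable [measurable]: "chi \<in> borel_measurable borel"
  unfolding chi_def sgn_real_def by measurable

lemma abs_chi_le: "\<bar>chi u\<bar> \<le> 1"
  by (simp add: chi_def sgn_real_def)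

lemma ridge_add_pi: "ridge x (a + pi) = - ridge x a" and ridge_add_2pi: "ridge x (a + 2 * pi) = ridge x a"
  by (simp_all add: ridge_def)

lemma ridge_measurable [measurable]: "ridge x \<in> borel_measurable borel"
  unfolding ridge_def by measurable

lemma nrm_pos: "nrm n > 0"
  by (simp add: nrm_def)

lemma nrm_sq: "(nrm n)\<^sup>2 = real (Suc n) / pi"
  by (simp add: nrm_def)

lemma circ_psi_ridge: "(\<integral>a. psi j k (ridge x a, a) \<partial>circ) = 2 * pi / nrm (j + k) * basis j k x"
proof -
  have "(\<integral>a. nrm (j + k) / (2 * pi) * (cheb (j + k) (ridge x a) * ang (int j - int k) a) \<partial>circ) = basis j k x"
    using basis_eq_circ by (rule has_bochner_integral_integral_eq)
  then have "basis j k x = nrm (j + k) / (2 * pi) * (\<integral>a. psi j k (ridge x a, a) \<partial>circ)"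
    by (simp add: psi_def)
  then show ?thesis using nrm_pos[of "j + k"] by simp
qed

text \<open>The cutoff to u \<ge> 0 costs exactly a factor 2: the half turn exchanges the two halves
  and preserves \<open>psi\<close>, and the two cutoffs add up to 1.\<close>

lemma circ_chi_psi_ridge:
  assumes x: "norm x \<le> 1"
  shows "(\<integral>a. chi (ridge x a) * psi j k (ridge x a, a) \<partial>circ) = pi / nrm (j + k) * basis j k x"
proof -
  let ?p = "\<lambda>a. psi j k (ridge x a, a)"
  have pm [measurable]: "?p \<in> borel_measurable borel"
    unfolding psi_def fst_conv snd_conv by measurable
  have B: "\<bar>?p a\<bar> \<le> real (Suc (j + k)) * 2" for a
    using abs_ridge_le[of x a] x by (intro abs_psi_le) linarith
  let ?k = "\<lambda>s a. chi (s * ridge x a) * ?p a"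
  have kB: "\<bar>?k s a\<bar> \<le> 1 * (real (Suc (j + k)) * 2)" for s a
    unfolding abs_mult[of "chi _"] by (intro mult_mono abs_chi_le B) auto
  have i: "integrable circ (?k s)" for s
    using kB by (intro integrable_circ_bounded) measurable
  have "(\<integral>a. ?k 1 (a + pi) \<partial>circ) = (\<integral>a. ?k 1 a \<partial>circ)"
    by (rule circ_shift_pi[OF _ kB]) (simp_all add: ridge_add_2pi psi_periodic)
  moreover have "?k 1 (a + pi) = ?k (- 1) a" for a
    by (simp add: ridge_add_pi psi_symmetric)
  ultimately have "2 * (\<integral>a. ?k 1 a \<partial>circ) = (\<integral>a. ?k 1 a \<partial>circ) + (\<integral>a. ?k (- 1) a \<partial>circ)"
    by simp
  also have "\<dots> = (\<integral>a. ?k 1 a + ?k (- 1) a \<partial>circ)"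
    by (rule Bochner_Integration.integral_add[OF i i, symmetric])
  also have "\<dots> = (\<integral>a. ?p a \<partial>circ)"
    by (rule Bochner_Integration.integral_cong) (simp_all add: chi_def sgn_minus field_simps)
  also have "\<dots> = 2 * pi / nrm (j + k) * basis j k x"
    by (rule circ_psi_ridge)
  finally show ?thesis by simp
qed

lemma finite_measure_cyl: "finite_measure cyl"
proof (rule finite_measureI)
  have "emeasure cyl (space cyl) = (\<integral>\<^sup>+z. 1 \<partial>cyl)" by simp
  also have "\<dots> = (\<integral>\<^sup>+a. \<integral>\<^sup>+u. indicator {0..1} u * (ennreal (cyl_weight u) * 1) \<partial>lborel \<partial>circ)"
    by (rule nn_integral_cyl) simp
  also have "\<dots> \<le> (\<integral>\<^sup>+a. \<integral>\<^sup>+u. indicator {0..1::real} u \<partial>lborel \<partial>circ)"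
  proof (intro nn_integral_mono)
    fix u :: real
    have "cyl_weight u \<le> 1 * 1" if "u \<in> {0..1}"
      unfolding cyl_weight_def
      by (rule mult_mono) (use that pi_ge_two in \<open>auto simp: abs_square_le_1\<close>)
    then show "indicator {0..1} u * (ennreal (cyl_weight u) * 1) \<le> indicator {0..1} u"
      by (auto simp: indicator_def)
  qed
  also have "\<dots> < \<infinity>"
    by (simp add: emeasure_circ[unfolded space_circ])
  finally show "emeasure cyl (space cyl) \<noteq> \<infinity>" by simp
qed

lemma psi_L2: "psi j k \<in> L2 cyl"
proof (rule L2_bounded[OF finite_measure_cyl])
  show "psi j k \<in> borel_measurable cyl"
    by (rule borel_measurable_cyl[OF psi_measurable])
  show "\<bar>psi j k z\<bar> \<le> real (Suc (j + k)) * 2" if "z \<in> space cyl" for z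
    using that abs_psi_le[of "fst z" j k "snd z"] by (auto simp: space_cyl)
qed

lemma circ_id: "(\<lambda>x. x) \<in> circ \<rightarrow>\<^sub>M borel"
  by (rule measurable_circ) simp

lemma measurable_circ_lborel:
  fixes k :: "real \<times> (real \<times> real) \<Rightarrow> real"
  assumes "k \<in> borel_measurable (borel \<Otimes>\<^sub>M borel)"
  shows "k \<in> borel_measurable (circ \<Otimes>\<^sub>M lborel)"
proof -
  have "(\<lambda>z. (fst z, snd z)) \<in> circ \<Otimes>\<^sub>M lborel \<rightarrow>\<^sub>M borel \<Otimes>\<^sub>M (borel :: (real \<times> real) measure)"
    using measurable_compose[OF measurable_fst circ_id]
    by (intro measurable_Pair) (auto intro: measurable_compose[OF measurable_snd])
  from measurable_compose[OF this assms] show ?thesis by simp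
qed

text \<open>For a fixed angle, (u, t) are rotated coordinates of the disk and u becomes the ridge
  variable. The pairing is then an integral over angle and disk; doing the angle first leaves the
  half-circle average of ridge functions, a multiple of \<open>basis j k\<close>.\<close>

lemma radon_adjoint:
  assumes f: "f \<in> L2 disk"
  shows "l2_inner cyl (radon f) (psi j k) = pi / nrm (j + k) * l2_inner disk f (basis j k)"
proof -
  have fm: "f \<in> borel_measurable disk" using f by (auto simp: L2_def)
  note [measurable] = dext_measurable[OF fm] radon_measurable[OF fm] psi_measurable
  have fi: "integrable lborel (dext f)"
    using L2_integrable_finite[OF finite_measure_disk f] by (simp add: disk_integrable)
  define K where "K = real (Suc (j + k)) * 2"
  \<comment> \<open>The integrand after the rotation. \<open>chi\<close> encodes u \<ge> 0, and the
    bound by a multiple of \<open>dext f\<close> justifies Fubini.\<close>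
  define G where "G = (\<lambda>a x. dext f x * (chi (ridge x a) * psi j k (ridge x a, a)))"
  have GB: "\<bar>G a x\<bar> \<le> K * \<bar>dext f x\<bar>" for a x
  proof (cases "norm x \<le> 1")
    case True
    have "\<bar>chi (ridge x a) * psi j k (ridge x a, a)\<bar> \<le> 1 * K"
      unfolding abs_mult K_def
      by (intro mult_mono abs_chi_le abs_psi_le) (use abs_ridge_le[of x a] True in auto)
    then show ?thesis
      unfolding G_def abs_mult[of "dext f x"] by (subst mult.commute) (intro mult_right_mono, auto)
  next
    case False
    then show ?thesis by (simp add: G_def dext_def)
  qed
  have [measurable]: "(\<lambda>z. ridge (snd z) (fst z)) \<in> borel_measurable (borel \<Otimes>\<^sub>M borel)"
    unfolding ridge_def borel_prod[symmetric] by measurable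
  have Gm: "(\<lambda>z. G (fst z) (snd z)) \<in> borel_measurable (borel \<Otimes>\<^sub>M borel)"
    unfolding G_def psi_def fst_conv snd_conv by measurable
  have Gm1 [measurable]: "G a \<in> borel_measurable borel" for a
    using measurable_compose[OF _ Gm, of "\<lambda>x. (a, x)" borel] by simp
  have Gi: "integrable lborel (G a)" for a
    by (rule Bochner_Integration.integrable_bound[of _ "\<lambda>x. K * \<bar>dext f x\<bar>"])
      (use fi GB in \<open>auto intro!: integrable_mult_right integrable_abs AE_I2 order_trans[OF GB abs_ge_self]\<close>)
  have Gri: "integrable lborel (\<lambda>z. G a (rot a z))" for a
    using integrable_distr[of "rot a" lborel borel "G a"] Gi[of a] by (simp add: distr_rot)
  have GT: "integrable (circ \<Otimes>\<^sub>M lborel) (\<lambda>z. G (fst z) (snd z))"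
  proof (rule integrableI_bounded)
    show m: "(\<lambda>z. G (fst z) (snd z)) \<in> borel_measurable (circ \<Otimes>\<^sub>M lborel)"
      by (rule measurable_circ_lborel[OF Gm])
    have "(\<integral>\<^sup>+z. ennreal (norm (G (fst z) (snd z))) \<partial>(circ \<Otimes>\<^sub>M lborel)) = (\<integral>\<^sup>+a. \<integral>\<^sup>+x. ennreal (norm (G a x)) \<partial>lborel \<partial>circ)"
      using m by (subst lborel.nn_integral_fst[symmetric]) simp_all
    also have "\<dots> \<le> (\<integral>\<^sup>+a. \<integral>\<^sup>+x. ennreal (norm (K * dext f x)) \<partial>lborel \<partial>circ)"
      using GB by (intro nn_integral_mono ennreal_leI) (simp add: abs_mult K_def)
    also have "\<dots> < \<infinity>"
      using integrable_mult_right[OF fi, of K] unfolding integrable_iff_bounded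
      by (simp add: emeasure_circ[unfolded space_circ] ennreal_mult_less_top)
    finally show "(\<integral>\<^sup>+z. ennreal (norm (G (fst z) (snd z))) \<partial>(circ \<Otimes>\<^sub>M lborel)) < \<infinity>" .
  qed
  interpret T: pair_sigma_finite circ "lborel :: (real \<times> real) measure" ..
  have line: "(\<integral>u. indicator {0..1} u * (cyl_weight u * (radon f (u, a) * psi j k (u, a))) \<partial>lborel) = (\<integral>x. G a x \<partial>lborel)" for a
  proof -
    have [measurable]: "(\<lambda>z. G a (rot a z)) \<in> borel_measurable (borel \<Otimes>\<^sub>M borel)"
      unfolding borel_prod by measurable
    have "(\<integral>u. indicator {0..1} u * (cyl_weight u * (radon f (u, a) * psi j k (u, a))) \<partial>lborel)
       = (\<integral>u. \<integral>t. G a (rot a (u, t)) \<partial>lborel \<partial>lborel)"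
    proof (rule integral_cong_AE)
      show "(\<lambda>u. indicator {0..1} u * (cyl_weight u * (radon f (u, a) * psi j k (u, a)))) \<in> borel_measurable lborel"
        by measurable
      show "(\<lambda>u. \<integral>t. G a (rot a (u, t)) \<partial>lborel) \<in> borel_measurable lborel"
        by measurable
      \<comment> \<open>Two points are discarded: 0, where \<open>chi\<close> has the value 1/2, and
        1, where the prefactor of the transform degenerates.\<close>
      show "AE u in lborel. indicator {0..1} u * (cyl_weight u * (radon f (u, a) * psi j k (u, a))) = (\<integral>t. G a (rot a (u, t)) \<partial>lborel)"
        using AE_lborel_singleton[of 0] AE_lborel_singleton[of 1]
      proof eventually_elim
        fix u :: real assume u: "u \<noteq> 0" "u \<noteq> 1"
        have e: "(\<integral>t. G a (rot a (u, t)) \<partial>lborel) = chi u * psi j k (u, a) * (\<integral>t. dext f (rot a (u, t)) \<partial>lborel)"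
          unfolding G_def ridge_rot fst_conv by (subst integral_mult_right_zero[symmetric]) (simp add: mult_ac)
        consider "u < 0" | "0 < u" "u < 1" | "u > 1" using u by linarith
        then show "indicator {0..1} u * (cyl_weight u * (radon f (u, a) * psi j k (u, a))) = (\<integral>t. G a (rot a (u, t)) \<partial>lborel)"
        proof cases
          case 1
          then show ?thesis unfolding e by (simp add: chi_def)
        next
          case 2
          then show ?thesis unfolding e using cyl_weight_radon[of u f a] by (simp add: chi_def mult_ac)
        next
          case 3
          have "dext f (rot a (u, t)) = 0" for t
          proof -
            have "1 < u\<^sup>2" using 3 by (simp add: power2_eq_square less_1_mult)
            then have "\<not> u\<^sup>2 + t\<^sup>2 \<le> 1" using zero_le_power2[of t] by linarith
            then show ?thesis using norm_rot_pair[of a u t] by (auto simp: dext_def)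
          qed
          then show ?thesis unfolding e using 3 by simp
        qed
      qed
    qed
    also have "\<dots> = (\<integral>z. G a (rot a z) \<partial>(lborel \<Otimes>\<^sub>M lborel))"
      using Gri[of a] by (intro lborel_pair.integral_fst') (simp add: lborel_prod)
    also have "\<dots> = (\<integral>x. G a x \<partial>lborel)"
      unfolding lborel_prod by (rule integral_rot) simp
    finally show ?thesis .
  qed
  have "l2_inner cyl (radon f) (psi j k) = (\<integral>a. \<integral>u. indicator {0..1} u * (cyl_weight u * (radon f (u, a) * psi j k (u, a))) \<partial>lborel \<partial>circ)"
    unfolding l2_inner_def by (rule integral_cyl) (simp_all add: L2_mult radon_L2 f psi_L2)
  also have "\<dots> = (\<integral>a. \<integral>x. G a x \<partial>lborel \<partial>circ)"
    by (simp only: line)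
  also have "\<dots> = (\<integral>x. \<integral>a. G a x \<partial>circ \<partial>lborel)"
    using GT by (intro T.Fubini_integral[symmetric]) (simp add: case_prod_beta')
  also have "\<dots> = (\<integral>x. pi / nrm (j + k) * dext (\<lambda>x. f x * basis j k x) x \<partial>lborel)"
  proof (rule Bochner_Integration.integral_cong)
    fix x :: "real \<times> real"
    show "(\<integral>a. G a x \<partial>circ) = pi / nrm (j + k) * dext (\<lambda>x. f x * basis j k x) x"
    proof (cases "norm x \<le> 1")
      case True
      show ?thesis
        unfolding G_def integral_mult_right_zero circ_chi_psi_ridge[OF True] by (simp add: dext_def)
    qed (simp add: G_def dext_def)
  qed simp
  also have "\<dots> = pi / nrm (j + k) * l2_inner disk f (basis j k)"
    by (simp add: l2_inner_def disk_integral)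
  finally show ?thesis .
qed

section \<open>The transform of the basis\<close>

text \<open>Since cos (n x) is a polynomial in cos x, it does not matter that arccos (cos x) may
  differ from x. This allows angles outside [0, pi] at the ends of a chord.\<close>

lemma cos_mult_arccos_cos: "cos (real n * arccos (cos x)) = cos (real n * x)"
proof (induction n rule: induct_nat_012)
  case (ge2 n)
  have r: "cos (real (Suc (Suc n)) * y) = 2 * cos y * cos (real (Suc n) * y) - cos (real n * y)" for y
  proof -
    let ?z = "real (Suc n) * y"
    have "real (Suc (Suc n)) * y = ?z + y" "real n * y = ?z - y"
      by (simp_all add: algebra_simps)
    then show ?thesis by (simp only: cos_add cos_diff) simp
  qed
  show ?case unfolding r ge2 by (simp add: cos_arccos_abs)
qed (simp_all add: cos_arccos_abs)

text \<open>The identity T_{n+1}' = (n + 1) U_n between Chebyshev polynomials of the first and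
  second kind, with T_{n+1} written through arccos.\<close>

lemma DERIV_cos_arccos:
  assumes "\<bar>y\<bar> < 1"
  shows "((\<lambda>y. cos (real (Suc n) * arccos y)) has_real_derivative real (Suc n) * cheb n y) (at y)"
proof -
  have y: "- 1 < y" "y < 1" using assms by auto
  have s: "sqrt (1 - y\<^sup>2) > 0" using assms by (simp add: abs_square_less_1)
  have "sqrt (1 - y\<^sup>2) * cheb n y = sin (real (Suc n) * arccos y)"
    using sin_cheb[of "arccos y" n] y by (simp add: sin_arccos cos_arccos)
  then have e: "- sin (real (Suc n) * arccos y) * (real (Suc n) * inverse (- sqrt (1 - y\<^sup>2))) = real (Suc n) * cheb n y"
    using s by (simp add: field_simps)
  have "((\<lambda>y. cos (real (Suc n) * arccos y)) has_real_derivative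
      - sin (real (Suc n) * arccos y) * (real (Suc n) * inverse (- sqrt (1 - y\<^sup>2)))) (at y)"
    using DERIV_arccos[OF y] y by (auto intro!: derivative_eq_intros)
  then show ?thesis unfolding e .
qed

section \<open>Integrals of Chebyshev ridge functions along chords\<close>

definition seg :: "real \<Rightarrow> real measure" where
  "seg s = restrict_space lborel {-s..s}"

lemma seg_integral: "(\<integral>t. f t \<partial>seg s) = set_lebesgue_integral lborel {-s..s} (f :: real \<Rightarrow> real)"
  unfolding seg_def set_lebesgue_integral_def by (subst integral_restrict_space) auto

lemma seg_FTC:
  fixes f :: "real \<Rightarrow> real"
  assumes "s \<ge> 0" "continuous_on {-s..s} f" "continuous_on {-s..s} F"
    and "\<And>t. -s < t \<Longrightarrow> t < s \<Longrightarrow> (F has_real_derivative f t) (at t)"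
  shows "(\<integral>t. f t \<partial>seg s) = F s - F (- s)"
proof -
  have "(f has_integral F s - F (- s)) {-s..s}"
    by (rule fundamental_theorem_of_calculus_interior)
      (use assms in \<open>auto simp: has_real_derivative_iff_has_vector_derivative\<close>)
  moreover have "set_integrable lborel {-s..s} f"
    using assms(2) by (rule borel_integrable_atLeastAtMost')
  ultimately show ?thesis
    unfolding seg_integral by (simp add: set_borel_integral_eq_integral integral_unique)
qed

lemma line_norm_le:
  assumes "u\<^sup>2 + t\<^sup>2 \<le> (1 :: real)" shows "\<bar>u * cos b + t * sin b\<bar> \<le> 1"
proof -
  have "norm (u, t) \<le> 1" using assms by (simp add: norm_Pair)
  then show ?thesis using abs_ridge_le[of "(u, t)" b] by (simp add: ridge_def)
qed

text \<open>With u = cos x and s = sin x the ends of the chord have ridge values cos (x - b) and cos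
  (x + b). The antiderivative is a multiple of T_{n+1}, so the integral is a difference of cosines,
  that is a product of two sines, and each sine gives back a factor \<open>cheb n\<close>. For sin b
  = 0 the integrand is constant along the chord.\<close>

lemma cheb_line_integral:
  assumes u: "0 \<le> u" "u < 1"
  defines "s \<equiv> sqrt (1 - u\<^sup>2)"
  shows "(\<integral>t. cheb n (u * cos b + t * sin b) \<partial>seg s) = 2 * s * cheb n u * cheb n (cos b) / real (Suc n)"
proof -
  define x where "x = arccos u"
  have ux: "u = cos x" and sx: "s = sin x"
    using u by (simp_all add: x_def s_def cos_arccos sin_arccos)
  have s: "s > 0" using u by (simp add: s_def abs_square_less_1)
  have in1: "\<bar>u * cos b + t * sin b\<bar> \<le> 1" if "\<bar>t\<bar> \<le> s" for t
    using that disk_section[of t u] by (intro line_norm_le) (simp add: s_def)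
  show ?thesis
  proof (cases "sin b = 0")
    case True
    then have "\<bar>cos b\<bar> = 1"
      by (metis sin_zero_abs_cos_one)
    then have c: "cheb n (u * cos b) = cheb n u * cheb n (cos b) / real (Suc n)"
    proof -
      have c1: "cheb n 1 = real (Suc n)"
        using cheb_cos[of n 0] by simp
      consider "cos b = 1" | "cos b = - 1" using \<open>\<bar>cos b\<bar> = 1\<close> by linarith
      then show ?thesis
        by cases (simp_all add: c1 cheb_uminus)
    qed
    have "(\<integral>t. cheb n (u * cos b + t * sin b) \<partial>seg s) = (\<integral>t. cheb n (u * cos b) \<partial>seg s)"
      using True by simp
    also have "\<dots> = 2 * s * cheb n (u * cos b)"
      unfolding seg_integral set_lebesgue_integral_def using s by simp
    finally show ?thesis by (simp add: c)
  next
    case False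
    define F where "F = (\<lambda>t. cos (real (Suc n) * arccos (u * cos b + t * sin b)) / (real (Suc n) * sin b))"
    have "(\<integral>t. cheb n (u * cos b + t * sin b) \<partial>seg s) = F s - F (- s)"
    proof (rule seg_FTC)
      show "continuous_on {- s..s} (\<lambda>t. cheb n (u * cos b + t * sin b))"
        by (intro continuous_intros)
      have "\<forall>t\<in>{-s..s}. - 1 \<le> u * cos b + t * sin b \<and> u * cos b + t * sin b \<le> 1"
      proof
        fix t assume "t \<in> {-s..s}"
        then have "\<bar>t\<bar> \<le> s" by auto
        from in1[OF this] show "- 1 \<le> u * cos b + t * sin b \<and> u * cos b + t * sin b \<le> 1"
          by linarith
      qed
      then show "continuous_on {- s..s} F"
        unfolding F_def using False by (intro continuous_intros) auto
      fix t assume t: "- s < t" "t < s"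
      have "t\<^sup>2 < s\<^sup>2" using t by (intro power2_strict_mono) auto
      then have "u\<^sup>2 + t\<^sup>2 < 1" using u by (simp add: s_def abs_square_le_1)
      moreover have "(u * cos b + t * sin b)\<^sup>2 \<le> u\<^sup>2 + t\<^sup>2"
      proof -
        have "\<bar>ridge (u, t) b\<bar> \<le> norm (u, t)" by (rule abs_ridge_le)
        then have "\<bar>u * cos b + t * sin b\<bar>\<^sup>2 \<le> (sqrt (u\<^sup>2 + t\<^sup>2))\<^sup>2"
          by (intro power_mono) (simp_all add: ridge_def norm_Pair)
        then show ?thesis by simp
      qed
      ultimately have y: "\<bar>u * cos b + t * sin b\<bar> < 1"
        by (subst abs_square_less_1[symmetric]) linarith
      have "((\<lambda>t. u * cos b + t * sin b) has_real_derivative sin b) (at t)"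
        by (auto intro!: derivative_eq_intros)
      from DERIV_cdivide[OF DERIV_chain2[OF DERIV_cos_arccos[OF y, of n] this], of "real (Suc n) * sin b"]
      show "(F has_real_derivative cheb n (u * cos b + t * sin b)) (at t)"
        unfolding F_def using False by (simp del: of_nat_Suc)
    qed (use s in simp)
    also have "F s - F (- s) = (cos (real (Suc n) * (x - b)) - cos (real (Suc n) * (x + b))) / (real (Suc n) * sin b)"
    proof -
      have "u * cos b + s * sin b = cos (x - b)" "u * cos b + (- s) * sin b = cos (x + b)"
        by (simp_all add: ux sx cos_add cos_diff)
      then show ?thesis
        unfolding F_def by (simp only: cos_mult_arccos_cos diff_divide_distrib)
    qed
    also have "cos (real (Suc n) * (x - b)) - cos (real (Suc n) * (x + b)) = 2 * (sin (real (Suc n) * x) * sin (real (Suc n) * b))"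
      unfolding right_diff_distrib distrib_left cos_add cos_diff by simp
    also have "\<dots> = 2 * (s * cheb n u * (sin b * cheb n (cos b)))"
      by (simp only: sin_cheb[symmetric] ux sx)
    also have "\<dots> / (real (Suc n) * sin b) = 2 * s * cheb n u * cheb n (cos b) / real (Suc n)"
      using False by (simp add: field_simps del: of_nat_Suc)
    finally show ?thesis .
  qed
qed

section \<open>The basis as a superposition of ridge functions, and its transform\<close>

lemma basis_measurable: "basis j k \<in> borel_measurable borel"
proof -
  have "(\<lambda>z. nrm (j + k) / (2 * pi) * (cheb (j + k) (ridge (fst z) (snd z)) * ang (int j - int k) (snd z)))
      \<in> borel_measurable (borel \<Otimes>\<^sub>M borel)"
    unfolding ridge_def borel_prod[symmetric] by measurable
  moreover have "(\<lambda>z. (fst z, snd z)) \<in> (borel :: (real \<times> real) measure) \<Otimes>\<^sub>M circ \<rightarrow>\<^sub>M borel \<Otimes>\<^sub>M borel"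
    using measurable_compose[OF measurable_snd circ_id] by (intro measurable_Pair) auto
  ultimately have "(\<lambda>z. nrm (j + k) / (2 * pi) * (cheb (j + k) (ridge (fst z) (snd z)) * ang (int j - int k) (snd z)))
      \<in> borel_measurable (borel \<Otimes>\<^sub>M circ)"
    using measurable_compose by force
  then have "(\<lambda>x. \<integral>t. nrm (j + k) / (2 * pi) * (cheb (j + k) (ridge x t) * ang (int j - int k) t) \<partial>circ) \<in> borel_measurable borel"
    by (intro circ.borel_measurable_lebesgue_integral) (simp add: case_prod_beta')
  moreover have "(\<lambda>x. \<integral>t. nrm (j + k) / (2 * pi) * (cheb (j + k) (ridge x t) * ang (int j - int k) t) \<partial>circ) = basis j k"
    using has_bochner_integral_integral_eq[OF basis_eq_circ[of j k]] by auto
  ultimately show ?thesis by simp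
qed

lemma basis_bounded: "\<exists>B. \<forall>x. norm x \<le> 1 \<longrightarrow> \<bar>basis j k x\<bar> \<le> B"
proof (intro exI allI impI)
  fix x :: "real \<times> real" assume x: "norm x \<le> 1"
  let ?K = "real (Suc (j + k)) * 2"
  let ?p = "\<lambda>a. psi j k (ridge x a, a)"
  have pm: "?p \<in> borel_measurable borel"
    unfolding psi_def fst_conv snd_conv by measurable
  have B: "\<bar>?p a\<bar> \<le> ?K" for a
    using abs_ridge_le[of x a] x by (intro abs_psi_le) linarith
  have "\<bar>\<integral>a. ?p a \<partial>circ\<bar> \<le> (\<integral>a. \<bar>?p a\<bar> \<partial>circ)"
    by (rule integral_abs_bound)
  also have "\<dots> \<le> (\<integral>a. ?K \<partial>circ)"
    by (rule integral_mono)
      (use B pm in \<open>auto intro!: integrable_circ_bounded[of _ ?K] integrable_abs\<close>)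
  finally have "\<bar>2 * pi / nrm (j + k) * basis j k x\<bar> \<le> (\<integral>a. ?K \<partial>circ)"
    unfolding circ_psi_ridge .
  then show "\<bar>basis j k x\<bar> \<le> (\<integral>a. ?K \<partial>circ) * nrm (j + k) / (2 * pi)"
    using nrm_pos[of "j + k"] by (simp add: abs_mult field_simps)
qed

lemma basis_L2: "basis j k \<in> L2 disk"
proof -
  obtain B where B: "\<And>x. norm x \<le> 1 \<Longrightarrow> \<bar>basis j k x\<bar> \<le> B"
    using basis_bounded by blast
  show ?thesis
    by (rule L2_bounded[OF finite_measure_disk borel_measurable_disk[OF basis_measurable], of _ _ B])
      (use B in simp)
qed

text \<open>A basis function is a superposition of ridge functions \<open>cheb n\<close>, and the transform of a
  ridge function is explicit.\<close>

lemma radon_basis: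
  assumes u: "0 \<le> u" "u < 1"
  shows "radon (basis j k) (u, a) = psi j k (u, a) / nrm (j + k)"
proof -
  let ?n = "j + k" and ?m = "int j - int k"
  define s where "s = sqrt (1 - u\<^sup>2)"
  define c where "c = nrm ?n / (2 * pi)"
  have s: "s > 0" using u by (simp add: s_def abs_square_less_1)
  define H where "H = (\<lambda>t b. cheb ?n (u * cos (b - a) + t * sin (b - a)) * ang ?m b)"
  \<comment> \<open>Along the line with normal angle a, the ridge function of direction b depends
    only on the relative angle b - a.\<close>
  have r: "ridge (u * cos a - t * sin a, u * sin a + t * cos a) b = u * cos (b - a) + t * sin (b - a)" for t b
    by (simp add: ridge_def cos_diff sin_diff algebra_simps)
  have b: "basis j k (u * cos a - t * sin a, u * sin a + t * cos a) = c * (\<integral>b. H t b \<partial>circ)" for t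
    using has_bochner_integral_integral_eq[OF basis_eq_circ[of j k "(u * cos a - t * sin a, u * sin a + t * cos a)"]]
    unfolding r c_def H_def by simp
  have fs: "finite_measure (seg s)"
    by (rule finite_measureI) (use s in \<open>simp add: seg_def emeasure_restrict_space space_restrict_space\<close>)
  interpret seg: finite_measure "seg s" by (rule fs)
  interpret P: pair_sigma_finite "seg s" circ ..
  interpret PF: finite_measure "seg s \<Otimes>\<^sub>M circ"
    by (rule finite_measure_pair_measure[OF finite_measure_circ fs])
  have spseg: "space (seg s) = {-s..s}" by (simp add: seg_def space_restrict_space)
  have "(\<lambda>z. H (fst z) (snd z)) \<in> borel_measurable (borel \<Otimes>\<^sub>M borel)"
    unfolding H_def by measurable
  moreover have "(\<lambda>z. (fst z, snd z)) \<in> seg s \<Otimes>\<^sub>M circ \<rightarrow>\<^sub>M borel \<Otimes>\<^sub>M borel"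
  proof -
    have "(\<lambda>x. x) \<in> seg s \<rightarrow>\<^sub>M borel"
      unfolding seg_def by (rule measurable_restrict_space1) simp
    then show ?thesis
      using measurable_compose[OF measurable_snd circ_id] measurable_compose[OF measurable_fst]
      by (intro measurable_Pair) auto
  qed
  ultimately have Hm: "(\<lambda>z. H (fst z) (snd z)) \<in> borel_measurable (seg s \<Otimes>\<^sub>M circ)"
    using measurable_compose by force
  have HB: "\<bar>H t b\<bar> \<le> real (Suc ?n) * 2" if "\<bar>t\<bar> \<le> s" for t b
  proof -
    have "\<bar>u * cos (b - a) + t * sin (b - a)\<bar> \<le> 1"
      using that disk_section[of t u] by (intro line_norm_le) (simp add: s_def)
    then show ?thesis
      unfolding H_def abs_mult by (intro mult_mono abs_cheb_le abs_ang_le) auto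
  qed
  have Hi: "integrable (seg s \<Otimes>\<^sub>M circ) (case_prod H)"
    unfolding case_prod_beta'
    by (rule PF.integrable_const_bound[of _ "real (Suc ?n) * 2"])
      (use HB Hm in \<open>auto simp: space_pair_measure spseg intro!: AE_I2\<close>)
  have "radon (basis j k) (u, a) = pi / (2 * s) * (\<integral>t. c * (\<integral>b. H t b \<partial>circ) \<partial>seg s)"
    unfolding radon_def seg_integral by (simp add: b s_def)
  also have "\<dots> = pi / (2 * s) * (c * (\<integral>t. \<integral>b. H t b \<partial>circ \<partial>seg s))"
    by simp
  also have "(\<integral>t. \<integral>b. H t b \<partial>circ \<partial>seg s) = (\<integral>b. \<integral>t. H t b \<partial>seg s \<partial>circ)"
    by (rule P.Fubini_integral[OF Hi, symmetric])
  also have "\<dots> = (\<integral>b. 2 * s * cheb ?n u / real (Suc ?n) * (cheb ?n (cos (b - a)) * ang ?m b) \<partial>circ)"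
    unfolding H_def integral_mult_left_zero s_def cheb_line_integral[OF u] by (simp add: mult_ac)
  also have "\<dots> = 2 * s * cheb ?n u / real (Suc ?n) * (2 * pi * ang ?m a)"
    unfolding integral_mult_right_zero has_bochner_integral_integral_eq[OF circ_cheb_cos_ang] ..
  also have "pi / (2 * s) * (c * (2 * s * cheb ?n u / real (Suc ?n) * (2 * pi * ang ?m a)))
     = pi * nrm ?n / real (Suc ?n) * psi j k (u, a)"
    using s by (simp add: c_def psi_def)
  also have "pi * nrm ?n / real (Suc ?n) = 1 / nrm ?n"
    using nrm_sq[of ?n] nrm_pos[of ?n] by (simp add: field_simps power2_eq_square)
  finally show ?thesis by simp
qed

section \<open>Orthogonality and the operator \<open>Q\<close>\<close>

lemma l2_inner_lincomb:
  assumes "\<And>i. i \<in> S \<Longrightarrow> f i \<in> L2 M" "h \<in> L2 M"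
  shows "l2_inner M (\<lambda>x. \<Sum>i\<in>S. c i * f i x) h = (\<Sum>i\<in>S. c i * l2_inner M (f i) h)"
  using l2_inner_sum[of S "\<lambda>i x. c i * f i x" M h] assms
  by (simp add: L2_scale l2_inner_scale)

text \<open>Equal parity makes the integrand even, so the half interval carries half of the usual
  integral. After u = cos x the weighted product is a difference of two cosines of even frequency;
  their antiderivatives vanish at pi / 2 except for frequency 0.\<close>

lemma cheb_orthogonal:
  assumes "even (n + n')"
  shows "(\<integral>u. indicator {0..1} u * (cyl_weight u * (cheb n u * cheb n' u)) \<partial>lborel) = of_bool (n = n') / 2"
proof -
  define S where "S = (\<lambda>p (x::real). if p = 0 then x else sin (of_int p * x) / of_int p)"
  have S0: "S p 0 = 0" for p by (simp add: S_def)
  have Sh: "S p (pi / 2) = of_bool (p = 0) * (pi / 2)" if even: "even p" for p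
  proof -
    obtain q where q: "p = 2 * q" using even by (elim evenE)
    have "sin (of_int p * (pi / 2)) = sin (pi * of_int q)" by (simp add: q mult.commute)
    then show ?thesis by (simp add: S_def)
  qed
  have S': "(S p has_real_derivative cos (of_int p * x)) (at x)" for p x
    by (cases "p = 0") (auto simp: S_def intro!: derivative_eq_intros)
  have Sc: "continuous_on A f \<Longrightarrow> continuous_on A (\<lambda>x. S p (f x))" for A p and f :: "real \<Rightarrow> real"
    by (cases "p = 0") (auto simp: S_def intro!: continuous_intros)
  let ?d = "int n - int n'" and ?e = "int n + int n' + 2"
  \<comment> \<open>The antiderivative pulled back by arccos: u = 1 corresponds to angle 0 and u = 0
    to pi / 2. The minus sign compensates for arccos being decreasing.\<close>
  define F where "F = (\<lambda>u. - (S ?d (arccos u) - S ?e (arccos u)) / pi)"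
  let ?f = "\<lambda>u. cyl_weight u * (cheb n u * cheb n' u)"
  have "(?f has_integral F 1 - F 0) {0..1}"
  proof (rule fundamental_theorem_of_calculus_interior)
    show "continuous_on {0..1} F"
      unfolding F_def by (intro continuous_intros Sc) auto
    fix u :: real assume "u \<in> {0<..<1}"
    then have u: "- 1 < u" "u < 1" "0 < u" by auto
    define x where "x = arccos u"
    define w where "w = sqrt (1 - u\<^sup>2)"
    have w: "w > 0" using u by (simp add: w_def abs_square_less_1)
    have ux: "cos x = u" "sin x = w"
      using u by (simp_all add: x_def w_def cos_arccos sin_arccos)
    have "cos (of_int ?d * x) - cos (of_int ?e * x) = 2 * (sin (real (Suc n) * x) * sin (real (Suc n') * x))"
    proof -
      have "of_int ?d * x = real (Suc n) * x - real (Suc n') * x" "of_int ?e * x = real (Suc n) * x + real (Suc n') * x"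
        by (simp_all add: algebra_simps)
      then show ?thesis by (simp only: cos_add cos_diff)
    qed
    also have "\<dots> = 2 * (w * cheb n u * (w * cheb n' u))"
      by (simp only: sin_cheb[symmetric] ux)
    finally have c: "cos (of_int ?d * x) - cos (of_int ?e * x) = 2 * (w * cheb n u * (w * cheb n' u))" .
    have da: "(arccos has_real_derivative inverse (- w)) (at u)"
      unfolding w_def by (rule DERIV_arccos[OF u(1,2)])
    have "(F has_real_derivative - (cos (of_int ?d * x) * inverse (- w) - cos (of_int ?e * x) * inverse (- w)) / pi) (at u)"
      unfolding F_def x_def
      by (rule DERIV_cdivide[OF DERIV_minus[OF DERIV_diff[OF
            DERIV_chain2[OF S'[of ?d "arccos u"] da] DERIV_chain2[OF S'[of ?e "arccos u"] da]]]])
    moreover have "- (cos (of_int ?d * x) * inverse (- w) - cos (of_int ?e * x) * inverse (- w)) / pi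
       = (cos (of_int ?d * x) - cos (of_int ?e * x)) / (w * pi)"
      using w by (simp add: field_simps)
    moreover have "(cos (of_int ?d * x) - cos (of_int ?e * x)) / (w * pi) = ?f u"
      unfolding c using w by (simp add: cyl_weight_def flip: w_def)
    ultimately show "(F has_vector_derivative ?f u) (at u)"
      by (simp add: has_real_derivative_iff_has_vector_derivative)
  qed simp
  moreover have "set_integrable lborel {0..1} ?f"
    unfolding cyl_weight_def by (intro borel_integrable_atLeastAtMost' continuous_intros)
  ultimately have "set_lebesgue_integral lborel {0..1} ?f = F 1 - F 0"
    by (simp add: set_borel_integral_eq_integral integral_unique)
  also have "\<dots> = of_bool (n = n') / 2"
  proof -
    have "even ?d" "even ?e" "?e \<noteq> 0" using assms by auto
    then show ?thesis by (simp add: F_def S0 Sh)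
  qed
  finally show ?thesis by (simp add: set_lebesgue_integral_def)
qed

text \<open>The angular integral leaves only equal frequencies j - k = j' - k', and this forces the
  parity that orthogonality on the half interval asks for.\<close>

lemma psi_orthogonal:
  "l2_inner cyl (psi j k) (psi j' k') = pi * of_bool (j = j' \<and> k = k')"
proof -
  let ?n = "j + k" and ?m = "int j - int k" and ?n' = "j' + k'" and ?m' = "int j' - int k'"
  note [measurable] = psi_measurable
  have "l2_inner cyl (psi j k) (psi j' k')
     = (\<integral>a. \<integral>u. indicator {0..1} u * (cyl_weight u * (psi j k (u, a) * psi j' k' (u, a))) \<partial>lborel \<partial>circ)"
    unfolding l2_inner_def by (rule integral_cyl) (simp_all add: L2_mult psi_L2)
  also have "\<dots> = (\<integral>a. \<integral>u. (ang ?m a * ang ?m' a) * (indicator {0..1} u * (cyl_weight u * (cheb ?n u * cheb ?n' u))) \<partial>lborel \<partial>circ)"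
    by (simp add: psi_def mult_ac)
  also have "\<dots> = (\<integral>a. (ang ?m a * ang ?m' a) * (\<integral>u. indicator {0..1} u * (cyl_weight u * (cheb ?n u * cheb ?n' u)) \<partial>lborel) \<partial>circ)"
    by (simp only: integral_mult_right_zero)
  also have "\<dots> = 2 * pi * of_bool (?m = ?m') * (\<integral>u. indicator {0..1} u * (cyl_weight u * (cheb ?n u * cheb ?n' u)) \<partial>lborel)"
    by (simp only: integral_mult_left_zero has_bochner_integral_integral_eq[OF circ_ang_ang])
  also have "\<dots> = pi * of_bool (j = j' \<and> k = k')"
  proof (cases "?m = ?m'")
    case True
    then have "even (?n + ?n')" by presburger
    moreover have "?n = ?n' \<longleftrightarrow> j = j' \<and> k = k'" using True by auto
    ultimately show ?thesis using True by (simp add: cheb_orthogonal)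
  next
    case False
    then show ?thesis by auto
  qed
  finally show ?thesis .
qed

text \<open>The density vanishes at u = 1, so the edge where the transform is given by a division by
  zero is a null set.\<close>

lemma AE_cyl: "AE z in cyl. 0 \<le> fst z \<and> fst z < 1"
proof -
  have "(\<lambda>z. ennreal (cyl_weight (fst z))) \<in> borel_measurable (restrict_space lborel ({0..1} \<times> {0..<2 * pi}))"
    by (intro measurable_restrict_space1) simp
  then show ?thesis
    unfolding cyl_eq
    by (subst AE_density) (auto intro!: AE_I2 simp: space_restrict_space cyl_weight_def less_le)
qed

lemma radon_basis_AE: "AE z in cyl. radon (basis j k) z = psi j k z / nrm (j + k)"
  using AE_cyl by eventually_elim (metis prod.collapse radon_basis)

lemma l2_inner_radon_basis:
  assumes g: "g \<in> L2 cyl"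
  shows "l2_inner cyl (radon (basis j k)) g = l2_inner cyl (psi j k) g / nrm (j + k)"
proof -
  have "l2_inner cyl (radon (basis j k)) g = l2_inner cyl (\<lambda>z. 1 / nrm (j + k) * psi j k z) g"
  proof (rule l2_inner_AE_cong[OF radon_L2[OF basis_L2] g L2_scale[OF psi_L2]])
    show "AE z in cyl. radon (basis j k) z = 1 / nrm (j + k) * psi j k z"
      using radon_basis_AE[of j k] by eventually_elim simp
  qed
  also have "\<dots> = 1 / nrm (j + k) * l2_inner cyl (psi j k) g"
    by (rule l2_inner_scale)
  finally show ?thesis by simp
qed

text \<open>The pairing of the transform of a basis function with \<open>psi\<close> is evaluated
  twice: by the adjoint, and by the explicit transform together with orthogonality on the
  cylinder.\<close>

lemma basis_orthonormal:
  "l2_inner disk (basis j k) (basis j' k') = of_bool (j = j' \<and> k = k')"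
proof -
  have "pi / nrm (j' + k') * l2_inner disk (basis j k) (basis j' k') = l2_inner cyl (radon (basis j k)) (psi j' k')"
    by (rule radon_adjoint[OF basis_L2, symmetric])
  also have "\<dots> = l2_inner cyl (psi j k) (psi j' k') / nrm (j + k)"
    by (rule l2_inner_radon_basis[OF psi_L2])
  also have "\<dots> = pi / nrm (j' + k') * of_bool (j = j' \<and> k = k')"
    unfolding psi_orthogonal by (cases "j = j' \<and> k = k'") auto
  finally have "pi / nrm (j' + k') * l2_inner disk (basis j k) (basis j' k') = pi / nrm (j' + k') * of_bool (j = j' \<and> k = k')" .
  moreover have "pi / nrm (j' + k') \<noteq> 0" using nrm_pos[of "j' + k'"] by simp
  ultimately show ?thesis by (simp only: mult_cancel_left) blast
qed

section \<open>Finite expansions and the action of \<open>radon_Q\<close> on them\<close>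

definition expansion :: "(nat \<times> nat) set \<Rightarrow> (nat \<Rightarrow> nat \<Rightarrow> real) \<Rightarrow> real \<times> real \<Rightarrow> real" where
  "expansion S \<theta> x = (\<Sum>(j, k)\<in>S. \<theta> j k * basis j k x)"

lemma expansion_L2: "expansion S \<theta> \<in> L2 disk"
  unfolding expansion_def case_prod_beta' by (intro L2_sum L2_scale basis_L2)

lemma l2_inner_expansion: "f \<in> L2 disk \<Longrightarrow> l2_inner disk (expansion S \<theta>) f = (\<Sum>(j, k)\<in>S. \<theta> j k * l2_inner disk (basis j k) f)"
  unfolding expansion_def case_prod_beta' by (rule l2_inner_lincomb) (auto intro: basis_L2)

lemma l2_inner_expansion_basis:
  assumes "finite S"
  shows "l2_inner disk (expansion S \<theta>) (basis j k) = (if (j, k) \<in> S then \<theta> j k else 0)"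
proof -
  have "l2_inner disk (expansion S \<theta>) (basis j k) = (\<Sum>p\<in>S. if p = (j, k) then \<theta> j k else 0)"
    unfolding l2_inner_expansion[OF basis_L2] basis_orthonormal
    by (rule sum.cong) auto
  then show ?thesis using assms by simp
qed

lemma expansion_norm_sq:
  assumes "finite S"
  shows "(l2_norm disk (expansion S \<theta>))\<^sup>2 = (\<Sum>(j, k)\<in>S. (\<theta> j k)\<^sup>2)"
proof -
  have "(l2_norm disk (expansion S \<theta>))\<^sup>2 = (\<Sum>(j, k)\<in>S. \<theta> j k * l2_inner disk (basis j k) (expansion S \<theta>))"
    unfolding l2_norm_sq l2_inner_expansion[OF expansion_L2] ..
  also have "\<dots> = (\<Sum>(j, k)\<in>S. (\<theta> j k)\<^sup>2)"
    by (rule sum.cong) (auto simp: l2_inner_commute[of _ "basis _ _"] l2_inner_expansion_basis assms power2_eq_square)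
  finally show ?thesis .
qed

lemma expansion_diff: "expansion S \<theta> x - expansion S \<theta>' x = expansion S (\<lambda>j k. \<theta> j k - \<theta>' j k) x"
  by (simp add: expansion_def case_prod_beta' left_diff_distrib sum_subtractf)

text \<open>The candidate for the image under Q. Pairing the transform of f with
  \<open>psi j k\<close> gives pi / \<open>nrm (j + k)\<close> times the coefficient of f, so the
  reciprocal factor reproduces the coefficient.\<close>

definition q_expansion :: "(nat \<times> nat) set \<Rightarrow> (nat \<Rightarrow> nat \<Rightarrow> real) \<Rightarrow> real \<times> real \<Rightarrow> real" where
  "q_expansion S \<theta> z = (\<Sum>(j, k)\<in>S. \<theta> j k * (nrm (j + k) / pi) * psi j k z)"

lemma q_expansion_L2: "q_expansion S \<theta> \<in> L2 cyl"
  unfolding q_expansion_def case_prod_beta' by (intro L2_sum L2_scale psi_L2)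

lemma q_expansion_diff: "q_expansion S \<theta> x - q_expansion S \<theta>' x = q_expansion S (\<lambda>j k. \<theta> j k - \<theta>' j k) x"
  by (simp only: q_expansion_def case_prod_beta' left_diff_distrib sum_subtractf)

lemma l2_inner_q_expansion: "f \<in> L2 cyl \<Longrightarrow>
    l2_inner cyl (q_expansion S \<theta>) f = (\<Sum>(j, k)\<in>S. \<theta> j k * (nrm (j + k) / pi) * l2_inner cyl (psi j k) f)"
  unfolding q_expansion_def case_prod_beta' by (rule l2_inner_lincomb) (auto intro: psi_L2)

text \<open>The weight (j + k + 1) / pi^2 is the inverse square of the singular value; its linear
  growth in the degree is the ill-posedness of the problem.\<close>

lemma q_expansion_norm_sq:
  assumes "finite S"
  shows "(l2_norm cyl (q_expansion S \<theta>))\<^sup>2 = (\<Sum>(j, k)\<in>S. (\<theta> j k)\<^sup>2 * (real (Suc (j + k)) / pi\<^sup>2))"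
proof -
  have p: "l2_inner cyl (psi j k) (q_expansion S \<theta>) = \<theta> j k * nrm (j + k)" if "(j, k) \<in> S" for j k
  proof -
    have "l2_inner cyl (q_expansion S \<theta>) (psi j k) = (\<Sum>p\<in>S. if p = (j, k) then \<theta> j k * nrm (j + k) else 0)"
      unfolding l2_inner_q_expansion[OF psi_L2] psi_orthogonal by (rule sum.cong) auto
    then show ?thesis using assms that by (simp add: l2_inner_commute)
  qed
  have "(l2_norm cyl (q_expansion S \<theta>))\<^sup>2 = (\<Sum>(j, k)\<in>S. \<theta> j k * (nrm (j + k) / pi) * l2_inner cyl (psi j k) (q_expansion S \<theta>))"
    unfolding l2_norm_sq l2_inner_q_expansion[OF q_expansion_L2] ..
  also have "\<dots> = (\<Sum>(j, k)\<in>S. (\<theta> j k)\<^sup>2 * ((nrm (j + k))\<^sup>2 / pi))"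
    by (rule sum.cong) (auto simp: p power2_eq_square)
  also have "\<dots> = (\<Sum>(j, k)\<in>S. (\<theta> j k)\<^sup>2 * (real (Suc (j + k)) / pi\<^sup>2))"
    unfolding nrm_sq by (simp add: power2_eq_square)
  finally show ?thesis .
qed

lemma q_expansion_adjoint:
  assumes f: "f \<in> L2 disk"
  shows "l2_inner disk f (expansion S \<theta>) = l2_inner cyl (radon f) (q_expansion S \<theta>)"
proof -
  have "l2_inner cyl (radon f) (q_expansion S \<theta>) = (\<Sum>(j, k)\<in>S. \<theta> j k * (nrm (j + k) / pi) * l2_inner cyl (radon f) (psi j k))"
    unfolding l2_inner_commute[of _ "radon f"] by (rule l2_inner_q_expansion[OF radon_L2[OF f]])
  also have "\<dots> = (\<Sum>(j, k)\<in>S. \<theta> j k * l2_inner disk (basis j k) f)"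
  proof (rule sum.cong[OF refl], clarify)
    fix j k
    show "\<theta> j k * (nrm (j + k) / pi) * l2_inner cyl (radon f) (psi j k) = \<theta> j k * l2_inner disk (basis j k) f"
      unfolding radon_adjoint[OF f] l2_inner_commute[of disk f] using nrm_pos[of "j + k"] by simp
  qed
  also have "\<dots> = l2_inner disk f (expansion S \<theta>)"
    unfolding l2_inner_commute[of disk f] by (rule l2_inner_expansion[OF f, symmetric])
  finally show ?thesis ..
qed

text \<open>Linearity on an individual line requires each term to be integrable along that line;
  boundedness of the basis functions on the disk supplies this.\<close>

lemma radon_expansion:
  assumes u: "0 \<le> u" "u < 1"
  shows "radon (expansion S \<theta>) (u, a) = (\<Sum>(j, k)\<in>S. \<theta> j k * radon (basis j k) (u, a))"
proof -
  have m: "(\<lambda>t. dext (basis j k) (rot a (u, t))) \<in> borel_measurable borel" for j k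
  proof -
    have "(\<lambda>t. rot a (u, t)) \<in> borel \<rightarrow>\<^sub>M borel"
      unfolding rot_def fst_conv snd_conv borel_prod[symmetric] by measurable
    then show ?thesis
      by (rule measurable_compose[OF _ dext_measurable[OF borel_measurable_disk[OF basis_measurable]]])
  qed
  have i: "integrable lborel (\<lambda>t. dext (basis j k) (rot a (u, t)))" for j k
  proof -
    obtain B where B: "\<And>x. norm x \<le> 1 \<Longrightarrow> \<bar>basis j k x\<bar> \<le> B"
      using basis_bounded by blast
    show ?thesis
    proof (rule Bochner_Integration.integrable_bound)
      show "integrable lborel (\<lambda>t. B * indicator {-1..1::real} t)"
        by (intro integrable_mult_right integrable_real_indicator) simp_all
      have le: "\<bar>t\<bar> \<le> 1" if "norm (rot a (u, t)) \<le> 1" for t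
      proof -
        have "t\<^sup>2 \<le> 1" using that zero_le_power2[of u] unfolding norm_rot_pair by linarith
        then show ?thesis by (simp add: abs_square_le_1)
      qed
      show "AE t in lborel. norm (dext (basis j k) (rot a (u, t))) \<le> norm (B * indicator {-1..1} t)"
      proof (rule AE_I2)
        fix t
        show "norm (dext (basis j k) (rot a (u, t))) \<le> norm (B * indicator {-1..1} t)"
        proof (cases "norm (rot a (u, t)) \<le> 1")
          case True
          then have "t \<in> {-1..1}" using le[of t] by auto
          then show ?thesis using B[OF True] True by (simp add: dext_def)
        qed (simp add: dext_def)
      qed
    qed (use m in simp)
  qed
  have d: "dext (expansion S \<theta>) x = (\<Sum>(j, k)\<in>S. \<theta> j k * dext (basis j k) x)" for x
    by (simp add: dext_def expansion_def sum_distrib_left case_prod_beta' mult.left_commute)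
  have "(\<integral>t. dext (expansion S \<theta>) (rot a (u, t)) \<partial>lborel) = (\<Sum>(j, k)\<in>S. \<theta> j k * (\<integral>t. dext (basis j k) (rot a (u, t)) \<partial>lborel))"
    unfolding d case_prod_beta' by (subst Bochner_Integration.integral_sum) (simp_all add: i)
  then show ?thesis
    by (simp add: radon_eq_dext sum_distrib_left case_prod_beta' mult.left_commute)
qed

lemma q_expansion_in_closure: "q_expansion S \<theta> \<in> l2_closure cyl (radon ` L2 disk)"
proof -
  \<comment> \<open>Coefficients divided by squared singular values. The candidate thus lies in the
    range itself up to a null set, and membership in the closure follows.\<close>
  define \<theta>' where "\<theta>' = (\<lambda>j k. \<theta> j k * ((nrm (j + k))\<^sup>2 / pi))"
  have "AE z in cyl. radon (expansion S \<theta>') z = q_expansion S \<theta> z"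
    using AE_cyl
  proof eventually_elim
    fix z :: "real \<times> real" assume z: "0 \<le> fst z \<and> fst z < 1"
    obtain u a where ua: "z = (u, a)" by (cases z)
    have u: "0 \<le> u" "u < 1" using z ua by auto
    show "radon (expansion S \<theta>') z = q_expansion S \<theta> z"
      unfolding ua radon_expansion[OF u] radon_basis[OF u] q_expansion_def
    proof (rule sum.cong[OF refl], clarify)
      fix j k
      show "\<theta>' j k * (psi j k (u, a) / nrm (j + k)) = \<theta> j k * (nrm (j + k) / pi) * psi j k (u, a)"
        using nrm_pos[of "j + k"] by (simp add: \<theta>'_def power2_eq_square)
    qed
  qed
  then have ae: "AE z in cyl. (q_expansion S \<theta> z - radon (expansion S \<theta>') z)\<^sup>2 = 0"
    by eventually_elim simp
  have "(\<integral>z. (q_expansion S \<theta> z - radon (expansion S \<theta>') z)\<^sup>2 \<partial>cyl) = 0"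
    by (rule integral_eq_zero_AE[OF ae])
  then have "l2_dist cyl (q_expansion S \<theta>) (radon (expansion S \<theta>')) = 0"
    by (simp add: l2_dist_def l2_norm_def)
  then show ?thesis
    unfolding l2_closure_def
    using q_expansion_L2[of S \<theta>] imageI[OF expansion_L2[of S \<theta>'], of radon] by force
qed

text \<open>Both functions lie in the closure of the range and have the same inner products with the
  range, so their difference is orthogonal to itself.\<close>

lemma radon_Q_expansion:
  fixes S :: "(nat \<times> nat) set" and \<theta> :: "nat \<Rightarrow> nat \<Rightarrow> real"
  defines "h \<equiv> radon_Q (expansion S \<theta>)"
  shows "h \<in> L2 cyl" "\<And>f. f \<in> L2 disk \<Longrightarrow> l2_inner disk f (expansion S \<theta>) = l2_inner cyl (radon f) h"
    "AE z in cyl. h z = q_expansion S \<theta> z"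
proof -
  \<comment> \<open>The candidate shows that the choice in \<open>radon_Q\<close> is made from a
    nonempty set.\<close>
  have h: "h \<in> l2_closure cyl (radon ` L2 disk) \<and>
     (\<forall>f\<in>L2 disk. l2_inner disk f (expansion S \<theta>) = l2_inner cyl (radon f) h)"
    unfolding h_def radon_Q_def
    by (rule someI[of _ "q_expansion S \<theta>"]) (simp add: q_expansion_in_closure q_expansion_adjoint)
  show hL: "h \<in> L2 cyl" using h by (auto simp: l2_closure_def)
  show i: "l2_inner disk f (expansion S \<theta>) = l2_inner cyl (radon f) h" if "f \<in> L2 disk" for f
    using h that by blast
  define D where "D = (\<lambda>z. h z - q_expansion S \<theta> z)"
  have DL: "D \<in> L2 cyl" unfolding D_def by (rule L2_diff[OF hL q_expansion_L2])
  have o: "l2_inner cyl (radon f) D = 0" if f: "f \<in> L2 disk" for f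
    unfolding D_def l2_inner_diff_right[OF hL q_expansion_L2 radon_L2[OF f]]
    using i[OF f] q_expansion_adjoint[OF f, of S \<theta>] by simp
  have z: "l2_inner cyl g D = 0" if g: "g \<in> l2_closure cyl (radon ` L2 disk)" for g
  proof (rule ccontr)
    assume n: "l2_inner cyl g D \<noteq> 0"
    have gL: "g \<in> L2 cyl" using g by (auto simp: l2_closure_def)
    \<comment> \<open>Small enough that replacing g by an element of the range changes the pairing
      with \<open>D\<close> by less than its supposed value; the summand 1 covers \<open>D\<close>
      of norm 0.\<close>
    define e where "e = \<bar>l2_inner cyl g D\<bar> / (l2_norm cyl D + 1)"
    have p: "l2_norm cyl D + 1 > 0" using l2_norm_nonneg[of cyl D] by linarith
    have "e > 0" using n p by (simp add: e_def)
    then obtain f where f: "f \<in> L2 disk" "l2_dist cyl g (radon f) < e"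
      using g by (auto simp: l2_closure_def)
    have "l2_inner cyl g D = l2_inner cyl (\<lambda>z. g z - radon f z) D"
      using l2_inner_diff[OF gL radon_L2[OF f(1)] DL] o[OF f(1)] by simp
    then have "\<bar>l2_inner cyl g D\<bar> \<le> l2_dist cyl g (radon f) * l2_norm cyl D"
      unfolding l2_dist_def using l2_inner_le[OF L2_diff[OF gL radon_L2[OF f(1)]] DL] by simp
    also have "\<dots> \<le> e * l2_norm cyl D"
      using f(2) by (intro mult_right_mono) auto
    also have "\<dots> < e * (l2_norm cyl D + 1)"
      using \<open>e > 0\<close> by simp
    also have "\<dots> = \<bar>l2_inner cyl g D\<bar>"
      using p by (simp add: e_def)
    finally show False by simp
  qed
  have "(l2_norm cyl D)\<^sup>2 = l2_inner cyl h D - l2_inner cyl (q_expansion S \<theta>) D"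
    unfolding l2_norm_sq by (subst (1) D_def) (rule l2_inner_diff[OF hL q_expansion_L2 DL])
  also have "\<dots> = 0" using z[OF conjunct1[OF h]] z[OF q_expansion_in_closure[of S \<theta>]] by simp
  finally show "AE z in cyl. h z = q_expansion S \<theta> z"
    by (intro AE_eq_of_l2_dist_0[OF hL q_expansion_L2]) (simp add: D_def)
qed

section \<open>Gaussian variables and joint laws\<close>

abbreviation "std_normal \<equiv> std_normal_distribution"

lemma prob_space_std_normal: "prob_space std_normal"
  by (rule prob_space_normal_density) simp

lemma centered_normal_nonneg: "centered_normal P X v \<Longrightarrow> v \<ge> 0"
  by (auto simp: centered_normal_def split: if_splits)

text \<open>Treats the point mass and the nondegenerate case together: the law is that of sqrt v
  times a standard normal variable. All moments below are computed from this form.\<close>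

lemma centered_normal_distr:
  assumes "prob_space P" and X: "centered_normal P X v"
  shows "distr P borel X = distr std_normal borel (\<lambda>z. sqrt v * z)"
proof (cases "v = 0")
  case True
  interpret prob_space P by fact
  interpret G: prob_space std_normal by (rule prob_space_std_normal)
  have "AE w in P. X w = 0" "X \<in> borel_measurable P"
    using X True by (simp_all add: centered_normal_def)
  then have "distr P borel X = distr P borel (\<lambda>w. 0)"
    by (intro distr_cong_AE) auto
  then show ?thesis
    using True by (simp add: distr_const G.distr_const)
next
  case False
  interpret prob_space P by fact
  have v: "v > 0" and d: "distributed P lborel X (\<lambda>x. ennreal (normal_density 0 (sqrt v) x))"
    and m [measurable]: "X \<in> borel_measurable P"
    using X False by (auto simp: centered_normal_def split: if_splits)
  have "distributed P lborel (\<lambda>w. (X w - 0) / sqrt v) std_normal_density"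
    using d v by (subst (asm) normal_standard_normal_convert) simp_all
  then have e: "distr P lborel (\<lambda>w. X w / sqrt v) = std_normal"
    by (simp add: distributed_distr_eq_density)
  have "distr std_normal borel (\<lambda>z. sqrt v * z) = distr (distr P lborel (\<lambda>w. X w / sqrt v)) borel (\<lambda>z. sqrt v * z)"
    unfolding e ..
  also have "\<dots> = distr P borel ((\<lambda>z. sqrt v * z) \<circ> (\<lambda>w. X w / sqrt v))"
    by (rule distr_distr) simp_all
  also have "(\<lambda>z. sqrt v * z) \<circ> (\<lambda>w. X w / sqrt v) = X"
    using v by (auto simp: fun_eq_iff)
  finally show ?thesis by simp
qed

lemma centered_normal_integral:
  fixes g :: "real \<Rightarrow> real"
  assumes "prob_space P" "centered_normal P X v" and g [measurable]: "g \<in> borel_measurable borel"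
  shows "(\<integral>w. g (X w) \<partial>P) = (\<integral>z. g (sqrt v * z) \<partial>std_normal)"
    and "(\<integral>\<^sup>+w. ennreal (g (X w)) \<partial>P) = (\<integral>\<^sup>+z. ennreal (g (sqrt v * z)) \<partial>std_normal)"
    and "integrable P (\<lambda>w. g (X w)) \<longleftrightarrow> integrable std_normal (\<lambda>z. g (sqrt v * z))"
proof -
  have m [measurable]: "X \<in> borel_measurable P" using assms(2) by (simp add: centered_normal_def)
  have m2 [measurable]: "(\<lambda>z. sqrt v * z) \<in> borel_measurable std_normal" by simp
  note d = centered_normal_distr[OF assms(1,2)]
  show "(\<integral>w. g (X w) \<partial>P) = (\<integral>z. g (sqrt v * z) \<partial>std_normal)"
    using integral_distr[OF m g] integral_distr[OF m2 g] d by simp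
  show "(\<integral>\<^sup>+w. ennreal (g (X w)) \<partial>P) = (\<integral>\<^sup>+z. ennreal (g (sqrt v * z)) \<partial>std_normal)"
    using nn_integral_distr[OF m, of "\<lambda>x. ennreal (g x)"] nn_integral_distr[OF m2, of "\<lambda>x. ennreal (g x)"] d by simp
  show "integrable P (\<lambda>w. g (X w)) \<longleftrightarrow> integrable std_normal (\<lambda>z. g (sqrt v * z))"
    using integrable_distr_eq[OF m g] integrable_distr_eq[OF m2 g] d by simp
qed

lemma std_normal_cos_sin:
  "(\<integral>z. cos (t * z) \<partial>std_normal) = exp (- (t\<^sup>2) / 2)" "(\<integral>z. sin (t * z) \<partial>std_normal) = 0"
proof -
  interpret prob_space std_normal by (rule prob_space_std_normal)
  have i: "complex_integrable std_normal (\<lambda>z. iexp (t * z))"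
    by (rule integrable_iexp) simp_all
  have c: "(\<integral>z. iexp (t * z) \<partial>std_normal) = complex_of_real (exp (- (t\<^sup>2) / 2))"
    using char_std_normal_distribution by (simp add: char_def fun_eq_iff)
  have "(\<integral>z. cos (t * z) \<partial>std_normal) = (\<integral>z. Re (iexp (t * z)) \<partial>std_normal)"
    by (simp add: Re_exp)
  also have "\<dots> = Re (\<integral>z. iexp (t * z) \<partial>std_normal)"
    by (rule integral_Re[OF i])
  finally show "(\<integral>z. cos (t * z) \<partial>std_normal) = exp (- (t\<^sup>2) / 2)"
    unfolding c by simp
  have "(\<integral>z. sin (t * z) \<partial>std_normal) = (\<integral>z. Im (iexp (t * z)) \<partial>std_normal)"
    by (simp add: Im_exp)
  also have "\<dots> = Im (\<integral>z. iexp (t * z) \<partial>std_normal)"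
    by (rule integral_Im[OF i])
  finally show "(\<integral>z. sin (t * z) \<partial>std_normal) = 0"
    unfolding c by simp
qed

lemma std_normal_cos_shift: "(\<integral>z. cos (t * z + p) \<partial>std_normal) = exp (- (t\<^sup>2) / 2) * cos p"
proof -
  interpret prob_space std_normal by (rule prob_space_std_normal)
  have i: "integrable std_normal (\<lambda>z. cos (t * z))" "integrable std_normal (\<lambda>z. sin (t * z))"
    by (auto intro!: integrable_const_bound[of _ 1] AE_I2)
  have "(\<integral>z. cos (t * z + p) \<partial>std_normal) = (\<integral>z. cos (t * z) * cos p - sin (t * z) * sin p \<partial>std_normal)"
    by (simp add: cos_add)
  also have "\<dots> = (\<integral>z. cos (t * z) * cos p \<partial>std_normal) - (\<integral>z. sin (t * z) * sin p \<partial>std_normal)"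
    by (rule Bochner_Integration.integral_diff) (intro integrable_mult_left i)+
  also have "\<dots> = exp (- (t\<^sup>2) / 2) * cos p"
    by (simp only: integral_mult_left_zero std_normal_cos_sin mult_zero_left diff_zero)
  finally show ?thesis .
qed

text \<open>A real substitute for the characteristic function: letting the phase p vary gives both
  its real and its imaginary part.\<close>

lemma centered_normal_cos:
  assumes "prob_space P" "centered_normal P X v"
  shows "(\<integral>w. cos (X w + p) \<partial>P) = exp (- v / 2) * cos p"
  using centered_normal_integral(1)[OF assms, of "\<lambda>x. cos (x + p)"] centered_normal_nonneg[OF assms(2)]
  by (simp add: std_normal_cos_shift)

lemma centered_normal_square:
  assumes "prob_space P" "centered_normal P X v"
  shows "(\<integral>w. (X w)\<^sup>2 \<partial>P) = v" "integrable P (\<lambda>w. (X w)\<^sup>2)"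
proof -
  have v: "v \<ge> 0" by (rule centered_normal_nonneg[OF assms(2)])
  have i: "integrable std_normal (\<lambda>z. z\<^sup>2)" by (rule integrable_std_normal_distribution_moment)
  have "(\<integral>z. z\<^sup>2 \<partial>std_normal) = 1"
    using std_normal_distribution_even_moments(1)[of 1] by (simp add: fact_numeral)
  then show "(\<integral>w. (X w)\<^sup>2 \<partial>P) = v"
    using centered_normal_integral(1)[OF assms, of "\<lambda>x. x\<^sup>2"] v by (simp add: power_mult_distrib)
  show "integrable P (\<lambda>w. (X w)\<^sup>2)"
    using centered_normal_integral(3)[OF assms, of "\<lambda>x. x\<^sup>2"] v i by (simp add: power_mult_distrib)
qed

text \<open>The exponent 1/4 is below the critical 1/2. For v = 1 the integrand times the density is
  sqrt 2 times the normal density of variance 2, and smaller variances only decrease the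
  integrand.\<close>

lemma centered_normal_exp_square:
  assumes "prob_space P" "centered_normal P X v" "v \<le> 1"
  shows "(\<integral>\<^sup>+w. ennreal (exp ((X w)\<^sup>2 / 4)) \<partial>P) \<le> ennreal (sqrt 2)"
proof -
  have v: "v \<ge> 0" by (rule centered_normal_nonneg[OF assms(2)])
  have "(\<integral>\<^sup>+w. ennreal (exp ((X w)\<^sup>2 / 4)) \<partial>P) = (\<integral>\<^sup>+z. ennreal (exp ((sqrt v * z)\<^sup>2 / 4)) \<partial>std_normal)"
    by (rule centered_normal_integral(2)[OF assms(1,2)]) simp
  also have "\<dots> \<le> (\<integral>\<^sup>+z. ennreal (exp (z\<^sup>2 / 4)) \<partial>std_normal)"
  proof (intro nn_integral_mono ennreal_leI)
    fix z :: real
    have "v * z\<^sup>2 \<le> 1 * z\<^sup>2" by (rule mult_right_mono[OF assms(3)]) simp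
    then show "exp ((sqrt v * z)\<^sup>2 / 4) \<le> exp (z\<^sup>2 / 4)"
      using v by (simp add: power_mult_distrib)
  qed
  also have "\<dots> = (\<integral>\<^sup>+z. ennreal (std_normal_density z) * ennreal (exp (z\<^sup>2 / 4)) \<partial>lborel)"
    by (rule nn_integral_density) auto
  also have "\<dots> = (\<integral>\<^sup>+z. ennreal (sqrt 2) * ennreal (normal_density 0 (sqrt 2) z) \<partial>lborel)"
  proof (rule nn_integral_cong)
    fix z :: real
    have "std_normal_density z * exp (z\<^sup>2 / 4) = 1 / sqrt (2 * pi) * (exp (- z\<^sup>2 / 2) * exp (z\<^sup>2 / 4))"
      by (simp add: std_normal_density_def)
    also have "exp (- z\<^sup>2 / 2) * exp (z\<^sup>2 / 4) = exp (- z\<^sup>2 / 4)"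
      by (simp flip: exp_add)
    also have "1 / sqrt (2 * pi) * exp (- z\<^sup>2 / 4) = sqrt 2 * normal_density 0 (sqrt 2) z"
      by (simp add: normal_density_def real_sqrt_mult field_simps)
    finally show "ennreal (std_normal_density z) * ennreal (exp (z\<^sup>2 / 4)) = ennreal (sqrt 2) * ennreal (normal_density 0 (sqrt 2) z)"
      by (simp flip: ennreal_mult)
  qed
  also have "\<dots> = ennreal (sqrt 2) * (\<integral>\<^sup>+z. ennreal (normal_density 0 (sqrt 2) z) \<partial>lborel)"
    by (rule nn_integral_cmult) simp
  also have "(\<integral>\<^sup>+z. ennreal (normal_density 0 (sqrt 2) z) \<partial>lborel) = 1"
    by (subst nn_integral_eq_integral) simp_all
  finally show ?thesis by simp
qed

text \<open>A weight in [1, 3], divided by its integral, is a probability density, so uniqueness of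
  characteristic functions applies to the reweighted laws. The hypothesis at t = p = 0 shows that
  the normalising constants agree, and the phase - pi / 2 turns the cosine into the sine.\<close>

lemma weighted_law_pos:
  assumes "prob_space P1" "prob_space P2"
    and X [measurable]: "X \<in> borel_measurable P1" and Y [measurable]: "Y \<in> borel_measurable P2"
    and v1 [measurable]: "v1 \<in> borel_measurable P1" and v2 [measurable]: "v2 \<in> borel_measurable P2"
    and b1: "\<And>w. 1 \<le> v1 w \<and> v1 w \<le> (3::real)" and b2: "\<And>w. 1 \<le> v2 w \<and> v2 w \<le> (3::real)"
    and c: "\<And>t p. (\<integral>w. v1 w * cos (t * X w + p) \<partial>P1) = (\<integral>w. v2 w * cos (t * Y w + p) \<partial>P2)"
    and B [measurable]: "B \<in> sets borel"
  shows "(\<integral>w. v1 w * indicator B (X w) \<partial>P1) = (\<integral>w. v2 w * indicator B (Y w) \<partial>P2)"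
proof -
  define c0 where "c0 = (\<integral>w. v1 w \<partial>P1)"
  have c02: "(\<integral>w. v2 w \<partial>P2) = c0" using c[of 0 0] by (simp add: c0_def)
  \<comment> \<open>Stated for a generic space and used once for each side, since the two sample
    spaces may have different types.\<close>
  have gen: "c0' \<ge> 1 \<Longrightarrow> real_distribution (distr (density P (\<lambda>w. ennreal (v w / c0'))) borel Z) \<and>
      (\<forall>t. char (distr (density P (\<lambda>w. ennreal (v w / c0'))) borel Z) t
         = Complex ((\<integral>w. v w * cos (t * Z w + 0) \<partial>P) / c0') ((\<integral>w. v w * cos (t * Z w + (- (pi / 2))) \<partial>P) / c0')) \<and>
      measure (distr (density P (\<lambda>w. ennreal (v w / c0'))) borel Z) B = (\<integral>w. v w * indicator B (Z w) \<partial>P) / c0'"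
    and one: "c0' \<ge> 1"
    if P: "prob_space P" and Z [measurable]: "Z \<in> borel_measurable P" and v [measurable]: "v \<in> borel_measurable P"
      and b: "\<And>w. 1 \<le> v w \<and> v w \<le> (3::real)" and c0': "(\<integral>w. v w \<partial>P) = c0'"
    for P :: "'z measure" and Z v c0'
  proof -
    interpret P: prob_space P by (rule P)
    have bd: "integrable P f" if "f \<in> borel_measurable P" "\<And>w. norm (f w) \<le> 3" for f :: "'z \<Rightarrow> 'x :: {banach, second_countable_topology}"
      by (rule P.integrable_const_bound[of _ 3]) (use that in auto)
    have vi: "integrable P v"
    proof (rule bd)
      show "norm (v w) \<le> 3" for w using b[of w] by simp
    qed simp
    have "(\<integral>w. 1 \<partial>P) \<le> (\<integral>w. v w \<partial>P)"
      by (rule integral_mono) (use b vi in auto)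
    then show one: "c0' \<ge> 1" using c0' by (simp add: P.prob_space)
    have v0: "0 \<le> v w" for w using b[of w] by linarith
    have nn: "AE w in P. 0 \<le> v w / c0'"
      using v0 one by (auto intro!: AE_I2)
    let ?D = "density P (\<lambda>w. ennreal (v w / c0'))"
    let ?M = "distr ?D borel Z"
    have "emeasure ?D (space ?D) = (\<integral>\<^sup>+w. ennreal (v w / c0') \<partial>P)"
      by (subst emeasure_density) (auto intro!: nn_integral_cong)
    also have "\<dots> = ennreal (\<integral>w. v w / c0' \<partial>P)"
      using vi nn by (intro nn_integral_eq_integral) auto
    also have "\<dots> = 1" using c0' one by simp
    finally interpret D: prob_space ?D by (rule prob_spaceI)
    have rd: "real_distribution ?M" by (rule D.real_distribution_distr) simp
    have 1: "\<forall>t. char ?M t = Complex ((\<integral>w. v w * cos (t * Z w + 0) \<partial>P) / c0') ((\<integral>w. v w * cos (t * Z w + (- (pi / 2))) \<partial>P) / c0')"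
    proof
      fix t
      have m: "(\<lambda>w. iexp (t * Z w)) \<in> borel_measurable P" by measurable
      have iC: "integrable P (\<lambda>w. (v w / c0') *\<^sub>R iexp (t * Z w))"
      proof (rule bd)
        fix w
        have "v w / c0' \<le> 3 / 1" using b[of w] one by (intro frac_le) auto
        then show "norm ((v w / c0') *\<^sub>R iexp (t * Z w)) \<le> 3"
          using v0[of w] one by simp
      qed measurable
      have "char ?M t = (\<integral>w. iexp (t * Z w) \<partial>?D)"
        unfolding char_def by (subst integral_distr) auto
      also have "\<dots> = (\<integral>w. (v w / c0') *\<^sub>R iexp (t * Z w) \<partial>P)"
        using nn by (intro integral_density) auto
      finally have e: "char ?M t = (\<integral>w. (v w / c0') *\<^sub>R iexp (t * Z w) \<partial>P)" .
      have ie: "Re (iexp y) = cos y" "Im (iexp y) = sin y" for y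
        by (simp_all add: Re_exp Im_exp)
      have "Re (char ?M t) = (\<integral>w. v w / c0' * cos (t * Z w) \<partial>P)"
        unfolding e integral_Re[OF iC, symmetric] by (simp add: ie del: of_real_mult)
      moreover have "Im (char ?M t) = (\<integral>w. v w / c0' * sin (t * Z w) \<partial>P)"
        unfolding e integral_Im[OF iC, symmetric] by (simp add: ie del: of_real_mult)
      moreover have "cos (y + (- (pi / 2))) = sin y" for y :: real
        by (simp add: cos_diff)
      ultimately show "char ?M t = Complex ((\<integral>w. v w * cos (t * Z w + 0) \<partial>P) / c0') ((\<integral>w. v w * cos (t * Z w + (- (pi / 2))) \<partial>P) / c0')"
        by (simp add: complex_eq_iff)
    qed
    have "measure ?M B = (\<integral>x. indicator B x \<partial>?M)"
      by simp
    also have "\<dots> = (\<integral>w. indicator B (Z w) \<partial>?D)"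
      by (subst integral_distr) auto
    also have "\<dots> = (\<integral>w. (v w / c0') *\<^sub>R indicator B (Z w) \<partial>P)"
      using nn by (intro integral_density) auto
    also have "\<dots> = (\<integral>w. v w * indicator B (Z w) \<partial>P) / c0'"
      by simp
    finally show "real_distribution ?M \<and> (\<forall>t. char ?M t
         = Complex ((\<integral>w. v w * cos (t * Z w + 0) \<partial>P) / c0') ((\<integral>w. v w * cos (t * Z w + (- (pi / 2))) \<partial>P) / c0')) \<and>
      measure ?M B = (\<integral>w. v w * indicator B (Z w) \<partial>P) / c0'"
      using rd 1 by blast
  qed
  note g1 = gen[OF assms(1) X v1 b1 c0_def[symmetric]] and g2 = gen[OF assms(2) Y v2 b2 c02]
  have pos: "c0 \<ge> 1" by (rule one[OF assms(1) X v1 b1 c0_def[symmetric]])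
  have "distr (density P1 (\<lambda>w. ennreal (v1 w / c0))) borel X = distr (density P2 (\<lambda>w. ennreal (v2 w / c0))) borel Y"
  proof (rule Levy_uniqueness)
    show "char (distr (density P1 (\<lambda>w. ennreal (v1 w / c0))) borel X) = char (distr (density P2 (\<lambda>w. ennreal (v2 w / c0))) borel Y)"
    proof
      fix t
      show "char (distr (density P1 (\<lambda>w. ennreal (v1 w / c0))) borel X) t = char (distr (density P2 (\<lambda>w. ennreal (v2 w / c0))) borel Y) t"
        using g1[OF pos] g2[OF pos] by (simp only: c)
    qed
  qed (use g1[OF pos] g2[OF pos] in blast)+
  then have "(\<integral>w. v1 w * indicator B (X w) \<partial>P1) / c0 = (\<integral>w. v2 w * indicator B (Y w) \<partial>P2) / c0"
    using g1[OF pos] g2[OF pos] by metis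
  then show ?thesis using pos by simp
qed

text \<open>Signed weights are moved into [1, 3] by adding 2; the contribution of the constant 2 is
  the unweighted case and is subtracted again.\<close>

lemma weighted_law:
  assumes P: "prob_space P1" "prob_space P2"
    and X [measurable]: "X \<in> borel_measurable P1" and Y [measurable]: "Y \<in> borel_measurable P2"
    and w1 [measurable]: "w1 \<in> borel_measurable P1" and w2 [measurable]: "w2 \<in> borel_measurable P2"
    and b1: "\<And>w. \<bar>w1 w\<bar> \<le> (1::real)" and b2: "\<And>w. \<bar>w2 w\<bar> \<le> (1::real)"
    and c0: "\<And>t p. (\<integral>w. cos (t * X w + p) \<partial>P1) = (\<integral>w. cos (t * Y w + p) \<partial>P2)"
    and c: "\<And>t p. (\<integral>w. w1 w * cos (t * X w + p) \<partial>P1) = (\<integral>w. w2 w * cos (t * Y w + p) \<partial>P2)"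
    and B [measurable]: "B \<in> sets borel"
  shows "(\<integral>w. w1 w * indicator B (X w) \<partial>P1) = (\<integral>w. w2 w * indicator B (Y w) \<partial>P2)"
proof -
  interpret P1: prob_space P1 by fact
  interpret P2: prob_space P2 by fact
  have bd: "\<bar>x\<bar> \<le> 1 \<Longrightarrow> 1 \<le> 2 + x \<and> 2 + x \<le> 3" for x :: real by linarith
  have pr: "\<bar>x * y\<bar> \<le> 1" if "\<bar>x\<bar> \<le> 1" "\<bar>y\<bar> \<le> 1" for x y :: real
    using mult_mono[of "\<bar>x\<bar>" 1 "\<bar>y\<bar>" 1] that by (simp add: abs_mult)
  have i1: "integrable P1 (\<lambda>w. f (X w))" "integrable P1 (\<lambda>w. w1 w * f (X w))"
    if [measurable]: "f \<in> borel_measurable borel" and f: "\<And>x. \<bar>f x\<bar> \<le> 1" for f :: "real \<Rightarrow> real"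
    by (rule P1.integrable_const_bound[of _ 1]; use f pr b1 in \<open>simp\<close>)+
  have i2: "integrable P2 (\<lambda>w. f (Y w))" "integrable P2 (\<lambda>w. w2 w * f (Y w))"
    if [measurable]: "f \<in> borel_measurable borel" and f: "\<And>x. \<bar>f x\<bar> \<le> 1" for f :: "real \<Rightarrow> real"
    by (rule P2.integrable_const_bound[of _ 1]; use f pr b2 in \<open>simp\<close>)+
  have e1: "(\<integral>w. (2 + w1 w) * f (X w) \<partial>P1) = (\<integral>w. 2 * f (X w) \<partial>P1) + (\<integral>w. w1 w * f (X w) \<partial>P1)"
    if "f \<in> borel_measurable borel" "\<And>x. \<bar>f x\<bar> \<le> 1" for f :: "real \<Rightarrow> real"
    unfolding distrib_right by (rule Bochner_Integration.integral_add) (use i1[OF that] in simp_all)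
  have e2: "(\<integral>w. (2 + w2 w) * f (Y w) \<partial>P2) = (\<integral>w. 2 * f (Y w) \<partial>P2) + (\<integral>w. w2 w * f (Y w) \<partial>P2)"
    if "f \<in> borel_measurable borel" "\<And>x. \<bar>f x\<bar> \<le> 1" for f :: "real \<Rightarrow> real"
    unfolding distrib_right by (rule Bochner_Integration.integral_add) (use i2[OF that] in simp_all)
  have "(\<integral>w. (2 + w1 w) * indicator B (X w) \<partial>P1) = (\<integral>w. (2 + w2 w) * indicator B (Y w) \<partial>P2)"
  proof (rule weighted_law_pos[OF P X Y])
    fix t p
    show "(\<integral>w. (2 + w1 w) * cos (t * X w + p) \<partial>P1) = (\<integral>w. (2 + w2 w) * cos (t * Y w + p) \<partial>P2)"
      using e1[of "\<lambda>x. cos (t * x + p)"] e2[of "\<lambda>x. cos (t * x + p)"] c0[of t p] c[of t p] by simp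
  qed (use bd b1 b2 in auto)
  moreover have "(\<integral>w. (2::real) * indicator B (X w) \<partial>P1) = (\<integral>w. 2 * indicator B (Y w) \<partial>P2)"
    by (rule weighted_law_pos[OF P X Y]) (use c0 in auto)
  ultimately show ?thesis
    using e1[of "indicator B"] e2[of "indicator B"] by (simp add: indicator_le_1)
qed

text \<open>Equality of all one-dimensional laws of linear combinations determines the joint law. The
  indicators are introduced one at a time; the remaining variables are kept in the phase of a
  cosine, which serves as a bounded weight for the one-dimensional uniqueness theorem.\<close>

lemma joint_law:
  fixes D :: "(('a \<Rightarrow> real) \<times> ('b \<Rightarrow> real)) set"
  assumes P: "prob_space P1" "prob_space P2"
    and add: "\<And>U V U' V'. (U, V) \<in> D \<Longrightarrow> (U', V') \<in> D \<Longrightarrow> (\<lambda>x. U x + U' x, \<lambda>y. V y + V' y) \<in> D"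
    and scale: "\<And>U V c. (U, V) \<in> D \<Longrightarrow> (\<lambda>x. c * U x, \<lambda>y. c * V y) \<in> D"
    and const: "\<And>c. (\<lambda>x. c, \<lambda>y. c) \<in> D"
    and meas: "\<And>U V. (U, V) \<in> D \<Longrightarrow> U \<in> borel_measurable P1 \<and> V \<in> borel_measurable P2"
    and eq: "\<And>U V. (U, V) \<in> D \<Longrightarrow> (\<integral>x. cos (U x) \<partial>P1) = (\<integral>y. cos (V y) \<partial>P2)"
    and K: "finite K" "\<And>k. k \<in> K \<Longrightarrow> (X k, Y k) \<in> D" "\<And>k. k \<in> K \<Longrightarrow> B k \<in> sets borel"
    and UV: "(U, V) \<in> D"
  shows "(\<integral>x. (\<Prod>k\<in>K. indicator (B k) (X k x)) * cos (U x) \<partial>P1)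
       = (\<integral>y. (\<Prod>k\<in>K. indicator (B k) (Y k y)) * cos (V y) \<partial>P2)"
  using K UV
proof (induction K arbitrary: U V rule: finite_induct)
  case empty
  then show ?case using eq by simp
next
  case (insert k K)
  interpret P1: prob_space P1 by fact
  interpret P2: prob_space P2 by fact
  have mK [measurable]: "X i \<in> borel_measurable P1" "Y i \<in> borel_measurable P2" if "i \<in> insert k K" for i
    using meas insert.prems(1)[OF that] by auto
  have BK [measurable]: "B i \<in> sets borel" if "i \<in> insert k K" for i using insert.prems(2)[OF that] .
  define I1 where "I1 = (\<lambda>x. \<Prod>i\<in>K. indicator (B i) (X i x) :: real)"
  define I2 where "I2 = (\<lambda>x. \<Prod>i\<in>K. indicator (B i) (Y i x) :: real)"
  have Im [measurable]: "I1 \<in> borel_measurable P1" "I2 \<in> borel_measurable P2"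
    unfolding I1_def I2_def by (intro borel_measurable_prod; measurable)+
  have Ib: "0 \<le> I1 x" "I1 x \<le> 1" "0 \<le> I2 y" "I2 y \<le> 1" for x y
    unfolding I1_def I2_def by (auto intro!: prod_nonneg prod_le_1)
  have IH: "(\<integral>x. I1 x * cos (U' x) \<partial>P1) = (\<integral>y. I2 y * cos (V' y) \<partial>P2)" if "(U', V') \<in> D" for U' V'
    unfolding I1_def I2_def by (rule insert.IH) (use insert.prems that in auto)
  have UVm [measurable]: "U \<in> borel_measurable P1" "V \<in> borel_measurable P2"
    using meas[OF insert.prems(3)] by auto
  have XY: "(\<lambda>x. t * X k x + p, \<lambda>y. t * Y k y + p) \<in> D" for t p
    using add[OF scale[OF insert.prems(1)[OF insertI1], of t] const[of p]] .
  have bnd: "\<bar>a * cos x\<bar> \<le> 1" if "0 \<le> a" "a \<le> 1" for a x :: real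
    using mult_mono[of "\<bar>a\<bar>" 1 "\<bar>cos x\<bar>" 1] that by (simp add: abs_mult)
  have kk: "k \<in> insert k K" by simp
  have "(\<integral>x. (I1 x * cos (U x)) * indicator (B k) (X k x) \<partial>P1) = (\<integral>y. (I2 y * cos (V y)) * indicator (B k) (Y k y) \<partial>P2)"
  proof (rule weighted_law[OF P mK(1)[OF kk] mK(2)[OF kk]])
    fix t p
    show "(\<integral>x. cos (t * X k x + p) \<partial>P1) = (\<integral>y. cos (t * Y k y + p) \<partial>P2)"
      by (rule eq[OF XY])
    have neg: "(\<lambda>x. - 1 * (t * X k x + p), \<lambda>y. - 1 * (t * Y k y + p)) \<in> D"
      by (rule scale[OF XY])
    \<comment> \<open>A product of cosines becomes a sum of cosines of the sum and the difference of
      the phases. Both remain in \<open>D\<close>, so the induction hypothesis applies to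
      each.\<close>
    have c2: "a * cos u * cos v = (a * cos (u + v) + a * cos (u + - 1 * v)) / 2" for a u v :: real
      by (simp add: cos_add cos_diff algebra_simps)
    have i1: "integrable P1 (\<lambda>x. I1 x * cos (U' x))" if [measurable]: "U' \<in> borel_measurable P1" for U'
      by (rule P1.integrable_const_bound[of _ 1]) (use bnd Ib in auto)
    have i2: "integrable P2 (\<lambda>x. I2 x * cos (U' x))" if [measurable]: "U' \<in> borel_measurable P2" for U'
      by (rule P2.integrable_const_bound[of _ 1]) (use bnd Ib in auto)
    have m: "X k \<in> borel_measurable P1" "Y k \<in> borel_measurable P2" using mK[OF kk] by auto
    note [measurable] = m
    show "(\<integral>x. I1 x * cos (U x) * cos (t * X k x + p) \<partial>P1) = (\<integral>y. I2 y * cos (V y) * cos (t * Y k y + p) \<partial>P2)"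
      unfolding c2 integral_divide_zero
      using IH[OF add[OF insert.prems(3) XY]] IH[OF add[OF insert.prems(3) neg]]
      by (subst Bochner_Integration.integral_add; (intro i1; measurable)?)
        (subst Bochner_Integration.integral_add; (intro i2; measurable)?; simp)
  qed (use bnd Ib BK in auto)
  then show ?case
    using insert.hyps by (simp add: I1_def I2_def mult_ac)
qed

section \<open>White noise\<close>

lemma white_noise_prob: "white_noise N P W \<Longrightarrow> prob_space P"
  by (simp add: white_noise_def)

lemma white_noise_pair:
  assumes "white_noise N P W" "h1 \<in> L2 N" "h2 \<in> L2 N"
  shows "centered_normal P (\<lambda>w. a * W h1 w + b * W h2 w)
     (a\<^sup>2 * l2_inner N h1 h1 + 2 * a * b * l2_inner N h1 h2 + b\<^sup>2 * l2_inner N h2 h2)"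
  using assms by (simp add: white_noise_def centered_normal_pair_def l2_norm_sq)

lemma white_noise_single:
  assumes "white_noise N P W" "h \<in> L2 N"
  shows "centered_normal P (W h) (l2_inner N h h)"
  using white_noise_pair[OF assms assms(2), of 1 0] by simp

lemma white_noise_measurable:
  assumes "white_noise N P W" "h \<in> L2 N"
  shows "W h \<in> borel_measurable P"
  using white_noise_single[OF assms] by (simp add: centered_normal_def)

lemma l2_inner_scale_both: "l2_inner N (\<lambda>x. c * f x) (\<lambda>x. c * f x) = c\<^sup>2 * l2_inner N f f"
  by (simp add: l2_inner_def power2_eq_square mult_ac)

text \<open>The covariances give the difference of the two sides variance 0, and a centred normal
  variable of variance 0 vanishes almost surely.\<close>

lemma white_noise_scale:
  assumes "white_noise N P W" "h \<in> L2 N"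
  shows "AE w in P. W (\<lambda>x. c * h x) w = c * W h w"
proof -
  have "l2_inner N (\<lambda>x. c * h x) (\<lambda>x. c * h x) = c\<^sup>2 * l2_inner N h h"
    by (rule l2_inner_scale_both)
  moreover have "l2_inner N (\<lambda>x. c * h x) h = c * l2_inner N h h"
    by (rule l2_inner_scale)
  ultimately have "centered_normal P (\<lambda>w. 1 * W (\<lambda>x. c * h x) w + (- c) * W h w) 0"
    using white_noise_pair[OF assms(1) L2_scale[OF assms(2), of c] assms(2), of 1 "- c"]
    by (simp add: power2_eq_square)
  then have "AE w in P. 1 * W (\<lambda>x. c * h x) w + (- c) * W h w = 0"
    by (simp add: centered_normal_def)
  then show ?thesis by eventually_elim simp
qed

text \<open>Additivity is forced by the covariances: the defect has second moment 0. The null set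
  depends on the two test functions.\<close>

lemma white_noise_add:
  assumes wn: "white_noise N P W" and h1: "h1 \<in> L2 N" and h2: "h2 \<in> L2 N"
  shows "AE w in P. W (\<lambda>x. h1 x + h2 x) w = W h1 w + W h2 w"
proof -
  let ?h3 = "\<lambda>x. h1 x + h2 x"
  define A B C where "A = l2_inner N h1 h1" and "B = l2_inner N h1 h2" and "C = l2_inner N h2 h2"
  have h3: "?h3 \<in> L2 N" by (rule L2_add[OF h1 h2])
  have i31: "l2_inner N ?h3 h1 = A + B" and i32: "l2_inner N ?h3 h2 = B + C"
    using l2_inner_add[OF h1 h2 h1] l2_inner_add[OF h1 h2 h2]
    by (simp_all add: A_def B_def C_def l2_inner_commute[of N h2 h1])
  have i33: "l2_inner N ?h3 ?h3 = A + 2 * B + C"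
    using l2_inner_add[OF h1 h2 h3] i31 i32
    by (simp add: l2_inner_commute[of N h1 ?h3] l2_inner_commute[of N h2 ?h3])
  note P = white_noise_prob[OF wn]
  note sq = centered_normal_square[OF P white_noise_pair[OF wn]]
  let ?X = "W h1" and ?Y = "W h2" and ?Z = "W ?h3"
  have s1: "(\<integral>w. (1 * ?X w + 1 * ?Y w)\<^sup>2 \<partial>P) = A + 2 * B + C" "integrable P (\<lambda>w. (1 * ?X w + 1 * ?Y w)\<^sup>2)"
    using sq[OF h1 h2, of 1 1] by (simp_all add: A_def B_def C_def)
  have s2: "(\<integral>w. (1 * ?Z w + (-1) * ?X w)\<^sup>2 \<partial>P) = C" "integrable P (\<lambda>w. (1 * ?Z w + (-1) * ?X w)\<^sup>2)"
    using sq[OF h3 h1, of 1 "-1"] by (simp_all add: i33 i31 flip: A_def)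
  have s3: "(\<integral>w. (1 * ?Z w + (-1) * ?Y w)\<^sup>2 \<partial>P) = A" "integrable P (\<lambda>w. (1 * ?Z w + (-1) * ?Y w)\<^sup>2)"
    using sq[OF h3 h2, of 1 "-1"] by (simp_all add: i33 i32 flip: C_def)
  have s4: "(\<integral>w. (?X w)\<^sup>2 \<partial>P) = A" "integrable P (\<lambda>w. (?X w)\<^sup>2)"
    using centered_normal_square[OF P white_noise_single[OF wn h1]] by (simp_all add: A_def)
  have s5: "(\<integral>w. (?Y w)\<^sup>2 \<partial>P) = C" "integrable P (\<lambda>w. (?Y w)\<^sup>2)"
    using centered_normal_square[OF P white_noise_single[OF wn h2]] by (simp_all add: C_def)
  have s6: "(\<integral>w. (?Z w)\<^sup>2 \<partial>P) = A + 2 * B + C" "integrable P (\<lambda>w. (?Z w)\<^sup>2)"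
    using centered_normal_square[OF P white_noise_single[OF wn h3]] by (simp_all add: i33)
  \<comment> \<open>Only pairs are jointly normal by assumption, so the square of the three-term combination is
    written through squares of two-term ones.\<close>
  have e: "(?Z w - ?X w - ?Y w)\<^sup>2 = ((1 * ?X w + 1 * ?Y w)\<^sup>2 + (1 * ?Z w + (-1) * ?X w)\<^sup>2 + (1 * ?Z w + (-1) * ?Y w)\<^sup>2)
     - ((?X w)\<^sup>2 + (?Y w)\<^sup>2 + (?Z w)\<^sup>2)" for w
    by (simp add: power2_eq_square algebra_simps)
  have "integrable P (\<lambda>w. (?Z w - ?X w - ?Y w)\<^sup>2)"
    unfolding e by (intro Bochner_Integration.integrable_diff Bochner_Integration.integrable_add s1 s2 s3 s4 s5 s6)
  moreover have "(\<integral>w. (?Z w - ?X w - ?Y w)\<^sup>2 \<partial>P) = 0"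
    unfolding e
    by (simp only: Bochner_Integration.integral_diff Bochner_Integration.integral_add
        Bochner_Integration.integrable_add s1 s2 s3 s4 s5 s6)
  ultimately have "AE w in P. (?Z w - ?X w - ?Y w)\<^sup>2 = 0"
    using integral_nonneg_eq_0_iff_AE[of P "\<lambda>w. (?Z w - ?X w - ?Y w)\<^sup>2"] by simp
  then show ?thesis by eventually_elim simp
qed

text \<open>The factor cos 0 puts the cylinder probability into the form in which joint laws are
  compared, with the zero variable in the phase.\<close>

lemma emeasure_cylinder:
  assumes "prob_space R" and X: "\<And>i. i \<in> I \<Longrightarrow> X i \<in> borel_measurable R"
    and J: "finite J" "J \<subseteq> I" and A: "\<And>j. j \<in> J \<Longrightarrow> A j \<in> sets borel"
  shows "emeasure (distr R (\<Pi>\<^sub>M i\<in>I. borel) (\<lambda>w. \<lambda>i\<in>I. X i w)) (prod_emb I (\<lambda>_. borel) J (Pi\<^sub>E J A))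
    = ennreal (\<integral>w. (\<Prod>j\<in>J. indicator (A j) (X j w)) * cos 0 \<partial>R)"
proof -
  interpret prob_space R by fact
  have m: "(\<lambda>w. \<lambda>i\<in>I. X i w) \<in> R \<rightarrow>\<^sub>M (\<Pi>\<^sub>M i\<in>I. borel)"
    by (rule measurable_restrict) (use X in simp)
  have s: "prod_emb I (\<lambda>_. borel) J (Pi\<^sub>E J A) \<in> sets (\<Pi>\<^sub>M i\<in>I. borel)"
    by (rule sets_PiM_I) (use J A in auto)
  have v: "(\<lambda>w. \<lambda>i\<in>I. X i w) -` prod_emb I (\<lambda>_. borel) J (Pi\<^sub>E J A) \<inter> space R = {w \<in> space R. \<forall>j\<in>J. X j w \<in> A j}"
    using J(2) by (auto simp: prod_emb_def PiE_iff restrict_def extensional_def subset_iff Pi_iff)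
  have ms: "{w \<in> space R. \<forall>j\<in>J. X j w \<in> A j} \<in> sets R"
    using measurable_sets[OF m s] unfolding v .
  have "emeasure (distr R (\<Pi>\<^sub>M i\<in>I. borel) (\<lambda>w. \<lambda>i\<in>I. X i w)) (prod_emb I (\<lambda>_. borel) J (Pi\<^sub>E J A))
      = emeasure R {w \<in> space R. \<forall>j\<in>J. X j w \<in> A j}"
    unfolding emeasure_distr[OF m s] v ..
  also have "\<dots> = ennreal (measure R {w \<in> space R. \<forall>j\<in>J. X j w \<in> A j})"
    by (rule emeasure_eq_measure)
  also have "measure R {w \<in> space R. \<forall>j\<in>J. X j w \<in> A j} = (\<integral>w. indicator {w \<in> space R. \<forall>j\<in>J. X j w \<in> A j} w \<partial>R)"
    using ms by simp
  also have "\<dots> = (\<integral>w. (\<Prod>j\<in>J. indicator (A j) (X j w)) * cos 0 \<partial>R)"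
  proof (rule Bochner_Integration.integral_cong[OF refl])
    fix w assume "w \<in> space R"
    then show "indicator {w \<in> space R. \<forall>j\<in>J. X j w \<in> A j} w = (\<Prod>j\<in>J. indicator (A j) (X j w)) * cos (0::real)"
      using J(1) by (auto simp: indicator_def prod_zero_iff intro!: prod.neutral)
  qed
  finally show ?thesis .
qed

text \<open>The component of the noise along the unit vector e may be replaced by an independent
  standard normal coordinate. By Pythagoras the variance of \<open>W h\<close> is the squared
  coefficient of h along e plus the variance of the remainder, so single variables keep their laws.
  Both processes are linear up to null sets, hence linear combinations keep theirs as well, and this
  fixes the law on the product space.\<close>

lemma noise_split:
  fixes b :: "('a \<Rightarrow> real) \<Rightarrow> real"
  assumes wn: "white_noise N P W" and e: "e \<in> L2 N" and e1: "l2_inner N e e = 1"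
  shows "distr P (\<Pi>\<^sub>M h\<in>L2 N. borel) (\<lambda>w. \<lambda>h\<in>L2 N. b h + r * W h w) =
    distr (P \<Otimes>\<^sub>M std_normal) (\<Pi>\<^sub>M h\<in>L2 N. borel)
      (\<lambda>z. \<lambda>h\<in>L2 N. b h + r * (l2_inner N h e * snd z + W (\<lambda>x. h x - l2_inner N h e * e x) (fst z)))"
proof -
  define p where "p = (\<lambda>h x. h x - l2_inner N h e * e x)"
  define W' where "W' = (\<lambda>h z. l2_inner N h e * snd z + W (p h) (fst z))"
  let ?Q = "P \<Otimes>\<^sub>M std_normal"
  interpret P: prob_space P by (rule white_noise_prob[OF wn])
  interpret G: prob_space std_normal by (rule prob_space_std_normal)
  interpret Q: pair_prob_space P std_normal ..
  have Qp: "prob_space ?Q" by unfold_locales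
  have pL: "p h \<in> L2 N" if "h \<in> L2 N" for h
    unfolding p_def by (rule L2_diff[OF that L2_scale[OF e]])
  have Wm: "W h \<in> borel_measurable P" if "h \<in> L2 N" for h
    by (rule white_noise_measurable[OF wn that])
  have W'm: "W' h \<in> borel_measurable ?Q" if h: "h \<in> L2 N" for h
    unfolding W'_def using measurable_compose[OF measurable_fst Wm[OF pL[OF h]]] by measurable
  \<comment> \<open>Null sets of the noise lift to the product because its first marginal is
    \<open>P\<close>.\<close>
  have AEQ: "AE z in ?Q. S (fst z)" if "AE w in P. S w" for S
  proof (rule AE_distrD[of fst ?Q P])
    show "AE w in distr ?Q P fst. S w"
      using that unfolding G.distr_pair_fst .
  qed simp
  have padd: "p (\<lambda>x. h x + h' x) = (\<lambda>x. p h x + p h' x)" if "h \<in> L2 N" "h' \<in> L2 N" for h h'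
    unfolding p_def l2_inner_add[OF that e] by (simp add: algebra_simps)
  have pscale: "p (\<lambda>x. c * h x) = (\<lambda>x. c * p h x)" for h c
    unfolding p_def l2_inner_scale by (simp add: algebra_simps)
  have W'add: "AE z in ?Q. W' (\<lambda>x. h x + h' x) z = W' h z + W' h' z" if h: "h \<in> L2 N" and h': "h' \<in> L2 N" for h h'
    using AEQ[OF white_noise_add[OF wn pL[OF h] pL[OF h']]]
    by eventually_elim (simp add: W'_def padd[OF h h'] l2_inner_add[OF h h' e] distrib_right)
  have W'scale: "AE z in ?Q. W' (\<lambda>x. c * h x) z = c * W' h z" if h: "h \<in> L2 N" for h c
    using AEQ[OF white_noise_scale[OF wn pL[OF h], of c]]
    by eventually_elim (simp add: W'_def pscale l2_inner_scale distrib_left mult.assoc)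
  have cosP: "(\<integral>w. cos (W h w + q) \<partial>P) = exp (- l2_inner N h h / 2) * cos q" if h: "h \<in> L2 N" for h q
    by (rule centered_normal_cos[OF white_noise_prob[OF wn] white_noise_single[OF wn h]])
  have cosQ: "(\<integral>z. cos (W' h z + q) \<partial>?Q) = exp (- l2_inner N h h / 2) * cos q" if h: "h \<in> L2 N" for h q
  proof -
    let ?c = "l2_inner N h e"
    have i: "integrable ?Q (\<lambda>z. cos (W' h z + q))"
      by (rule Q.integrable_const_bound[of _ 1]) (use W'm[OF h] in auto)
    have n: "l2_inner N (p h) (p h) = l2_inner N h h - ?c\<^sup>2"
    proof -
      have "(l2_norm N (p h))\<^sup>2 = (l2_norm N h)\<^sup>2 - 2 * l2_inner N h (\<lambda>x. ?c * e x) + (l2_norm N (\<lambda>x. ?c * e x))\<^sup>2"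
        unfolding p_def by (rule l2_norm_sq_diff[OF h L2_scale[OF e]])
      moreover have "l2_inner N h (\<lambda>x. ?c * e x) = ?c * ?c"
        unfolding l2_inner_commute[of N h "\<lambda>x. ?c * e x"] l2_inner_scale l2_inner_commute[of N e h] ..
      moreover have "l2_inner N (\<lambda>x. ?c * e x) (\<lambda>x. ?c * e x) = ?c\<^sup>2 * l2_inner N e e"
        by (rule l2_inner_scale_both)
      ultimately show ?thesis unfolding l2_norm_sq e1 by (simp add: power2_eq_square)
    qed
    have "(\<integral>z. cos (W' h z + q) \<partial>?Q) = (\<integral>w. \<integral>y. cos (W' h (w, y) + q) \<partial>std_normal \<partial>P)"
      by (rule Q.integral_fst'[OF i, symmetric])
    also have "\<dots> = (\<integral>w. \<integral>y. cos (?c * y + (W (p h) w + q)) \<partial>std_normal \<partial>P)"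
      by (simp add: W'_def add.assoc)
    also have "\<dots> = (\<integral>w. exp (- (?c\<^sup>2) / 2) * cos (W (p h) w + q) \<partial>P)"
      by (simp only: std_normal_cos_shift)
    also have "\<dots> = exp (- (?c\<^sup>2) / 2) * (exp (- l2_inner N (p h) (p h) / 2) * cos q)"
      by (simp only: integral_mult_right_zero cosP[OF pL[OF h]])
    also have "\<dots> = exp (- l2_inner N h h / 2) * cos q"
      unfolding n by (simp add: mult.assoc[symmetric] exp_add[symmetric] field_simps)
    finally show ?thesis .
  qed
  \<comment> \<open>Pairs of corresponding affine functions of the two processes. Almost sure
    equality is built in, since \<open>W\<close> is linear only up to null sets.\<close>
  define D where "D = {(U, V). U \<in> borel_measurable P \<and> V \<in> borel_measurable ?Q \<and>
     (\<exists>h\<in>L2 N. \<exists>q. (AE w in P. U w = W h w + q) \<and> (AE z in ?Q. V z = W' h z + q))}"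
  have DI: "(U, V) \<in> D" if "U \<in> borel_measurable P" "V \<in> borel_measurable ?Q" "h \<in> L2 N"
      "AE w in P. U w = W h w + q" "AE z in ?Q. V z = W' h z + q" for U V h q
    using that unfolding D_def by blast
  have Dadd: "(\<lambda>x. U x + U' x, \<lambda>y. V y + V' y) \<in> D" if UV: "(U, V) \<in> D" and UV': "(U', V') \<in> D" for U V U' V'
  proof -
    from UV obtain h q where h: "h \<in> L2 N" "AE w in P. U w = W h w + q" "AE z in ?Q. V z = W' h z + q"
      and m: "U \<in> borel_measurable P" "V \<in> borel_measurable ?Q" unfolding D_def by blast
    from UV' obtain h' q' where h': "h' \<in> L2 N" "AE w in P. U' w = W h' w + q'" "AE z in ?Q. V' z = W' h' z + q'"
      and m': "U' \<in> borel_measurable P" "V' \<in> borel_measurable ?Q" unfolding D_def by blast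
    show ?thesis
    proof (rule DI[of _ _ "\<lambda>x. h x + h' x" "q + q'"])
      show "AE w in P. U w + U' w = W (\<lambda>x. h x + h' x) w + (q + q')"
        using h(2) h'(2) white_noise_add[OF wn h(1) h'(1)] by eventually_elim simp
      show "AE z in ?Q. V z + V' z = W' (\<lambda>x. h x + h' x) z + (q + q')"
        using h(3) h'(3) W'add[OF h(1) h'(1)] by eventually_elim simp
    qed (use m m' L2_add[OF h(1) h'(1)] in auto)
  qed
  have Dscale: "(\<lambda>x. c * U x, \<lambda>y. c * V y) \<in> D" if UV: "(U, V) \<in> D" for U V c
  proof -
    from UV obtain h q where h: "h \<in> L2 N" "AE w in P. U w = W h w + q" "AE z in ?Q. V z = W' h z + q"
      and m: "U \<in> borel_measurable P" "V \<in> borel_measurable ?Q" unfolding D_def by blast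
    show ?thesis
    proof (rule DI[of _ _ "\<lambda>x. c * h x" "c * q"])
      show "AE w in P. c * U w = W (\<lambda>x. c * h x) w + c * q"
        using h(2) white_noise_scale[OF wn h(1), of c] by eventually_elim (simp add: distrib_left)
      show "AE z in ?Q. c * V z = W' (\<lambda>x. c * h x) z + c * q"
        using h(3) W'scale[OF h(1), of c] by eventually_elim (simp add: distrib_left)
    qed (use m L2_scale[OF h(1)] in auto)
  qed
  have Dconst: "(\<lambda>x. c, \<lambda>y. c) \<in> D" for c
  proof (rule DI[of _ _ "\<lambda>x. 0" c])
    show "AE w in P. c = W (\<lambda>x. 0) w + c"
      using white_noise_scale[OF wn L2_zero, of 0] by simp
    show "AE z in ?Q. c = W' (\<lambda>x. 0) z + c"
      using W'scale[OF L2_zero, of 0] by simp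
  qed (simp_all add: L2_zero)
  have Dcos: "(\<integral>x. cos (U x) \<partial>P) = (\<integral>y. cos (V y) \<partial>?Q)" if UV: "(U, V) \<in> D" for U V
  proof -
    from UV obtain h q where h: "h \<in> L2 N" "AE w in P. U w = W h w + q" "AE z in ?Q. V z = W' h z + q"
      and m [measurable]: "U \<in> borel_measurable P" "V \<in> borel_measurable ?Q" unfolding D_def by blast
    note [measurable] = Wm[OF h(1)] W'm[OF h(1)]
    have "(\<integral>x. cos (U x) \<partial>P) = (\<integral>w. cos (W h w + q) \<partial>P)"
    proof (rule integral_cong_AE)
      show "AE w in P. cos (U w) = cos (W h w + q)" using h(2) by eventually_elim simp
    qed measurable
    moreover have "(\<integral>y. cos (V y) \<partial>?Q) = (\<integral>z. cos (W' h z + q) \<partial>?Q)"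
    proof (rule integral_cong_AE)
      show "AE z in ?Q. cos (V z) = cos (W' h z + q)" using h(3) by eventually_elim simp
    qed measurable
    ultimately show ?thesis by (simp add: cosP[OF h(1)] cosQ[OF h(1)])
  qed
  have DW: "(\<lambda>w. b h + r * W h w, \<lambda>z. b h + r * W' h z) \<in> D" if h: "h \<in> L2 N" for h
  proof -
    have "(W h, W' h) \<in> D"
      by (rule DI[of _ _ h 0]) (use h Wm[OF h] W'm[OF h] in auto)
    from Dadd[OF Dconst Dscale[OF this]] show ?thesis .
  qed
  let ?S = "\<Pi>\<^sub>M h\<in>L2 N. (borel :: real measure)"
  have "distr P ?S (\<lambda>w. \<lambda>h\<in>L2 N. b h + r * W h w) = distr ?Q ?S (\<lambda>z. \<lambda>h\<in>L2 N. b h + r * W' h z)"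
  proof (rule measure_eqI_PiM_infinite[where I = "L2 N" and M = "\<lambda>_. borel"])
    fix A and J assume J: "finite J" "J \<subseteq> L2 N" and A: "\<And>i. i \<in> J \<Longrightarrow> A i \<in> sets (borel :: real measure)"
    have "(\<integral>w. (\<Prod>j\<in>J. indicator (A j) (b j + r * W j w)) * cos (0::real) \<partial>P)
        = (\<integral>z. (\<Prod>j\<in>J. indicator (A j) (b j + r * W' j z)) * cos 0 \<partial>?Q)"
    proof (rule joint_law[OF white_noise_prob[OF wn] Qp, where D = D and U = "\<lambda>w. 0" and V = "\<lambda>z. 0" and K = J
            and X = "\<lambda>h w. b h + r * W h w" and Y = "\<lambda>h z. b h + r * W' h z" and B = A])
      show "U \<in> borel_measurable P \<and> V \<in> borel_measurable ?Q" if "(U, V) \<in> D" for U V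
        using that by (simp add: D_def)
      show "(\<lambda>w. b h + r * W h w, \<lambda>z. b h + r * W' h z) \<in> D" if "h \<in> J" for h
        using that J(2) by (intro DW) blast
    qed (fact Dadd Dscale Dconst Dcos J(1) A)+
    then show "emeasure (distr P ?S (\<lambda>w. \<lambda>h\<in>L2 N. b h + r * W h w)) (prod_emb (L2 N) (\<lambda>_. borel) J (Pi\<^sub>E J A))
       = emeasure (distr ?Q ?S (\<lambda>z. \<lambda>h\<in>L2 N. b h + r * W' h z)) (prod_emb (L2 N) (\<lambda>_. borel) J (Pi\<^sub>E J A))"
      using emeasure_cylinder[OF white_noise_prob[OF wn], of "L2 N" "\<lambda>h w. b h + r * W h w" J A]
        emeasure_cylinder[OF Qp, of "L2 N" "\<lambda>h z. b h + r * W' h z" J A] J A Wm W'm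
      by simp
  next
    have "(\<lambda>w. \<lambda>h\<in>L2 N. b h + r * W h w) \<in> P \<rightarrow>\<^sub>M ?S"
      by (rule measurable_restrict) (use Wm in simp)
    then show "finite_measure (distr P ?S (\<lambda>w. \<lambda>h\<in>L2 N. b h + r * W h w))"
      by (rule P.finite_measure_distr)
  qed simp_all
  then show ?thesis by (simp add: W'_def p_def)
qed

text \<open>On [0, 1] the densities centred at 0 and at k are both at least the standard normal
  density at 1, so the two errors of any test sum to at least that number times the unit
  length.\<close>

lemma std_normal_two_point:
  assumes [measurable]: "S \<in> sets borel" and k: "0 \<le> k" "k \<le> 1"
  shows "ennreal (std_normal_density 1) \<le> (\<integral>\<^sup>+y. indicator S y \<partial>std_normal) + (\<integral>\<^sup>+y. indicator (- S) (y + k) \<partial>std_normal)"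
proof -
  let ?f = "\<lambda>y. ennreal (std_normal_density y)"
  have ge: "std_normal_density 1 \<le> std_normal_density y" if "\<bar>y\<bar> \<le> 1" for y
    using that by (auto simp: std_normal_density_def abs_square_le_1 intro!: divide_right_mono)
  have "(\<integral>\<^sup>+y. indicator S y \<partial>std_normal) = (\<integral>\<^sup>+y. ?f y * indicator S y \<partial>lborel)"
    by (rule nn_integral_density) auto
  moreover have "(\<integral>\<^sup>+y. indicator (- S) (y + k) \<partial>std_normal) = (\<integral>\<^sup>+y. ?f y * indicator (- S) (y + k) \<partial>lborel)"
    by (rule nn_integral_density) auto
  moreover have "\<dots> = (\<integral>\<^sup>+y. ?f (y - k) * indicator (- S) y \<partial>lborel)"
    by (subst (2) nn_integral_real_affine[of _ 1 k]) (auto simp: add.commute)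
  moreover have "(\<integral>\<^sup>+y. ?f y * indicator S y \<partial>lborel) + (\<integral>\<^sup>+y. ?f (y - k) * indicator (- S) y \<partial>lborel)
     = (\<integral>\<^sup>+y. ?f y * indicator S y + ?f (y - k) * indicator (- S) y \<partial>lborel)"
    by (rule nn_integral_add[symmetric]) auto
  moreover have "(\<integral>\<^sup>+y. ennreal (std_normal_density 1) * indicator {0..1::real} y \<partial>lborel) \<le> \<dots>"
  proof (rule nn_integral_mono)
    fix y :: real
    show "ennreal (std_normal_density 1) * indicator {0..1} y \<le> ?f y * indicator S y + ?f (y - k) * indicator (- S) y"
      using ge[of y] ge[of "y - k"] k by (auto simp: indicator_def intro!: ennreal_leI)
  qed
  moreover have "(\<integral>\<^sup>+y. ennreal (std_normal_density 1) * indicator {0..1} y \<partial>(lborel :: real measure)) = ennreal (std_normal_density 1)"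
    by (subst nn_integral_cmult) simp_all
  ultimately show ?thesis by simp
qed

text \<open>After the splitting, the two drifts differ by a translation of the independent normal
  coordinate by k alone. With the rest of the noise held fixed, any test on the whole process
  becomes a test between two normal laws on the line.\<close>

lemma two_point:
  fixes b :: "('a \<Rightarrow> real) \<Rightarrow> real"
  assumes wn: "white_noise N P W" and e: "e \<in> L2 N" and e1: "l2_inner N e e = 1"
    and k: "0 \<le> k" "k \<le> 1" and B: "B \<in> sets (\<Pi>\<^sub>M h\<in>L2 N. borel)"
  shows "ennreal (std_normal_density 1) \<le>
     emeasure P {w \<in> space P. (\<lambda>h\<in>L2 N. b h + r * W h w) \<in> B} +
     emeasure P {w \<in> space P. (\<lambda>h\<in>L2 N. b h + r * k * l2_inner N h e + r * W h w) \<notin> B}"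
proof -
  let ?S = "\<Pi>\<^sub>M h\<in>L2 N. (borel :: real measure)" and ?Q = "P \<Otimes>\<^sub>M std_normal"
  let ?b1 = "\<lambda>h. b h + r * k * l2_inner N h e"
  define F where "F = (\<lambda>c w y. \<lambda>h\<in>L2 N. (c h :: real) + r * (l2_inner N h e * y + W (\<lambda>x. h x - l2_inner N h e * e x) w))"
  interpret P: prob_space P by (rule white_noise_prob[OF wn])
  interpret G: prob_space std_normal by (rule prob_space_std_normal)
  interpret Q: pair_prob_space P std_normal ..
  have Wm: "W h \<in> borel_measurable P" if "h \<in> L2 N" for h
    by (rule white_noise_measurable[OF wn that])
  have Ym: "(\<lambda>w. \<lambda>h\<in>L2 N. c h + r * W h w) \<in> P \<rightarrow>\<^sub>M ?S" for c
    by (rule measurable_restrict) (use Wm in simp)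
  have Fm: "(\<lambda>z. F c (fst z) (snd z)) \<in> ?Q \<rightarrow>\<^sub>M ?S" for c
    unfolding F_def
  proof (rule measurable_restrict)
    fix h assume "h \<in> L2 N"
    then have "W (\<lambda>x. h x - l2_inner N h e * e x) \<in> borel_measurable P"
      by (intro Wm L2_diff L2_scale e)
    from measurable_compose[OF measurable_fst this]
    show "(\<lambda>z. c h + r * (l2_inner N h e * snd z + W (\<lambda>x. h x - l2_inner N h e * e x) (fst z))) \<in> borel_measurable ?Q"
      by measurable
  qed
  have law: "emeasure P {w \<in> space P. (\<lambda>h\<in>L2 N. c h + r * W h w) \<in> C} = (\<integral>\<^sup>+w. \<integral>\<^sup>+y. indicator C (F c w y) \<partial>std_normal \<partial>P)"
    if C: "C \<in> sets ?S" for c C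
  proof -
    have "emeasure P {w \<in> space P. (\<lambda>h\<in>L2 N. c h + r * W h w) \<in> C} = emeasure (distr P ?S (\<lambda>w. \<lambda>h\<in>L2 N. c h + r * W h w)) C"
      using Ym[of c] C by (subst emeasure_distr) (auto intro!: arg_cong[where f = "emeasure P"])
    also have "\<dots> = emeasure (distr ?Q ?S (\<lambda>z. F c (fst z) (snd z))) C"
      unfolding F_def noise_split[OF wn e e1] ..
    also have "\<dots> = (\<integral>\<^sup>+x. indicator C x \<partial>distr ?Q ?S (\<lambda>z. F c (fst z) (snd z)))"
      using C by simp
    also have "\<dots> = (\<integral>\<^sup>+z. indicator C (F c (fst z) (snd z)) \<partial>?Q)"
      using C Fm by (subst nn_integral_distr) simp_all
    also have "\<dots> = (\<integral>\<^sup>+w. \<integral>\<^sup>+y. indicator C (F c w y) \<partial>std_normal \<partial>P)"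
      using measurable_compose[OF Fm borel_measurable_indicator[OF C]]
      by (subst G.nn_integral_fst[symmetric]) simp_all
    finally show ?thesis .
  qed
  let ?C = "space ?S - B"
  have C: "?C \<in> sets ?S" using B by auto
  have Fsp: "F c w y \<in> space ?S" for c w y
    by (simp add: F_def space_PiM)
  \<comment> \<open>This equality holds for every sample point, without exceptional null set, as the
    added drift is r times the coefficient of h along e times k.\<close>
  have shift: "F ?b1 w y = F b w (y + k)" for w y
    by (auto simp: F_def restrict_def algebra_simps)
  have Fmw: "F b w \<in> borel \<rightarrow>\<^sub>M ?S" for w
    unfolding F_def by (rule measurable_restrict) simp
  have Fm2: "(\<lambda>w. \<integral>\<^sup>+y. indicator C' (F c w y) \<partial>std_normal) \<in> borel_measurable P" if "C' \<in> sets ?S" for C' c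
    using G.borel_measurable_nn_integral_fst[OF measurable_compose[OF Fm[of c] borel_measurable_indicator[OF that]]]
    by simp
  have "ennreal (std_normal_density 1) = (\<integral>\<^sup>+w. ennreal (std_normal_density 1) \<partial>P)"
    by (simp add: P.emeasure_space_1)
  also have "\<dots> \<le> (\<integral>\<^sup>+w. (\<integral>\<^sup>+y. indicator B (F b w y) \<partial>std_normal) + (\<integral>\<^sup>+y. indicator ?C (F ?b1 w y) \<partial>std_normal) \<partial>P)"
  proof (rule nn_integral_mono)
    fix w
    have S: "F b w -` B \<in> sets borel"
      using measurable_sets[OF Fmw B] by simp
    have "ennreal (std_normal_density 1) \<le> (\<integral>\<^sup>+y. indicator (F b w -` B) y \<partial>std_normal) + (\<integral>\<^sup>+y. indicator (- (F b w -` B)) (y + k) \<partial>std_normal)"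
      by (rule std_normal_two_point[OF S k])
    also have "(\<integral>\<^sup>+y. indicator (F b w -` B) y \<partial>std_normal) = (\<integral>\<^sup>+y. indicator B (F b w y) \<partial>std_normal)"
      by (rule nn_integral_cong) (simp add: indicator_def)
    also have "(\<integral>\<^sup>+y. indicator (- (F b w -` B)) (y + k) \<partial>std_normal) = (\<integral>\<^sup>+y. indicator ?C (F ?b1 w y) \<partial>std_normal)"
      unfolding shift by (rule nn_integral_cong) (use Fsp in \<open>simp add: indicator_def\<close>)
    finally show "ennreal (std_normal_density 1) \<le> (\<integral>\<^sup>+y. indicator B (F b w y) \<partial>std_normal) + (\<integral>\<^sup>+y. indicator ?C (F ?b1 w y) \<partial>std_normal)" .
  qed
  also have "\<dots> = (\<integral>\<^sup>+w. \<integral>\<^sup>+y. indicator B (F b w y) \<partial>std_normal \<partial>P) + (\<integral>\<^sup>+w. \<integral>\<^sup>+y. indicator ?C (F ?b1 w y) \<partial>std_normal \<partial>P)"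
    by (rule nn_integral_add[OF Fm2[OF B] Fm2[OF C]])
  also have "\<dots> = emeasure P {w \<in> space P. (\<lambda>h\<in>L2 N. b h + r * W h w) \<in> B} + emeasure P {w \<in> space P. (\<lambda>h\<in>L2 N. ?b1 h + r * W h w) \<in> ?C}"
    unfolding law[OF B] law[OF C] ..
  also have "{w \<in> space P. (\<lambda>h\<in>L2 N. ?b1 h + r * W h w) \<in> ?C} = {w \<in> space P. (\<lambda>h\<in>L2 N. ?b1 h + r * W h w) \<notin> B}"
    by (auto simp: space_PiM)
  finally show ?thesis .
qed

section \<open>The upper bound\<close>

text \<open>Over a common finite index set differences of expansions are again expansions, which
  fails for sums over the support; hence the change of form.\<close>

lemma fin_expansion_eq_expansion:
  assumes "finite S" "\<And>j k. (j, k) \<notin> S \<Longrightarrow> \<theta> j k = 0"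
  shows "fin_expansion \<theta> = expansion S \<theta>"
proof
  fix x
  show "fin_expansion \<theta> x = expansion S \<theta> x"
    unfolding fin_expansion_def expansion_def
    by (rule sum.mono_neutral_left) (use assms in auto)
qed

text \<open>As a chosen representative \<open>radon_Q\<close> need not be additive pointwise, so the
  difference is first replaced almost everywhere by the explicit expansion. The factor 1 / pi^2 is
  bounded by 1.\<close>

lemma radon_Q_diff_norm:
  assumes S: "finite S" and M: "\<And>j k. (j, k) \<in> S \<Longrightarrow> real (Suc (j + k)) \<le> K"
  shows "(l2_norm cyl (\<lambda>z. radon_Q (expansion S \<theta>) z - radon_Q (expansion S \<theta>') z))\<^sup>2
    \<le> K * (l2_norm disk (\<lambda>x. expansion S \<theta> x - expansion S \<theta>' x))\<^sup>2"
proof -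
  let ?d = "\<lambda>j k. \<theta> j k - \<theta>' j k"
  let ?D = "\<lambda>z. radon_Q (expansion S \<theta>) z - radon_Q (expansion S \<theta>') z"
  note h = radon_Q_expansion[where S = S and \<theta> = \<theta>] and h' = radon_Q_expansion[where S = S and \<theta> = \<theta>']
  have DL: "?D \<in> L2 cyl" by (rule L2_diff[OF h(1) h'(1)])
  have ae: "AE z in cyl. (?D z)\<^sup>2 = (q_expansion S ?d z)\<^sup>2"
    using h(3) h'(3) by eventually_elim (simp only: q_expansion_diff)
  have "(\<integral>z. (?D z)\<^sup>2 \<partial>cyl) = (\<integral>z. (q_expansion S ?d z)\<^sup>2 \<partial>cyl)"
    by (rule integral_cong_AE[OF _ _ ae]) (use DL q_expansion_L2[of S ?d] in \<open>auto simp: L2_def dest: borel_measurable_integrable\<close>)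
  then have "(l2_norm cyl ?D)\<^sup>2 = (l2_norm cyl (q_expansion S ?d))\<^sup>2"
    by (simp add: l2_norm_def)
  also have "\<dots> = (\<Sum>(j, k)\<in>S. (?d j k)\<^sup>2 * (real (Suc (j + k)) / pi\<^sup>2))"
    by (rule q_expansion_norm_sq[OF S])
  also have "\<dots> \<le> (\<Sum>(j, k)\<in>S. K * (?d j k)\<^sup>2)"
  proof (rule sum_mono, clarify)
    fix j k assume jk: "(j, k) \<in> S"
    have p: "1 \<le> pi\<^sup>2" using pi_ge_two by (simp add: one_le_power)
    have "real (Suc (j + k)) / pi\<^sup>2 \<le> K / 1"
      using M[OF jk] p by (intro frac_le) auto
    then have "(?d j k)\<^sup>2 * (real (Suc (j + k)) / pi\<^sup>2) \<le> (?d j k)\<^sup>2 * K"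
      by (intro mult_left_mono) auto
    then show "(?d j k)\<^sup>2 * (real (Suc (j + k)) / pi\<^sup>2) \<le> K * (?d j k)\<^sup>2"
      by (simp only: mult.commute)
  qed
  also have "\<dots> = K * (\<Sum>(j, k)\<in>S. (?d j k)\<^sup>2)"
    by (simp add: sum_distrib_left case_prod_beta')
  also have "(\<Sum>(j, k)\<in>S. (?d j k)\<^sup>2) = (l2_norm disk (expansion S ?d))\<^sup>2"
    by (rule expansion_norm_sq[OF S, symmetric])
  finally show ?thesis by (simp only: expansion_diff)
qed

text \<open>Minimality bounds the squared error \<open>D\<close> by that of \<open>g0\<close> plus a
  noise term proportional to the distance w between g and \<open>g0\<close>. Splitting that term as
  w^2 / 4 plus a remainder, with w^2 \<le> 2 D + 2 D0, lets D / 2 be absorbed on the left; this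
  produces the constants 3 and 8.\<close>

lemma oracle_inequality:
  assumes f: "f \<in> L2 M" and g: "g \<in> L2 M" and g0: "g0 \<in> L2 M"
    and min: "- 2 * (l2_inner M f g + r * x) + (l2_norm M g)\<^sup>2 \<le> - 2 * (l2_inner M f g0 + r * x0) + (l2_norm M g0)\<^sup>2"
    and noise: "\<bar>x - x0\<bar> \<le> sqrt K * l2_norm M (\<lambda>y. g y - g0 y) * \<bar>z\<bar>" and r: "r \<ge> 0" and K: "K \<ge> 0"
  shows "(l2_dist M g f)\<^sup>2 \<le> 3 * (l2_dist M f g0)\<^sup>2 + 8 * r\<^sup>2 * K * z\<^sup>2"
proof -
  define w where "w = l2_norm M (\<lambda>y. g y - g0 y)"
  define D where "D = (l2_dist M g f)\<^sup>2"
  define D0 where "D0 = (l2_dist M f g0)\<^sup>2"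
  have D: "D = (l2_norm M g)\<^sup>2 - 2 * l2_inner M f g + (l2_norm M f)\<^sup>2"
    unfolding D_def l2_dist_def l2_norm_sq_diff[OF g f] l2_inner_commute[of M g f] ..
  have D0: "D0 = (l2_norm M f)\<^sup>2 - 2 * l2_inner M f g0 + (l2_norm M g0)\<^sup>2"
    unfolding D0_def l2_dist_def by (rule l2_norm_sq_diff[OF f g0])
  have "r * (x - x0) \<le> r * (sqrt K * w * \<bar>z\<bar>)"
    using noise r by (intro mult_left_mono) (auto simp: w_def)
  then have 1: "D \<le> D0 + 2 * (r * (sqrt K * w * \<bar>z\<bar>))"
    using min unfolding D D0 by (simp add: algebra_simps)
  have 2: "w\<^sup>2 \<le> 2 * D + 2 * D0"
  proof -
    let ?u = "\<lambda>y. g y - f y" and ?v = "\<lambda>y. f y - g0 y"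
    have uv: "?u \<in> L2 M" "?v \<in> L2 M" by (rule L2_diff[OF g f], rule L2_diff[OF f g0])
    have "w\<^sup>2 = (l2_norm M (\<lambda>y. ?u y + ?v y))\<^sup>2" by (simp add: w_def)
    also have "\<dots> = D + 2 * l2_inner M ?u ?v + D0"
      unfolding l2_norm_sq_add[OF uv] D_def D0_def l2_dist_def ..
    also have "\<dots> = 2 * D + 2 * D0 - (l2_norm M (\<lambda>y. ?u y - ?v y))\<^sup>2"
      unfolding l2_norm_sq_diff[OF uv] D_def D0_def l2_dist_def by simp
    finally show ?thesis by simp
  qed
  have 3: "2 * (r * (sqrt K * w * \<bar>z\<bar>)) \<le> w\<^sup>2 / 4 + 4 * r\<^sup>2 * K * z\<^sup>2"
  proof -
    let ?b = "2 * r * sqrt K * \<bar>z\<bar>"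
    have "0 \<le> (w / 2 - ?b)\<^sup>2" by simp
    also have "\<dots> = w\<^sup>2 / 4 - w * ?b + ?b\<^sup>2"
      by (simp add: power2_diff power_divide)
    also have "?b\<^sup>2 = 4 * r\<^sup>2 * K * z\<^sup>2"
      using K by (simp add: power_mult_distrib)
    finally show ?thesis by (simp add: algebra_simps)
  qed
  show ?thesis using 1 2 3 unfolding D_def[symmetric] D0_def[symmetric] by linarith
qed

text \<open>The maximum over the net is controlled by \<open>x \<le> exp x - 1\<close> at \<open>x = z\<^sup>2 / 4 - ln (card G)\<close>.\<close>

lemma net_estimator_risk:
  assumes wn: "white_noise cyl P W" and n: "n \<ge> 1" and S: "finite S"
    and K: "\<And>j k. (j, k) \<in> S \<Longrightarrow> real (Suc (j + k)) \<le> K" "K \<ge> 0"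
    and G: "finite G" "\<And>g. g \<in> G \<Longrightarrow> \<exists>\<theta>. g = expansion S \<theta>"
    and est: "is_net_estimator G fhat"
    and f: "f \<in> L2 disk" and g0: "g0 \<in> G" "l2_dist disk f g0 \<le> \<delta>"
  shows "risk P W n fhat f \<le> ennreal (3 * \<delta>\<^sup>2 + 32 * K / real n * (ln (real (card G)) + sqrt 2))"
proof -
  interpret P: prob_space P by (rule white_noise_prob[OF wn])
  define r where "r = real n powr (-1/2)"
  have r: "r \<ge> 0" "r\<^sup>2 = 1 / real n"
    using n by (simp_all add: r_def powr_minus powr_half_sqrt power_divide inverse_eq_divide)
  define N where "N = real (card G)"
  have N: "N \<ge> 1" using G(1) g0(1) by (auto simp: N_def Suc_le_eq card_gt_0_iff)
  have GL: "g \<in> L2 disk" if "g \<in> G" for g using G(2)[OF that] expansion_L2 by auto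
  have QL: "radon_Q g \<in> L2 cyl" if "g \<in> G" for g using G(2)[OF that] radon_Q_expansion(1) by auto
  have Qi: "l2_inner cyl (radon_Q g) (radon f) = l2_inner disk f g" if "g \<in> G" for g
    using G(2)[OF that] radon_Q_expansion(2)[OF f] by (auto simp: l2_inner_commute[of cyl "radon_Q _"])
  \<comment> \<open>An upper bound for the standard deviation of the noise difference between g and
    \<open>g0\<close>.\<close>
  define v where "v = (\<lambda>g. sqrt K * l2_norm disk (\<lambda>y. g y - g0 y))"
  \<comment> \<open>If \<open>v g\<close> is 0, division by zero makes \<open>Z g\<close> vanish, so
    the variance bound 1 holds in that case too.\<close>
  define Z where "Z = (\<lambda>g w. (1 / v g) * W (radon_Q g) w + (- (1 / v g)) * W (radon_Q g0) w)"
  have vn: "v g \<ge> 0" for g using K(2) by (simp add: v_def)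
  have var: "l2_inner cyl (radon_Q g) (radon_Q g) - 2 * l2_inner cyl (radon_Q g) (radon_Q g0) + l2_inner cyl (radon_Q g0) (radon_Q g0) \<le> (v g)\<^sup>2"
    if g: "g \<in> G" for g
  proof -
    obtain \<theta> \<theta>' where t: "g = expansion S \<theta>" "g0 = expansion S \<theta>'" using G(2)[OF g] G(2)[OF g0(1)] by auto
    have "(l2_norm cyl (\<lambda>z. radon_Q g z - radon_Q g0 z))\<^sup>2 \<le> K * (l2_norm disk (\<lambda>x. g x - g0 x))\<^sup>2"
      unfolding t by (rule radon_Q_diff_norm[OF S K(1)])
    then show ?thesis
      unfolding l2_norm_sq_diff[OF QL[OF g] QL[OF g0(1)]]
      using K(2) by (simp add: l2_norm_sq v_def power_mult_distrib)
  qed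
  have Zn: "\<exists>u\<le>1. centered_normal P (Z g) u" if g: "g \<in> G" for g
  proof (intro exI conjI)
    let ?a = "1 / v g"
    let ?u = "?a\<^sup>2 * l2_inner cyl (radon_Q g) (radon_Q g) + 2 * ?a * (- ?a) * l2_inner cyl (radon_Q g) (radon_Q g0) + (- ?a)\<^sup>2 * l2_inner cyl (radon_Q g0) (radon_Q g0)"
    show "centered_normal P (Z g) ?u"
      unfolding Z_def by (rule white_noise_pair[OF wn QL[OF g] QL[OF g0(1)]])
    have "?u = ?a\<^sup>2 * (l2_inner cyl (radon_Q g) (radon_Q g) - 2 * l2_inner cyl (radon_Q g) (radon_Q g0) + l2_inner cyl (radon_Q g0) (radon_Q g0))"
      by (simp only: power2_eq_square) algebra
    also have "\<dots> \<le> ?a\<^sup>2 * (v g)\<^sup>2" by (rule mult_left_mono[OF var[OF g]]) simp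
    also have "\<dots> \<le> 1" by (simp add: power_divide)
    finally show "?u \<le> 1" .
  qed
  have Zm [measurable]: "Z g \<in> borel_measurable P" if "g \<in> G" for g
    using Zn[OF that] by (auto simp: centered_normal_def)
  have Ze: "(\<integral>\<^sup>+w. ennreal (exp ((Z g w)\<^sup>2 / 4)) \<partial>P) \<le> ennreal (sqrt 2)" if "g \<in> G" for g
    using Zn[OF that] centered_normal_exp_square[OF white_noise_prob[OF wn]] by blast
  \<comment> \<open>The degenerate case is not seen by \<open>Z\<close>. There the variance of the
    noise difference is squeezed to 0, and the difference vanishes almost surely.\<close>
  have v0: "AE w in P. v g = 0 \<longrightarrow> W (radon_Q g) w = W (radon_Q g0) w" if g: "g \<in> G" for g
  proof (cases "v g = 0")
    case True
    let ?u = "1\<^sup>2 * l2_inner cyl (radon_Q g) (radon_Q g) + 2 * 1 * (- 1) * l2_inner cyl (radon_Q g) (radon_Q g0) + (- 1)\<^sup>2 * l2_inner cyl (radon_Q g0) (radon_Q g0)"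
    have c: "centered_normal P (\<lambda>w. 1 * W (radon_Q g) w + (- 1) * W (radon_Q g0) w) ?u"
      by (rule white_noise_pair[OF wn QL[OF g] QL[OF g0(1)]])
    have "?u = 0" using centered_normal_nonneg[OF c] var[OF g] True by simp
    then have "AE w in P. 1 * W (radon_Q g) w + (- 1) * W (radon_Q g0) w = 0"
      using c by (simp add: centered_normal_def)
    then show ?thesis by eventually_elim simp
  qed simp
  define c1 where "c1 = 3 * \<delta>\<^sup>2 + 32 * K / real n * ln N"
  define c2 where "c2 = 32 * K / real n / N"
  have c: "c1 \<ge> 0" "c2 \<ge> 0" using K(2) N by (simp_all add: c1_def c2_def)
  have "AE w in P. \<forall>g\<in>G. v g = 0 \<longrightarrow> W (radon_Q g) w = W (radon_Q g0) w"
    using v0 by (subst AE_ball_countable) (auto simp: countable_finite G(1))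
  then have "AE w in P. (l2_dist disk (fhat (observe W n f w)) f)\<^sup>2 \<le> c1 + c2 * (\<Sum>g\<in>G. exp ((Z g w)\<^sup>2 / 4))"
  proof eventually_elim
    fix w assume w: "\<forall>g\<in>G. v g = 0 \<longrightarrow> W (radon_Q g) w = W (radon_Q g0) w"
    let ?y = "observe W n f w"
    have "?y \<in> space obs_space" by (simp add: observe_def obs_space_def space_PiM)
    then have am: "is_arg_min (emp_risk ?y) (\<lambda>g. g \<in> G) (fhat ?y)"
      using est by (simp add: is_net_estimator_def)
    define g where "g = fhat ?y"
    have g: "g \<in> G" and mn: "emp_risk ?y g \<le> emp_risk ?y g0"
      using am g0(1) unfolding is_arg_min_def g_def by (auto simp: not_less)
    have y: "?y (radon_Q h) = l2_inner disk f h + r * W (radon_Q h) w" if "h \<in> G" for h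
      using QL[OF that] Qi[OF that] by (simp add: observe_def r_def)
    have "(l2_dist disk g f)\<^sup>2 \<le> 3 * (l2_dist disk f g0)\<^sup>2 + 8 * r\<^sup>2 * K * (Z g w)\<^sup>2"
    proof (rule oracle_inequality[OF f GL[OF g] GL[OF g0(1)]])
      show "- 2 * (l2_inner disk f g + r * W (radon_Q g) w) + (l2_norm disk g)\<^sup>2
        \<le> - 2 * (l2_inner disk f g0 + r * W (radon_Q g0) w) + (l2_norm disk g0)\<^sup>2"
        using mn y[OF g] y[OF g0(1)] by (simp add: emp_risk_def)
      have "\<bar>W (radon_Q g) w - W (radon_Q g0) w\<bar> \<le> v g * \<bar>Z g w\<bar>"
      proof (cases "v g = 0")
        case True
        then show ?thesis using w g by simp
      next
        case False
        then have "v g * \<bar>Z g w\<bar> = \<bar>v g * Z g w\<bar>" using vn[of g] by (simp add: abs_mult)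
        also have "v g * Z g w = W (radon_Q g) w - W (radon_Q g0) w"
          using False by (simp add: Z_def field_simps)
        finally show ?thesis by simp
      qed
      then show "\<bar>W (radon_Q g) w - W (radon_Q g0) w\<bar> \<le> sqrt K * l2_norm disk (\<lambda>y. g y - g0 y) * \<bar>Z g w\<bar>"
        by (simp add: v_def)
    qed (use r K in auto)
    also have "\<dots> \<le> 3 * \<delta>\<^sup>2 + 8 * r\<^sup>2 * K * (4 * (ln N + (\<Sum>g\<in>G. exp ((Z g w)\<^sup>2 / 4)) / N))"
    proof (intro add_mono mult_left_mono power_mono)
      have "exp ((Z g w)\<^sup>2 / 4) \<le> (\<Sum>g\<in>G. exp ((Z g w)\<^sup>2 / 4))"
        by (rule member_le_sum[OF g]) (use G(1) in auto)
      then have "exp ((Z g w)\<^sup>2 / 4) / N \<le> (\<Sum>g\<in>G. exp ((Z g w)\<^sup>2 / 4)) / N"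
        using N by (intro divide_right_mono) auto
      moreover have "1 + ((Z g w)\<^sup>2 / 4 - ln N) \<le> exp ((Z g w)\<^sup>2 / 4 - ln N)"
        by (rule exp_ge_add_one_self)
      moreover have "exp ((Z g w)\<^sup>2 / 4 - ln N) = exp ((Z g w)\<^sup>2 / 4) / N"
        using N by (simp add: exp_diff)
      moreover have "z \<le> 4 * (l + b)" if "a \<le> b" "1 + (z / 4 - l) \<le> e" "e = a" for a b e z l :: real
        using that by argo
      ultimately show "(Z g w)\<^sup>2 \<le> 4 * (ln N + (\<Sum>g\<in>G. exp ((Z g w)\<^sup>2 / 4)) / N)"
        by blast
    qed (use g0(2) K r in \<open>auto simp: l2_dist_def\<close>)
    also have "\<dots> = c1 + c2 * (\<Sum>g\<in>G. exp ((Z g w)\<^sup>2 / 4))"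
      unfolding r(2) c1_def c2_def using n N by (simp add: field_simps)
    finally show "(l2_dist disk (fhat (observe W n f w)) f)\<^sup>2 \<le> c1 + c2 * (\<Sum>g\<in>G. exp ((Z g w)\<^sup>2 / 4))"
      by (simp add: g_def)
  qed
  then have "risk P W n fhat f \<le> (\<integral>\<^sup>+w. ennreal (c1 + c2 * (\<Sum>g\<in>G. exp ((Z g w)\<^sup>2 / 4))) \<partial>P)"
    unfolding risk_def by (intro nn_integral_mono_AE) (auto elim!: eventually_mono intro: ennreal_leI)
  also have "\<dots> = (\<integral>\<^sup>+w. ennreal c1 + ennreal c2 * (\<Sum>g\<in>G. ennreal (exp ((Z g w)\<^sup>2 / 4))) \<partial>P)"
    using c by (intro nn_integral_cong) (simp add: ennreal_plus ennreal_mult sum_nonneg sum_ennreal)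
  also have "\<dots> = (\<integral>\<^sup>+w. ennreal c1 \<partial>P) + (\<integral>\<^sup>+w. ennreal c2 * (\<Sum>g\<in>G. ennreal (exp ((Z g w)\<^sup>2 / 4))) \<partial>P)"
    by (rule nn_integral_add) (auto intro!: borel_measurable_times borel_measurable_sum)
  also have "(\<integral>\<^sup>+w. ennreal c2 * (\<Sum>g\<in>G. ennreal (exp ((Z g w)\<^sup>2 / 4))) \<partial>P)
     = ennreal c2 * (\<integral>\<^sup>+w. (\<Sum>g\<in>G. ennreal (exp ((Z g w)\<^sup>2 / 4))) \<partial>P)"
    by (rule nn_integral_cmult) (auto intro!: borel_measurable_sum)
  also have "(\<integral>\<^sup>+w. (\<Sum>g\<in>G. ennreal (exp ((Z g w)\<^sup>2 / 4))) \<partial>P) = (\<Sum>g\<in>G. \<integral>\<^sup>+w. ennreal (exp ((Z g w)\<^sup>2 / 4)) \<partial>P)"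
    by (rule nn_integral_sum) auto
  also have "(\<integral>\<^sup>+w. ennreal c1 \<partial>P) + ennreal c2 * (\<Sum>g\<in>G. \<integral>\<^sup>+w. ennreal (exp ((Z g w)\<^sup>2 / 4)) \<partial>P)
      \<le> ennreal c1 + ennreal c2 * (\<Sum>g\<in>G. ennreal (sqrt 2))"
    by (intro add_mono mult_left_mono sum_mono Ze) (auto simp: P.emeasure_space_1)
  also have "\<dots> = ennreal (c1 + c2 * (N * sqrt 2))"
    using c N by (simp add: ennreal_plus ennreal_mult N_def ennreal_of_nat_eq_real_of_nat)
  also have "c1 + c2 * (N * sqrt 2) = 3 * \<delta>\<^sup>2 + 32 * K / real n * (ln (real (card G)) + sqrt 2)"
    using n N unfolding c1_def c2_def N_def[symmetric] by (simp add: field_simps)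
  finally show ?thesis .
qed

text \<open>In terms of x = delta^(-1/s) = n^(1/(2s+3)) the degrees in the net are O(x), its
  log-cardinality is O(x^2), and x^3 / n equals delta^2. Both terms of the risk bound are therefore
  of order delta^2.\<close>

lemma net_estimator_upper_bound:
  fixes s :: real
  assumes s: "s > 0" and wn: "white_noise cyl P W"
    and F: "F \<subseteq> L2 disk"
    and adm: "admissible_nets F s 2 T"
    and est: "\<forall>n\<ge>1. is_net_estimator (net_funs (T (real n powr (- s / (2 * s + 3))))) (fhat n)"
  shows "limsup (\<lambda>n. ennreal (real n powr (2 * s / (2 * s + 3))) * (SUP f\<in>F. risk P W n (fhat n) f)) < \<infinity>"
proof -
  define q where "q = s / (2 * s + 3)"
  have q: "q > 0" using s by (simp add: q_def)
  define \<delta> where "\<delta> = (\<lambda>n::nat. real n powr (- q))"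
  have dlim: "filterlim \<delta> (at_right 0) sequentially"
    unfolding filterlim_at
  proof
    show "\<forall>\<^sub>F n in sequentially. \<delta> n \<in> {0<..} \<and> \<delta> n \<noteq> 0"
      using eventually_gt_at_top[of 0] by eventually_elim (simp add: \<delta>_def)
    show "\<delta> \<longlonglongrightarrow> 0"
      unfolding \<delta>_def using q by (intro tendsto_neg_powr filterlim_real_sequentially) auto
  qed
  from adm obtain M :: "real \<Rightarrow> nat" and C :: real
    where net: "\<And>d. d > 0 \<Longrightarrow> is_delta_net F d (net_funs (T d))"
      and supp: "\<And>d \<theta> j k. d > 0 \<Longrightarrow> \<theta> \<in> T d \<Longrightarrow> (j, k) \<notin> {0..M d} \<times> {0..M d} \<Longrightarrow> \<theta> j k = 0"
      and Mt: "(\<lambda>d. real (M d)) \<in> \<Theta>[at_right 0](\<lambda>d. d powr (- 1 / s))"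
      and Ct: "\<forall>\<^sub>F d in at_right 0. ln (real (card (net_funs (T d)))) \<le> C * d powr (- real 2 / s)"
    unfolding admissible_nets_def by blast
  have "(\<lambda>d. real (M d)) \<in> O[at_right 0](\<lambda>d. d powr (- 1 / s))" using Mt by blast
  then obtain c where c: "c > 0" "\<forall>\<^sub>F d in at_right 0. norm (real (M d)) \<le> c * norm (d powr (- 1 / s))"
    by (elim landau_o.bigE)
  \<comment> \<open>Here 3 comes from the approximation error, 2 c + 1 from 2 M + 1 \<le> (2 c + 1)
    x with x \<ge> 1, and the added 2 absorbs sqrt 2.\<close>
  define K where "K = 3 + 32 * (2 * c + 1) * (\<bar>C\<bar> + 2)"
  have "\<forall>\<^sub>F n in sequentially. real (M (\<delta> n)) \<le> c * \<delta> n powr (- 1 / s)"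
    using filterlim_iff[THEN iffD1, OF dlim, rule_format, OF c(2)] by eventually_elim simp
  moreover have "\<forall>\<^sub>F n in sequentially. ln (real (card (net_funs (T (\<delta> n))))) \<le> C * \<delta> n powr (- 2 / s)"
    using filterlim_iff[THEN iffD1, OF dlim, rule_format, OF Ct] by eventually_elim simp
  moreover have "\<forall>\<^sub>F n in sequentially. n \<ge> (1::nat)" by (rule eventually_ge_at_top)
  ultimately have "\<forall>\<^sub>F n in sequentially. ennreal (real n powr (2 * s / (2 * s + 3))) * (SUP f\<in>F. risk P W n (fhat n) f) \<le> ennreal K"
  proof eventually_elim
    fix n :: nat
    assume M: "real (M (\<delta> n)) \<le> c * \<delta> n powr (- 1 / s)"
      and lnN: "ln (real (card (net_funs (T (\<delta> n))))) \<le> C * \<delta> n powr (- 2 / s)" and n: "1 \<le> n"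
    have d0: "\<delta> n > 0" using n by (simp add: \<delta>_def)
    define x where "x = \<delta> n powr (- 1 / s)"
    have x2: "\<delta> n powr (- 2 / s) = x\<^sup>2"
      using d0 by (simp add: x_def powr_power)
    define p where "p = 1 / (2 * s + 3)"
    have xn: "x = real n powr p"
      using n s by (simp add: x_def \<delta>_def powr_powr q_def p_def)
    have x: "x \<ge> 1"
      unfolding xn using n s by (intro ge_one_powr_ge_zero) (simp_all add: p_def)
    have dn: "(\<delta> n)\<^sup>2 = real n powr (- (2 * s * p))"
      using n by (simp add: \<delta>_def q_def p_def powr_power)
    have x3: "x ^ 3 / real n = real n powr (- (2 * s * p))"
    proof -
      have "x ^ 3 = real n powr (3 * p)" using n by (simp add: xn powr_power)
      then have "x ^ 3 / real n = real n powr (3 * p - 1)" using n by (simp add: powr_diff)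
      also have "3 * p - 1 = - (2 * s * p)" using s by (simp add: p_def field_simps)
      finally show ?thesis .
    qed
    let ?G = "net_funs (T (\<delta> n))"
    let ?S = "{0..M (\<delta> n)} \<times> {0..M (\<delta> n)}"
    let ?K = "2 * real (M (\<delta> n)) + 1"
    let ?b = "3 * (\<delta> n)\<^sup>2 + 32 * ?K / real n * (ln (real (card ?G)) + sqrt 2)"
    have fin: "finite ?G" using net[OF d0] by (simp add: is_delta_net_def)
    have G: "\<exists>\<theta>. g = expansion ?S \<theta>" if g: "g \<in> ?G" for g
    proof -
      obtain \<theta> where t: "\<theta> \<in> T (\<delta> n)" "g = fin_expansion \<theta>" using g by (auto simp: net_funs_def)
      then show ?thesis using fin_expansion_eq_expansion[of ?S \<theta>] supp[OF d0 t(1)] by auto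
    qed
    have Kb: "real (Suc (j + k)) \<le> ?K" if "(j, k) \<in> ?S" for j k
      using that by auto
    have est': "is_net_estimator ?G (fhat n)"
      using est n by (simp add: \<delta>_def q_def)
    have rb: "risk P W n (fhat n) f \<le> ennreal ?b" if f: "f \<in> F" for f
    proof -
      obtain g0 where g0: "g0 \<in> ?G" "l2_dist disk f g0 \<le> \<delta> n"
        using net[OF d0] f by (auto simp: is_delta_net_def)
      show ?thesis
        by (rule net_estimator_risk[OF wn n _ Kb _ fin G est' _ g0]) (use f F in auto)
    qed
    have "?b \<le> K * real n powr (- (2 * s * p))"
    proof -
      have "?K \<le> (2 * c + 1) * x" using M x unfolding x_def[symmetric] by (simp add: algebra_simps)
      moreover have "ln (real (card ?G)) + sqrt 2 \<le> (\<bar>C\<bar> + 2) * x\<^sup>2"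
      proof -
        have "C * x\<^sup>2 \<le> \<bar>C\<bar> * x\<^sup>2" by (intro mult_right_mono) auto
        moreover have "sqrt 2 \<le> 2 * x\<^sup>2"
        proof -
          have "sqrt 2 \<le> 2" by (rule real_le_lsqrt) auto
          moreover have "1 \<le> x\<^sup>2" using x by (rule one_le_power)
          ultimately show ?thesis by linarith
        qed
        ultimately show ?thesis using lnN unfolding x2 by (simp add: algebra_simps)
      qed
      ultimately have "?K * (ln (real (card ?G)) + sqrt 2) \<le> ((2 * c + 1) * x) * ((\<bar>C\<bar> + 2) * x\<^sup>2)"
      proof (rule mult_mono')
        \<comment> \<open>For an empty net the logarithm is \<open>ln 0\<close>, which is 0 by
          convention.\<close>
        show "0 \<le> ln (real (card ?G)) + sqrt 2"
          by (cases "card ?G = 0") auto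
      qed simp
      also have "\<dots> = (2 * c + 1) * (\<bar>C\<bar> + 2) * x ^ 3"
        by (simp add: power2_eq_square power3_eq_cube)
      finally have "32 * (?K * (ln (real (card ?G)) + sqrt 2)) / real n \<le> 32 * ((2 * c + 1) * (\<bar>C\<bar> + 2) * x ^ 3) / real n"
        by (intro divide_right_mono) auto
      also have "\<dots> = 32 * (2 * c + 1) * (\<bar>C\<bar> + 2) * (x ^ 3 / real n)" by simp
      finally show ?thesis
        unfolding dn x3 K_def by (simp add: algebra_simps)
    qed
    then have "(SUP f\<in>F. risk P W n (fhat n) f) \<le> ennreal (K * real n powr (- (2 * s * p)))"
      by (intro SUP_least order_trans[OF rb] ennreal_leI)
    then have "ennreal (real n powr (2 * s / (2 * s + 3))) * (SUP f\<in>F. risk P W n (fhat n) f)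
        \<le> ennreal (real n powr (2 * s / (2 * s + 3))) * ennreal (K * real n powr (- (2 * s * p)))"
      by (rule mult_left_mono) simp
    also have "\<dots> = ennreal (real n powr (2 * s / (2 * s + 3)) * (K * real n powr (- (2 * s * p))))"
      by (rule ennreal_mult'[symmetric]) simp
    also have "real n powr (2 * s / (2 * s + 3)) * (K * real n powr (- (2 * s * p))) = K"
    proof -
      have "real n powr (2 * s / (2 * s + 3)) * real n powr (- (2 * s * p)) = real n powr 0"
        unfolding powr_add[symmetric] by (simp add: p_def)
      then show ?thesis using n by (simp add: mult.left_commute)
    qed
    finally show "ennreal (real n powr (2 * s / (2 * s + 3))) * (SUP f\<in>F. risk P W n (fhat n) f) \<le> ennreal K" .
  qed
  then have "limsup (\<lambda>n. ennreal (real n powr (2 * s / (2 * s + 3))) * (SUP f\<in>F. risk P W n (fhat n) f)) \<le> ennreal K"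
    by (rule Limsup_bounded)
  then show ?thesis by (rule order_le_less_trans) simp
qed

section \<open>The lower bound\<close>

lemma l2_inner_radon_expansion:
  assumes h: "h \<in> L2 cyl"
  shows "l2_inner cyl h (radon (expansion S \<theta>)) = (\<Sum>(j, k)\<in>S. \<theta> j k / nrm (j + k) * l2_inner cyl h (psi j k))"
proof -
  let ?g = "\<lambda>z. \<Sum>p\<in>S. \<theta> (fst p) (snd p) / nrm (fst p + snd p) * psi (fst p) (snd p) z"
  have gL: "?g \<in> L2 cyl" by (intro L2_sum L2_scale psi_L2)
  have "AE z in cyl. radon (expansion S \<theta>) z = ?g z"
    using AE_cyl
  proof eventually_elim
    fix z :: "real \<times> real" assume z: "0 \<le> fst z \<and> fst z < 1"
    obtain u a where ua: "z = (u, a)" by (cases z)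
    have u: "0 \<le> u" "u < 1" using z ua by auto
    show "radon (expansion S \<theta>) z = ?g z"
      unfolding ua radon_expansion[OF u] radon_basis[OF u] by (rule sum.cong) auto
  qed
  then have "l2_inner cyl (radon (expansion S \<theta>)) h = l2_inner cyl ?g h"
    by (rule l2_inner_AE_cong[OF radon_L2[OF expansion_L2] h gL])
  also have "\<dots> = (\<Sum>p\<in>S. \<theta> (fst p) (snd p) / nrm (fst p + snd p) * l2_inner cyl (psi (fst p) (snd p)) h)"
    by (rule l2_inner_lincomb) (auto intro: psi_L2 h)
  finally show ?thesis
    by (simp add: case_prod_beta' l2_inner_commute[of cyl h])
qed

lemma basis_Bessel:
  assumes D: "D \<in> L2 disk" and S: "finite S"
  shows "(\<Sum>(j, k)\<in>S. (l2_inner disk D (basis j k))\<^sup>2) \<le> (l2_norm disk D)\<^sup>2"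
proof -
  define c where "c = (\<lambda>j k. l2_inner disk D (basis j k))"
  have "l2_inner disk D (expansion S c) = (\<Sum>(j, k)\<in>S. (c j k)\<^sup>2)"
  proof -
    have "l2_inner disk (expansion S c) D = (\<Sum>(j, k)\<in>S. (c j k)\<^sup>2)"
      unfolding l2_inner_expansion[OF D] by (rule sum.cong) (auto simp: c_def l2_inner_commute[of disk "basis _ _"] power2_eq_square)
    then show ?thesis by (simp add: l2_inner_commute[of disk D])
  qed
  moreover have "0 \<le> (l2_norm disk (\<lambda>x. D x - expansion S c x))\<^sup>2" by simp
  moreover have "(l2_norm disk (\<lambda>x. D x - expansion S c x))\<^sup>2 = (l2_norm disk D)\<^sup>2 - 2 * l2_inner disk D (expansion S c) + (l2_norm disk (expansion S c))\<^sup>2"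
    by (rule l2_norm_sq_diff[OF D expansion_L2])
  ultimately show ?thesis
    unfolding expansion_norm_sq[OF S] c_def by linarith
qed

text \<open>The complementary half-space is open by continuity of the inner product. This makes the
  tests obtained by thresholding a coefficient of an estimator measurable.\<close>

lemma halfspace_l2_borel:
  assumes b: "b \<in> L2 M"
  shows "{f \<in> L2 M. t \<le> l2_inner M f b} \<in> sets (l2_borel M)"
proof -
  let ?U = "{f \<in> L2 M. l2_inner M f b < t}"
  let ?G = "{U. U \<subseteq> L2 M \<and> (\<forall>f\<in>U. \<exists>e>0. \<forall>g\<in>L2 M. l2_dist M g f < e \<longrightarrow> g \<in> U)}"
  have GP: "?G \<subseteq> Pow (L2 M)" by auto
  have "?U \<in> ?G"
  proof (intro CollectI conjI ballI)
    fix f assume f: "f \<in> ?U"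
    define e where "e = (t - l2_inner M f b) / (l2_norm M b + 1)"
    have p: "l2_norm M b + 1 > 0" using l2_norm_nonneg[of M b] by linarith
    have e: "e > 0" using f p by (simp add: e_def)
    have "l2_inner M g b < t" if g: "g \<in> L2 M" "l2_dist M g f < e" for g
    proof -
      have fL: "f \<in> L2 M" using f by simp
      have "l2_inner M g b - l2_inner M f b = l2_inner M (\<lambda>x. g x - f x) b"
        by (rule l2_inner_diff[OF g(1) fL b, symmetric])
      also have "\<dots> \<le> l2_dist M g f * l2_norm M b"
        using l2_inner_le[OF L2_diff[OF g(1) fL] b] by (simp add: l2_dist_def)
      also have "\<dots> \<le> e * l2_norm M b" using g(2) by (intro mult_right_mono) auto
      also have "\<dots> < e * (l2_norm M b + 1)" using e by simp
      also have "\<dots> = t - l2_inner M f b" using p by (simp add: e_def)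
      finally show ?thesis by simp
    qed
    then show "\<exists>e>0. \<forall>g\<in>L2 M. l2_dist M g f < e \<longrightarrow> g \<in> ?U"
      using e by blast
  qed auto
  then have "?U \<in> sets (l2_borel M)"
    unfolding l2_borel_def using GP by (simp add: sigma_sets.Basic)
  moreover have "space (l2_borel M) = L2 M"
    unfolding l2_borel_def using GP by (rule space_measure_of)
  ultimately have "L2 M - ?U \<in> sets (l2_borel M)"
    by (metis sets.compl_sets)
  moreover have "L2 M - ?U = {f \<in> L2 M. t \<le> l2_inner M f b}" by auto
  ultimately show ?thesis by simp
qed

lemma space_l2_borel: "space (l2_borel M) = L2 M"
  unfolding l2_borel_def by (rule space_measure_of) auto

text \<open>Groups the vertices of the cube into the edges in direction p.\<close>

lemma sum_Pow_insert:
  fixes g :: "'a set \<Rightarrow> ennreal"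
  assumes "finite S" "p \<in> S"
  shows "(\<Sum>E\<in>Pow S. g E) = (\<Sum>E\<in>Pow (S - {p}). g E + g (insert p E))"
proof -
  have S: "Pow S = Pow (S - {p}) \<union> insert p ` Pow (S - {p})"
    using Pow_insert[of p "S - {p}"] assms(2) by (simp add: insert_absorb)
  have "inj_on (insert p) (Pow (S - {p}))"
    by (auto simp: inj_on_def)
  moreover have "Pow (S - {p}) \<inter> insert p ` Pow (S - {p}) = {}" by auto
  ultimately show ?thesis
    unfolding S using assms(1) by (subst sum.union_disjoint) (auto simp: sum.reindex sum.distrib)
qed

section \<open>The cube of hypotheses and the bound of Assouad type\<close>

definition cube_fun :: "(nat \<times> nat) set \<Rightarrow> real \<Rightarrow> (nat \<times> nat) set \<Rightarrow> real \<times> real \<Rightarrow> real" where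
  "cube_fun S \<tau> E = expansion S (\<lambda>j k. if (j, k) \<in> E then \<tau> else 0)"

lemma observe_measurable:
  assumes "white_noise cyl P W"
  shows "observe W n f \<in> P \<rightarrow>\<^sub>M obs_space"
  unfolding observe_def[abs_def] obs_space_def
  by (rule measurable_restrict) (use white_noise_measurable[OF assms] in simp)

text \<open>Assouad's argument: neighbouring vertices of the cube cannot be separated by a test, so
  each coordinate contributes an error of order \<open>\<tau>\<^sup>2\<close> on average over the cube.\<close>

lemma assouad_radon:
  assumes wn: "white_noise cyl P W" and n: "n \<ge> 1" and S: "finite S" and \<tau>: "\<tau> > 0"
    and small: "\<And>j k. (j, k) \<in> S \<Longrightarrow> real n * \<tau>\<^sup>2 * pi\<^sup>2 \<le> real (Suc (j + k))"
    and cube: "\<And>E. E \<subseteq> S \<Longrightarrow> cube_fun S \<tau> E \<in> F"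
    and gh: "ghat \<in> estimators"
  shows "ennreal (std_normal_density 1 / 8 * \<tau>\<^sup>2 * real (card S)) \<le> (SUP f\<in>F. risk P W n ghat f)"
proof -
  interpret P: prob_space P by (rule white_noise_prob[OF wn])
  define c0 where "c0 = std_normal_density 1"
  have c0: "c0 \<ge> 0" by (simp add: c0_def)
  define r where "r = real n powr (-1/2)"
  have r: "r > 0" "r = 1 / sqrt (real n)"
    using n by (simp_all add: r_def powr_minus powr_half_sqrt inverse_eq_divide)
  define f where "f = cube_fun S \<tau>"
  have fL: "f E \<in> L2 disk" for E by (simp add: f_def cube_fun_def expansion_L2)
  \<comment> \<open>The test derived from the estimator: a coefficient is decided to be \<tau> when
    its estimate is at least the midpoint \<tau> / 2.\<close>
  define B where "B = (\<lambda>p. {y \<in> space obs_space. \<tau> / 2 \<le> l2_inner disk (ghat y) (basis (fst p) (snd p))})"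
  have ghm: "ghat \<in> obs_space \<rightarrow>\<^sub>M l2_borel disk" using gh by (simp add: estimators_def)
  have ghL: "ghat y \<in> L2 disk" if "y \<in> space obs_space" for y
    using measurable_space[OF ghm that] by (simp add: space_l2_borel)
  have B: "B p \<in> sets obs_space" for p
  proof -
    have "ghat -` {f \<in> L2 disk. \<tau> / 2 \<le> l2_inner disk f (basis (fst p) (snd p))} \<inter> space obs_space = B p"
      using ghL by (auto simp: B_def)
    then show ?thesis
      using measurable_sets[OF ghm halfspace_l2_borel[OF basis_L2], of "\<tau> / 2" "fst p" "snd p"] by simp
  qed
  define err where "err = (\<lambda>E p. {w \<in> space P. (observe W n (f E) w \<in> B p) \<noteq> (p \<in> E)})"
  have errm: "err E p \<in> sets P" for E p
  proof -
    have "{w \<in> space P. observe W n (f E) w \<in> B p} \<in> sets P"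
      using measurable_sets[OF observe_measurable[OF wn] B] by (simp add: vimage_def Int_def conj_commute)
    then have "{w \<in> space P. observe W n (f E) w \<in> B p} \<in> sets P" "space P - {w \<in> space P. observe W n (f E) w \<in> B p} \<in> sets P"
      by auto
    moreover have "err E p = (if p \<in> E then space P - {w \<in> space P. observe W n (f E) w \<in> B p} else {w \<in> space P. observe W n (f E) w \<in> B p})"
      by (auto simp: err_def)
    ultimately show ?thesis by simp
  qed
  \<comment> \<open>A wrong decision means that the coefficient is off by at least \<tau> / 2; the
    inequality of Bessel adds these errors over the coordinates.\<close>
  have rk: "(\<Sum>p\<in>S. ennreal (\<tau>\<^sup>2 / 4) * emeasure P (err E p)) \<le> risk P W n ghat (f E)" if E: "E \<subseteq> S" for E
  proof -
    have "(\<Sum>p\<in>S. ennreal (\<tau>\<^sup>2 / 4) * emeasure P (err E p)) = (\<Sum>p\<in>S. \<integral>\<^sup>+w. ennreal (\<tau>\<^sup>2 / 4) * indicator (err E p) w \<partial>P)"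
      using errm by (intro sum.cong) (auto simp: nn_integral_cmult_indicator)
    also have "\<dots> = (\<integral>\<^sup>+w. (\<Sum>p\<in>S. ennreal (\<tau>\<^sup>2 / 4) * indicator (err E p) w) \<partial>P)"
      using errm by (intro nn_integral_sum[symmetric]) auto
    also have "\<dots> \<le> risk P W n ghat (f E)"
      unfolding risk_def
    proof (rule nn_integral_mono)
      fix w assume w: "w \<in> space P"
      let ?y = "observe W n (f E) w"
      have y: "?y \<in> space obs_space" by (rule measurable_space[OF observe_measurable[OF wn] w])
      let ?D = "\<lambda>x. ghat ?y x - f E x"
      have DL: "?D \<in> L2 disk" by (rule L2_diff[OF ghL[OF y] fL])
      have "(\<Sum>p\<in>S. \<tau>\<^sup>2 / 4 * indicator (err E p) w) \<le> (\<Sum>(j, k)\<in>S. (l2_inner disk ?D (basis j k))\<^sup>2)"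
      proof (rule sum_mono, clarify)
        fix j k assume jk: "(j, k) \<in> S"
        have "l2_inner disk ?D (basis j k) = l2_inner disk (ghat ?y) (basis j k) - (if (j, k) \<in> E then \<tau> else 0)"
          unfolding l2_inner_diff[OF ghL[OF y] fL basis_L2]
          using jk by (simp add: f_def cube_fun_def l2_inner_expansion_basis[OF S])
        moreover have "\<tau> / 2 \<le> \<bar>l2_inner disk (ghat ?y) (basis j k) - (if (j, k) \<in> E then \<tau> else 0)\<bar>" if "w \<in> err E (j, k)"
          using that y \<tau> by (auto simp: err_def B_def)
        ultimately have "(\<tau> / 2)\<^sup>2 \<le> (l2_inner disk ?D (basis j k))\<^sup>2" if "w \<in> err E (j, k)"
          using that \<tau> by (simp only: abs_le_square_iff[symmetric]) simp
        then show "\<tau>\<^sup>2 / 4 * indicator (err E (j, k)) w \<le> (l2_inner disk ?D (basis j k))\<^sup>2"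
          by (simp add: indicator_def power_divide)
      qed
      also have "\<dots> \<le> (l2_dist disk (ghat ?y) (f E))\<^sup>2"
        unfolding l2_dist_def by (rule basis_Bessel[OF DL S])
      finally have le: "ennreal (\<Sum>p\<in>S. \<tau>\<^sup>2 / 4 * indicator (err E p) w) \<le> ennreal ((l2_dist disk (ghat ?y) (f E))\<^sup>2)"
        by (rule ennreal_leI)
      have eq: "ennreal (\<Sum>p\<in>S. \<tau>\<^sup>2 / 4 * indicator (err E p) w) = (\<Sum>p\<in>S. ennreal (\<tau>\<^sup>2 / 4) * indicator (err E p) w)"
      proof -
        have "ennreal (\<Sum>p\<in>S. \<tau>\<^sup>2 / 4 * indicator (err E p) w) = (\<Sum>p\<in>S. ennreal (\<tau>\<^sup>2 / 4 * indicator (err E p) w))"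
          by (rule sum_ennreal[symmetric]) simp
        also have "\<dots> = (\<Sum>p\<in>S. ennreal (\<tau>\<^sup>2 / 4) * indicator (err E p) w)"
          by (rule sum.cong) (auto simp: indicator_def)
        finally show ?thesis .
      qed
      show "(\<Sum>p\<in>S. ennreal (\<tau>\<^sup>2 / 4) * indicator (err E p) w) \<le> ennreal ((l2_dist disk (ghat ?y) (f E))\<^sup>2)"
        using le unfolding eq .
    qed
    finally show ?thesis .
  qed
  have tp: "ennreal c0 \<le> emeasure P (err E p) + emeasure P (err (insert p E) p)"
    if p: "p \<in> S" and E: "E \<subseteq> S - {p}" for E p
  proof -
    obtain j k where pj: "p = (j, k)" by (cases p)
    define e where "e = (\<lambda>z. 1 / sqrt pi * psi j k z)"
    have eL: "e \<in> L2 cyl" unfolding e_def by (rule L2_scale[OF psi_L2])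
    have e1: "l2_inner cyl e e = 1"
      unfolding e_def l2_inner_scale_both psi_orthogonal by (simp add: power_divide)
    \<comment> \<open>The norm of the change of drift in units of the noise level: flipping one
      coordinate changes the transform by \<tau> times the singular value pi / sqrt (j + k + 1). The
      assumption \<open>small\<close> keeps it at most 1.\<close>
    define \<kappa> where "\<kappa> = sqrt (real n) * \<tau> * pi / sqrt (real (Suc (j + k)))"
    have k0: "0 \<le> \<kappa>" using \<tau> by (simp add: \<kappa>_def)
    have "\<kappa>\<^sup>2 = real n * \<tau>\<^sup>2 * pi\<^sup>2 / real (Suc (j + k))"
      unfolding \<kappa>_def by (simp add: power_divide power_mult_distrib del: of_nat_Suc)
    also have "\<dots> \<le> 1" using small[of j k] p pj by (simp del: of_nat_Suc)
    finally have k1: "\<kappa> \<le> 1" using k0 by (simp add: power_le_one_iff abs_square_le_1)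
    let ?b = "\<lambda>h. l2_inner cyl h (radon (f E))"
    have step: "l2_inner cyl h (radon (f (insert p E))) = ?b h + r * \<kappa> * l2_inner cyl h e" if h: "h \<in> L2 cyl" for h
    proof -
      let ?t = "\<lambda>E q. (if q \<in> E then \<tau> else 0) / nrm (fst q + snd q) * l2_inner cyl h (psi (fst q) (snd q))"
      have i: "l2_inner cyl h (radon (f E)) = (\<Sum>q\<in>S. ?t E q)" for E
        unfolding f_def cube_fun_def l2_inner_radon_expansion[OF h] by (rule sum.cong) auto
      have "(\<Sum>q\<in>S. ?t (insert p E) q) = (\<Sum>q\<in>S. ?t E q + (if q = p then \<tau> / nrm (j + k) * l2_inner cyl h (psi j k) else 0))"
        using E pj by (intro sum.cong) auto
      also have "\<dots> = (\<Sum>q\<in>S. ?t E q) + \<tau> / nrm (j + k) * l2_inner cyl h (psi j k)"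
        using S p by (simp add: sum.distrib)
      also have "\<tau> / nrm (j + k) * l2_inner cyl h (psi j k) = r * \<kappa> * l2_inner cyl h e"
      proof -
        have "l2_inner cyl h e = 1 / sqrt pi * l2_inner cyl h (psi j k)"
          unfolding e_def l2_inner_commute[of cyl h] by (rule l2_inner_scale)
        moreover have "r * \<kappa> * (1 / sqrt pi) = \<tau> / nrm (j + k)"
        proof -
          have "pi / sqrt pi = sqrt pi" by (rule real_div_sqrt) simp
          then have "r * \<kappa> * (1 / sqrt pi) = \<tau> * sqrt pi / sqrt (real (Suc (j + k)))"
            using n by (simp add: r(2) \<kappa>_def field_simps del: of_nat_Suc)
          then show ?thesis by (simp add: nrm_def real_sqrt_divide del: of_nat_Suc)
        qed
        ultimately show ?thesis by (simp only: mult.assoc[symmetric])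
      qed
      finally show ?thesis unfolding i .
    qed
    have "ennreal c0 \<le> emeasure P {w \<in> space P. (\<lambda>h\<in>L2 cyl. ?b h + r * W h w) \<in> B p} +
       emeasure P {w \<in> space P. (\<lambda>h\<in>L2 cyl. ?b h + r * \<kappa> * l2_inner cyl h e + r * W h w) \<notin> B p}"
      unfolding c0_def by (rule two_point[OF wn eL e1 k0 k1]) (use B in \<open>simp add: obs_space_def\<close>)
    also have "{w \<in> space P. (\<lambda>h\<in>L2 cyl. ?b h + r * W h w) \<in> B p} = err E p"
      using E by (auto simp: err_def observe_def r_def)
    also have "(\<lambda>h\<in>L2 cyl. ?b h + r * \<kappa> * l2_inner cyl h e + r * W h w) = observe W n (f (insert p E)) w" for w
      unfolding observe_def r_def[symmetric] by (rule restrict_ext) (simp add: step)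
    then have "{w \<in> space P. (\<lambda>h\<in>L2 cyl. ?b h + r * \<kappa> * l2_inner cyl h e + r * W h w) \<notin> B p} = err (insert p E) p"
      by (auto simp: err_def)
    finally show ?thesis .
  qed
  define m where "m = card S"
  define X where "X = (SUP f\<in>F. risk P W n ghat f)"
  have av: "ennreal (c0 * 2 ^ (m - 1)) \<le> (\<Sum>E\<in>Pow S. emeasure P (err E p))" if p: "p \<in> S" for p
  proof -
    have "ennreal (c0 * 2 ^ (m - 1)) = (\<Sum>E\<in>Pow (S - {p}). ennreal c0)"
      using S p c0 by (simp add: card_Pow m_def ennreal_mult ennreal_of_nat_eq_real_of_nat mult.commute)
    also have "\<dots> \<le> (\<Sum>E\<in>Pow (S - {p}). emeasure P (err E p) + emeasure P (err (insert p E) p))"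
      by (intro sum_mono tp p) auto
    also have "\<dots> = (\<Sum>E\<in>Pow S. emeasure P (err E p))"
      by (rule sum_Pow_insert[OF S p, symmetric])
    finally show ?thesis .
  qed
  show ?thesis
  proof (cases "S = {}")
    case True
    then show ?thesis by simp
  next
    case False
    then have m: "m \<ge> 1" using S by (simp add: m_def Suc_le_eq card_gt_0_iff)
    \<comment> \<open>The constant 1/8 is the cost 1/4 of an error times 1/2, as there are 2^(m-1)
      edges in each direction against 2^m vertices.\<close>
    have "ennreal (2 ^ m) * ennreal (c0 / 8 * \<tau>\<^sup>2 * real m) = ennreal (\<tau>\<^sup>2 / 4) * (\<Sum>p\<in>S. ennreal (c0 * 2 ^ (m - 1)))"
    proof -
      have "(2::real) ^ m = 2 * 2 ^ (m - 1)" using m by (cases m) simp_all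
      then have "2 ^ m * (c0 / 8 * \<tau>\<^sup>2 * real m) = \<tau>\<^sup>2 / 4 * (real m * (c0 * 2 ^ (m - 1)))" by simp
      moreover have "(\<Sum>p\<in>S. ennreal (c0 * 2 ^ (m - 1))) = ennreal (real m * (c0 * 2 ^ (m - 1)))"
        using c0 by (simp add: m_def ennreal_mult ennreal_of_nat_eq_real_of_nat)
      ultimately show ?thesis using c0 by (simp only: ennreal_mult[symmetric] zero_le_power zero_le_numeral zero_le_divide_iff
            mult_nonneg_nonneg zero_le_power2 of_nat_0_le_iff) (simp add: ennreal_mult[symmetric])
    qed
    also have "\<dots> \<le> ennreal (\<tau>\<^sup>2 / 4) * (\<Sum>p\<in>S. \<Sum>E\<in>Pow S. emeasure P (err E p))"
      by (intro mult_left_mono sum_mono av) auto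
    also have "\<dots> = (\<Sum>E\<in>Pow S. \<Sum>p\<in>S. ennreal (\<tau>\<^sup>2 / 4) * emeasure P (err E p))"
      by (subst sum.swap) (simp add: sum_distrib_left)
    also have "\<dots> \<le> (\<Sum>E\<in>Pow S. X)"
    proof (rule sum_mono)
      fix E assume E: "E \<in> Pow S"
      then have "(\<Sum>p\<in>S. ennreal (\<tau>\<^sup>2 / 4) * emeasure P (err E p)) \<le> risk P W n ghat (f E)" by (intro rk) auto
      also have "\<dots> \<le> X" unfolding X_def f_def using E by (intro SUP_upper cube) auto
      finally show "(\<Sum>p\<in>S. ennreal (\<tau>\<^sup>2 / 4) * emeasure P (err E p)) \<le> X" .
    qed
    also have "\<dots> = ennreal (2 ^ m) * X"
      using S by (simp add: card_Pow m_def ennreal_of_nat_eq_real_of_nat)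
    finally have "ennreal (c0 / 8 * \<tau>\<^sup>2 * real m) \<le> X"
      by (subst (asm) ennreal_mult_le_mult_iff) auto
    then show ?thesis by (simp add: c0_def m_def X_def)
  qed
qed

lemma cube_fun_in_class:
  fixes a :: "nat \<Rightarrow> nat \<Rightarrow> real"
  assumes S: "finite S" "(0, 0) \<notin> S" and E: "E \<subseteq> S"
    and b: "\<And>j k. (j, k) \<in> S \<Longrightarrow> \<bar>a j k\<bar> \<le> A" and L: "real (card S) * A\<^sup>2 * \<tau>\<^sup>2 \<le> L\<^sup>2"
  shows "cube_fun S \<tau> E \<in> fun_class a L"
proof -
  define \<theta> where "\<theta> = (\<lambda>j k. if (j, k) \<in> E then \<tau> else 0)"
  let ?f = "\<lambda>(j, k). (a j k)\<^sup>2 * (\<theta> j k)\<^sup>2"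
  have "(?f has_sum (\<Sum>p\<in>S. ?f p)) S" by (rule has_sum_finite[OF S(1)])
  then have hs: "(?f has_sum (\<Sum>p\<in>S. ?f p)) (- {(0, 0)})"
    by (rule has_sum_cong_neutral[THEN iffD1, rotated -1]) (use E S in \<open>auto simp: \<theta>_def split: if_splits\<close>)
  have "(\<Sum>p\<in>S. ?f p) \<le> (\<Sum>p\<in>S. A\<^sup>2 * \<tau>\<^sup>2)"
  proof (rule sum_mono, clarify)
    fix j k assume jk: "(j, k) \<in> S"
    have "\<bar>a j k\<bar>\<^sup>2 \<le> A\<^sup>2" by (rule power_mono[OF b[OF jk]]) simp
    then show "(a j k)\<^sup>2 * (\<theta> j k)\<^sup>2 \<le> A\<^sup>2 * \<tau>\<^sup>2"
      by (intro mult_mono) (auto simp: \<theta>_def)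
  qed
  also have "\<dots> \<le> L\<^sup>2" using L by (simp add: mult.assoc)
  finally have "\<theta> \<in> ellipsoid a L"
    unfolding ellipsoid_def using hs by (auto simp: has_sum_imp_summable infsumI)
  moreover have "has_expansion (cube_fun S \<tau> E) \<theta>"
    unfolding has_expansion_def
  proof (rule tendsto_eventually)
    \<comment> \<open>The distances vanish as soon as the index set contains S, so the limit is
      reached and completeness of the basis does not enter.\<close>
    have "finite S \<and> S \<subseteq> - {(0, 0)} \<and>
      (\<forall>X. finite X \<and> S \<subseteq> X \<and> X \<subseteq> - {(0, 0)} \<longrightarrow> l2_dist disk (cube_fun S \<tau> E) (\<lambda>x. \<Sum>(j, k)\<in>X. \<theta> j k * basis j k x) = 0)"
    proof (intro conjI allI impI)
      fix X assume X: "finite X \<and> S \<subseteq> X \<and> X \<subseteq> - {(0, 0)}"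
      have "(\<Sum>(j, k)\<in>X. \<theta> j k * basis j k x) = cube_fun S \<tau> E x" for x
        unfolding cube_fun_def expansion_def \<theta>_def by (rule sum.mono_neutral_right) (use X E in auto)
      then show "l2_dist disk (cube_fun S \<tau> E) (\<lambda>x. \<Sum>(j, k)\<in>X. \<theta> j k * basis j k x) = 0"
        by (simp add: l2_dist_def l2_norm_def)
    qed (use S in auto)
    then show "\<forall>\<^sub>F X in finite_subsets_at_top (- {(0, 0)}). l2_dist disk (cube_fun S \<tau> E) (\<lambda>x. \<Sum>(j, k)\<in>X. \<theta> j k * basis j k x) = 0"
      unfolding eventually_finite_subsets_at_top by blast
  qed
  ultimately show ?thesis
    unfolding fun_class_def by (auto simp: cube_fun_def expansion_L2)
qed

text \<open>The cube has M^2 coordinates of size tau^2 ~ M^(-2s-2), with M of order n^(1/(2s+3)).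
  Weights of order M^(2s) keep it in the ellipsoid, n tau^2 is of order M and so within the range of
  singular values, and M^2 tau^2 is of the order of the rate.\<close>

lemma minimax_lower_bound:
  fixes s L C1 :: real and a :: "nat \<Rightarrow> nat \<Rightarrow> real"
  assumes L: "L > 0" and s: "s > 0" and C1: "C1 > 0" and wn: "white_noise cyl P W"
    and a: "\<And>j k. (j, k) \<noteq> (0, 0) \<Longrightarrow> \<bar>a j k\<bar> \<le> C1 * real (j + k) powr s"
  shows "liminf (\<lambda>n. ennreal (real n powr (2 * s / (2 * s + 3))) *
     (INF ghat\<in>estimators. SUP f\<in>fun_class a L. risk P W n ghat f)) > 0"
proof -
  \<comment> \<open>The first entry places the cube in the ellipsoid; 4^s arises from j + k \<le> 4
    M. The second one bounds the change of drift along an edge, using j + k \<ge> 2 M.\<close>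
  define \<kappa> where "\<kappa> = min (L\<^sup>2 / (C1 * 4 powr s)\<^sup>2) (2 / pi\<^sup>2)"
  have \<kappa>: "\<kappa> > 0" "\<kappa> \<le> L\<^sup>2 / (C1 * 4 powr s)\<^sup>2" "\<kappa> \<le> 2 / pi\<^sup>2"
    using L C1 by (auto simp: \<kappa>_def)
  define c where "c = std_normal_density 1 / 8 * \<kappa> * 2 powr (- 2 * s)"
  have "std_normal_density 1 > 0" by (rule normal_density_pos) simp
  then have c: "c > 0" using \<kappa>(1) by (simp add: c_def)
  have "ennreal c \<le> ennreal (real n powr (2 * s / (2 * s + 3))) *
     (INF ghat\<in>estimators. SUP f\<in>fun_class a L. risk P W n ghat f)" if n: "n \<ge> 1" for n
  proof -
    define x where "x = real n powr (1 / (2 * s + 3))"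
    have x: "x \<ge> 1" unfolding x_def using n s by (intro ge_one_powr_ge_zero) auto
    \<comment> \<open>Rounding up gives n \<le> M^(2s+3). The price M \<le> 2 x is the factor
      2^(-2s) in the constant c.\<close>
    define M where "M = nat \<lceil>x\<rceil>"
    have Mx: "x \<le> real M" "real M \<le> 2 * x" using x unfolding M_def by linarith+
    then have M: "real M \<ge> 1" using x by linarith
    have nM: "real n \<le> real M powr (2 * s + 3)"
    proof -
      have "real n = x powr (2 * s + 3)" using n s by (simp add: x_def powr_powr)
      also have "\<dots> \<le> real M powr (2 * s + 3)" using Mx x s by (intro powr_mono2) auto
      finally show ?thesis .
    qed
    define \<tau> where "\<tau> = sqrt (\<kappa> * real M powr (- 2 * s - 2))"
    have \<tau>: "\<tau> > 0" "\<tau>\<^sup>2 = \<kappa> * real M powr (- 2 * s - 2)" using \<kappa>(1) M by (auto simp: \<tau>_def)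
    \<comment> \<open>Starting at M + 1 excludes (0, 0) and keeps all degrees comparable with
      M.\<close>
    define S where "S = {M+1..2*M} \<times> {M+1..2*M}"
    have S: "finite S" "(0, 0) \<notin> S" and cS: "real (card S) = (real M)\<^sup>2"
      by (auto simp: S_def power2_eq_square)
    have small: "real n * \<tau>\<^sup>2 * pi\<^sup>2 \<le> real (Suc (j + k))" if "(j, k) \<in> S" for j k
    proof -
      have "real n * (\<kappa> * real M powr (- 2 * s - 2)) * pi\<^sup>2 \<le> real M powr (2 * s + 3) * (2 / pi\<^sup>2 * real M powr (- 2 * s - 2)) * pi\<^sup>2"
        using nM \<kappa> by (intro mult_right_mono mult_mono) auto
      also have "\<dots> = 2 * (real M powr (2 * s + 3) * real M powr (- 2 * s - 2))" by simp
      also have "\<dots> = 2 * real M" using M by (simp add: powr_add[symmetric])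
      also have "\<dots> \<le> real (Suc (j + k))" using that by (auto simp: S_def)
      finally show ?thesis by (simp only: \<tau>(2))
    qed
    have cube: "cube_fun S \<tau> E \<in> fun_class a L" if "E \<subseteq> S" for E
    proof (rule cube_fun_in_class[OF S that])
      fix j k assume jk: "(j, k) \<in> S"
      have "(j, k) \<noteq> (0, 0)" using jk S(2) by metis
      then have "\<bar>a j k\<bar> \<le> C1 * real (j + k) powr s" by (rule a)
      also have "\<dots> \<le> C1 * (4 * real M) powr s"
        using jk C1 s by (intro mult_left_mono powr_mono2) (auto simp: S_def)
      finally show "\<bar>a j k\<bar> \<le> C1 * (4 * real M) powr s" .
    next
      have "real (card S) * (C1 * (4 * real M) powr s)\<^sup>2 * \<tau>\<^sup>2
          = (C1 * 4 powr s)\<^sup>2 * \<kappa> * ((real M)\<^sup>2 * (real M powr s)\<^sup>2 * real M powr (- 2 * s - 2))"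
        unfolding cS \<tau>(2) by (simp add: powr_mult power_mult_distrib)
      also have "(real M)\<^sup>2 * (real M powr s)\<^sup>2 * real M powr (- 2 * s - 2) = 1"
      proof -
        have "(real M)\<^sup>2 = real M powr 2" using M by (simp add: powr_numeral)
        moreover have "(real M powr s)\<^sup>2 = real M powr (s + s)"
          unfolding power2_eq_square powr_add ..
        ultimately have "(real M)\<^sup>2 * (real M powr s)\<^sup>2 * real M powr (- 2 * s - 2) = real M powr (2 + (s + s) + (- 2 * s - 2))"
          by (simp only: powr_add)
        also have "2 + (s + s) + (- 2 * s - 2) = 0" by simp
        finally show ?thesis using M by simp
      qed
      also have "(C1 * 4 powr s)\<^sup>2 * \<kappa> * 1 \<le> L\<^sup>2"
        using \<kappa>(2) C1 by (simp add: pos_le_divide_eq mult.commute)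
      finally show "real (card S) * (C1 * (4 * real M) powr s)\<^sup>2 * \<tau>\<^sup>2 \<le> L\<^sup>2" .
    qed
    have "ennreal (std_normal_density 1 / 8 * \<tau>\<^sup>2 * real (card S)) \<le> (INF ghat\<in>estimators. SUP f\<in>fun_class a L. risk P W n ghat f)"
      by (intro INF_greatest assouad_radon[OF wn n S(1) \<tau>(1) small cube])
    then have "ennreal (real n powr (2 * s / (2 * s + 3))) * ennreal (std_normal_density 1 / 8 * \<tau>\<^sup>2 * real (card S))
       \<le> ennreal (real n powr (2 * s / (2 * s + 3))) * (INF ghat\<in>estimators. SUP f\<in>fun_class a L. risk P W n ghat f)"
      by (rule mult_left_mono) simp
    moreover have "ennreal c \<le> ennreal (real n powr (2 * s / (2 * s + 3))) * ennreal (std_normal_density 1 / 8 * \<tau>\<^sup>2 * real (card S))"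
    proof -
      have e1: "real n powr (2 * s / (2 * s + 3)) = x powr (2 * s)"
        using n s by (simp add: x_def powr_powr)
      have e2: "\<tau>\<^sup>2 * real (card S) = \<kappa> * real M powr (- 2 * s)"
      proof -
        have "(real M)\<^sup>2 = real M powr 2" using M by (simp add: powr_numeral)
        then have "\<tau>\<^sup>2 * real (card S) = \<kappa> * real M powr (- 2 * s - 2 + 2)"
          unfolding \<tau>(2) cS powr_add by (simp only: mult.assoc)
        then show ?thesis by simp
      qed
      have e3: "2 powr (- 2 * s) * x powr (- 2 * s) \<le> real M powr (- 2 * s)"
      proof -
        have "2 powr (- 2 * s) * x powr (- 2 * s) = (2 * x) powr (- 2 * s)"
          by (rule powr_mult[symmetric])
        also have "\<dots> \<le> real M powr (- 2 * s)"
          using Mx M s by (intro powr_mono2') auto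
        finally show ?thesis .
      qed
      have "c = x powr (2 * s) * (std_normal_density 1 / 8 * (\<kappa> * (2 powr (- 2 * s) * x powr (- 2 * s))))"
      proof -
        have "x powr (2 * s) * x powr (- 2 * s) = 1" using x by (simp add: powr_add[symmetric])
        then show ?thesis by (simp add: c_def)
      qed
      also have "\<dots> \<le> x powr (2 * s) * (std_normal_density 1 / 8 * (\<kappa> * real M powr (- 2 * s)))"
        using e3 \<kappa>(1) by (intro mult_left_mono) auto
      also have "\<dots> = x powr (2 * s) * (std_normal_density 1 / 8 * \<tau>\<^sup>2 * real (card S))"
        by (simp only: mult.assoc e2)
      finally show ?thesis
        unfolding e1 by (simp add: ennreal_mult'[symmetric] ennreal_leI)
    qed
    ultimately show ?thesis by (rule order_trans[rotated])
  qed
  then have "\<forall>\<^sub>F n in sequentially. ennreal c \<le> ennreal (real n powr (2 * s / (2 * s + 3))) *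
     (INF ghat\<in>estimators. SUP f\<in>fun_class a L. risk P W n ghat f)"
    by (rule eventually_mono[OF eventually_ge_at_top[of "1::nat"]])
  then have le: "ennreal c \<le> liminf (\<lambda>n. ennreal (real n powr (2 * s / (2 * s + 3))) *
     (INF ghat\<in>estimators. SUP f\<in>fun_class a L. risk P W n ghat f))"
    by (rule Liminf_bounded)
  have "0 < ennreal c" using c by simp
  then show ?thesis using le by (rule order_less_le_trans)
qed

theorem corollary2:
  fixes d :: nat and s L C0 C1 :: real and a :: "nat \<Rightarrow> nat \<Rightarrow> real"
    and P :: "'w measure" and W :: "(real \<times> real \<Rightarrow> real) \<Rightarrow> 'w \<Rightarrow> real"
  assumes "d = 2"
    and "L > 0" and "s > 0" and "C0 > 0" and "C1 > 0"
    and "\<And>j1 j2. (j1, j2) \<noteq> (0, 0) \<Longrightarrow>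
           C0 * real (j1 + j2) powr s \<le> a j1 j2 \<and> a j1 j2 \<le> C1 * real (j1 + j2) powr s"
    and "white_noise cyl P W"
  shows "(\<forall>T fhat. admissible_nets (fun_class a L) s d T \<longrightarrow>
            (\<forall>n\<ge>1. is_net_estimator
               (net_funs (T (real n powr (- s / (2 * s + 2 * real d - 1))))) (fhat n)) \<longrightarrow>
            limsup (\<lambda>n. ennreal (real n powr (2 * s / (2 * s + 2 * real d - 1))) *
              (SUP f\<in>fun_class a L. risk P W n (fhat n) f)) < \<infinity>) \<and>
         liminf (\<lambda>n. ennreal (real n powr (2 * s / (2 * s + 2 * real d - 1))) *
           (INF ghat\<in>estimators. SUP f\<in>fun_class a L. risk P W n ghat f)) > 0"
proof -
  have e: "2 * s + 2 * real d - 1 = 2 * s + 3" using assms(1) by simp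
  have F: "fun_class a L \<subseteq> L2 disk" by (auto simp: fun_class_def)
  have a: "\<bar>a j k\<bar> \<le> C1 * real (j + k) powr s" if "(j, k) \<noteq> (0, 0)" for j k
  proof -
    \<comment> \<open>The lower bound makes the weights nonnegative, so the upper bound also
      controls their absolute values.\<close>
    have "0 \<le> C0 * real (j + k) powr s" using assms(4) by simp
    then show ?thesis using assms(6)[OF that] by linarith
  qed
  show ?thesis
    unfolding e
    using net_estimator_upper_bound[OF assms(3,7) F] minimax_lower_bound[OF assms(2,3,5,7) a]
    unfolding assms(1) by blast
qed

end
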